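(* Let $\sigma:\mathbb{R}\to(0,\infty)$ be Lipschitz continuous with $0<\inf_{\mathbb{R}}\sigma\le\sup_{\mathbb{R}}\sigma<\infty$, let $b:\mathbb{R}\to(0,\infty)$ be locally Lipschitz continuous and nondecreasing, and let $u_0:\mathbb{R}\to\mathbb{R}$ be a non-random bounded function. Suppose that $$\int_1^\infty\frac{\mathrm{d}y}{b(y)}<\infty .$$ Let $u$ be the minimal solution of the stochastic heat equation $$\partial_t u(t,x)=\tfrac12\partial_x^2u(t,x)+b(u(t,x))+\sigma(u(t,x))\,\dot W(t,x)\quad\text{for }(t,x)\in(0,\infty)\times\mathbb{R},\qquad u(0,x)=u_0(x)\quad\text{for }x\in\mathbb{R},$$ where $\dot W$ is space-time white noise. Then $u$ blows up everywhere and instantaneously almost surely, that is, $$\mathrm{P}\{u(t,x)=\infty\ \text{for every } t>0 \text{ and } x\in\mathbb{R}\}=1 .$$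
   Context: Space-time white noise $\dot W$ is the centered generalized Gaussian random field with $\mathrm{Cov}[\dot W(t,x),\dot W(s,y)]=\delta_0(t-s)\delta_0(x-y)$ for $t,s\ge0$, $x,y\in\mathbb{R}$. Predictability is with respect to the filtration of the noise (assumed to satisfy the usual conditions), and stochastic integrals against $W(\mathrm{d}s\,\mathrm{d}y)$ are Walsh integrals. Write $p_r(z)=(2\pi r)^{-1/2}\exp\{-z^2/(2r)\}$ for $r>0$, $z\in\mathbb{R}$, and let $*$ denote convolution in space. A random field solution with drift $b$ is a predictable random field $u$ satisfying $$u(t,x)=(p_t*u_0)(x)+\int_{(0,t)\times\mathbb{R}}p_{t-s}(y-x)b(u(s,y))\,\mathrm{d}s\,\mathrm{d}y+\int_{(0,t)\times\mathbb{R}}p_{t-s}(y-x)\sigma(u(s,y))\,W(\mathrm{d}s\,\mathrm{d}y).$$ Let $\mathscr{L}$ be the set of all nondecreasing, (globally) Lipschitz continuous functions $c:\mathbb{R}\to(0,\infty)$. For $c\in\mathscr{L}$, let $u_c$ denote the (continuous) random field solution with drift $c$ in place of $b$ (same $\sigma$, $u_0$, $W$) satisfying $\sup_{t\in(0,T)}\sup_{x\in\mathbb{R}}\mathrm{E}(|u_c(t,x)|^2)<\infty$ for all $T>0$; it exists and is unique by classical theory, and $\mathrm{P}\{u_c\le u_{c'}\}=1$ whenever $c,c'\in\mathscr{L}$ and $c\le c'$. Minimal solution: put $b^{(n)}=\min(b,n)$ for $n\in\mathbb{N}$; the paper takes $b^{(n)}\in\mathscr{L}$. The random fields $u_{b^{(n)}}$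 are nondecreasing in $n$, and the minimal solution is the $(-\infty,\infty]$-valued random field $u=\lim_{n\to\infty}u_{b^{(n)}}$. Equivalently, $u=\sup\{u_c:\ c\in\mathscr{L},\ c\le b\}$. *)

theory Defs
  imports "HOL-Probability.Probability"
begin

section \<open>Space-time white noise\<close>

text \<open>
  The noise is indexed by \<open>L\<^sup>2([0,\<infinity>) \<times> \<real>)\<close>: \<open>W \<phi>\<close> stands for \<open>\<integral> \<phi> dW\<close>, and functions on the
  half-plane \<open>[0,\<infinity>) \<times> \<real>\<close>, with points \<open>(time, space)\<close>, are extended by \<open>0\<close> to \<open>\<real> \<times> \<real>\<close>.
\<close>

definition L2_halfplane :: "(real \<times> real \<Rightarrow> real) set" where
  "L2_halfplane = {\<phi> \<in> borel_measurable borel.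
     integrable lborel (\<lambda>z. (\<phi> z)\<^sup>2) \<and> (\<forall>s y. s < 0 \<longrightarrow> \<phi> (s, y) = 0)}"

text \<open>Constants count as (degenerate) Gaussian random variables.\<close>

definition gaussian_rv :: "'a measure \<Rightarrow> ('a \<Rightarrow> real) \<Rightarrow> bool" where
  "gaussian_rv M X \<longleftrightarrow> X \<in> borel_measurable M \<and>
     (\<exists>m. (AE \<omega> in M. X \<omega> = m) \<or>
          (\<exists>s>0. distributed M lborel X (\<lambda>x. ennreal (normal_density m s x))))"

text \<open>
  The covariance \<open>\<delta>\<^sub>0(t - s) \<delta>\<^sub>0(x - y)\<close>, tested against \<open>\<phi> \<otimes> \<psi>\<close>, is the \<open>L\<^sup>2\<close> inner product of \<open>\<phi>\<close>
  and \<open>\<psi>\<close>.  Linearity of \<open>W\<close> up to null sets is a consequence of the covariance formula.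
\<close>

definition white_noise :: "'a measure \<Rightarrow> ((real \<times> real \<Rightarrow> real) \<Rightarrow> 'a \<Rightarrow> real) \<Rightarrow> bool" where
  "white_noise M W \<longleftrightarrow>
     (\<forall>\<Phi> a. finite \<Phi> \<and> \<Phi> \<subseteq> L2_halfplane \<longrightarrow> gaussian_rv M (\<lambda>\<omega>. \<Sum>\<phi>\<in>\<Phi>. a \<phi> * W \<phi> \<omega>)) \<and>
     (\<forall>\<phi>\<in>L2_halfplane. (\<integral>\<omega>. W \<phi> \<omega> \<partial>M) = 0) \<and>
     (\<forall>\<phi>\<in>L2_halfplane. \<forall>\<psi>\<in>L2_halfplane.
        (\<integral>\<omega>. W \<phi> \<omega> * W \<psi> \<omega> \<partial>M) = (\<integral>z. \<phi> z * \<psi> z \<partial>lborel))"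

text \<open>
  The filtration of the noise, augmented by the null sets and made right-continuous, so that it
  satisfies the usual conditions whenever \<open>M\<close> is complete.
\<close>

definition noise_history ::
  "'a measure \<Rightarrow> ((real \<times> real \<Rightarrow> real) \<Rightarrow> 'a \<Rightarrow> real) \<Rightarrow> real \<Rightarrow> 'a set set" where
  "noise_history M W t = sigma_sets (space M)
     ({W \<phi> -` B \<inter> space M | \<phi> B.
         \<phi> \<in> L2_halfplane \<and> (\<forall>s y. t < s \<longrightarrow> \<phi> (s, y) = 0) \<and> B \<in> sets borel}
      \<union> null_sets M)"

definition noise_filtration ::
  "'a measure \<Rightarrow> ((real \<times> real \<Rightarrow> real) \<Rightarrow> 'a \<Rightarrow> real) \<Rightarrow> real \<Rightarrow> 'a measure" where
  "noise_filtration M W t = sigma (space M) (\<Inter>r\<in>{t<..}. noise_history M W r)"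


section \<open>Predictability and Walsh integrals\<close>

definition predictable_sigma ::
  "'a measure \<Rightarrow> ((real \<times> real \<Rightarrow> real) \<Rightarrow> 'a \<Rightarrow> real) \<Rightarrow> (real \<times> real \<times> 'a) measure" where
  "predictable_sigma M W = sigma ({0<..} \<times> UNIV \<times> space M)
     {{r<..t} \<times> A \<times> G | r t A G. 0 \<le> r \<and> r \<le> t \<and> A \<in> sets borel \<and> G \<in> sets (noise_filtration M W r)}"

definition predictable ::
  "'a measure \<Rightarrow> ((real \<times> real \<Rightarrow> real) \<Rightarrow> 'a \<Rightarrow> real) \<Rightarrow> (real \<Rightarrow> real \<Rightarrow> 'a \<Rightarrow> real) \<Rightarrow> bool" where
  "predictable M W u \<longleftrightarrow> (\<lambda>(s, y, \<omega>). u s y \<omega>) \<in> borel_measurable (predictable_sigma M W)"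

text \<open>
  A tuple \<open>(X, r, t, A)\<close> encodes the elementary integrand \<open>X(\<omega>) 1\<^bsub>(r,t]\<^esub>(s) 1\<^bsub>A\<^esub>(y)\<close>, and a list of tuples
  the simple integrand that is the sum of its entries.
\<close>

type_synonym 'a elementary = "('a \<Rightarrow> real) \<times> real \<times> real \<times> real set"

definition elementary_integrand ::
  "'a measure \<Rightarrow> ((real \<times> real \<Rightarrow> real) \<Rightarrow> 'a \<Rightarrow> real) \<Rightarrow> 'a elementary \<Rightarrow> bool" where
  "elementary_integrand M W = (\<lambda>(X, r, t, A).
     X \<in> borel_measurable (noise_filtration M W r) \<and> bounded (X ` space M) \<and>
     0 \<le> r \<and> r \<le> t \<and> A \<in> sets borel \<and> emeasure lborel A < \<infinity>)"

definition simple_value :: "'a elementary list \<Rightarrow> real \<Rightarrow> real \<Rightarrow> 'a \<Rightarrow> real" where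
  "simple_value S s y \<omega> =
     (\<Sum>(X, r, t, A)\<leftarrow>S. X \<omega> * indicat_real {r<..t} s * indicat_real A y)"

definition simple_integral ::
  "((real \<times> real \<Rightarrow> real) \<Rightarrow> 'a \<Rightarrow> real) \<Rightarrow> 'a elementary list \<Rightarrow> 'a \<Rightarrow> real" where
  "simple_integral W S \<omega> = (\<Sum>(X, r, t, A)\<leftarrow>S. X \<omega> * W (indicat_real ({r<..t} \<times> A)) \<omega>)"

text \<open>
  \<open>I\<close> is (a version of) the Walsh integral of \<open>g\<close> over \<open>(0,\<infinity>) \<times> \<real>\<close>: the \<open>L\<^sup>2\<close> limit of the integrals of
  simple integrands that approximate the predictable field \<open>g\<close> in \<open>L\<^sup>2(ds dy dP)\<close>.  By the isometry
  \<open>I\<close> is unique up to null sets, and such a \<open>g\<close> has finite \<open>L\<^sup>2(ds dy dP)\<close> norm.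
\<close>

definition has_walsh_integral ::
  "'a measure \<Rightarrow> ((real \<times> real \<Rightarrow> real) \<Rightarrow> 'a \<Rightarrow> real) \<Rightarrow>
   (real \<Rightarrow> real \<Rightarrow> 'a \<Rightarrow> real) \<Rightarrow> ('a \<Rightarrow> real) \<Rightarrow> bool" where
  "has_walsh_integral M W g I \<longleftrightarrow> predictable M W g \<and> I \<in> borel_measurable M \<and>
     (\<exists>S :: nat \<Rightarrow> 'a elementary list.
        (\<forall>n. \<forall>e\<in>set (S n). elementary_integrand M W e) \<and>
        (\<lambda>n. \<integral>\<^sup>+\<omega>. (\<integral>\<^sup>+z\<in>{0<..} \<times> UNIV.
            (case z of (s, y) \<Rightarrow> ennreal ((simple_value (S n) s y \<omega> - g s y \<omega>)\<^sup>2)) \<partial>lborel) \<partial>M)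
          \<longlonglongrightarrow> 0 \<and>
        (\<lambda>n. \<integral>\<^sup>+\<omega>. ennreal ((simple_integral W (S n) \<omega> - I \<omega>)\<^sup>2) \<partial>M) \<longlonglongrightarrow> 0)"


section \<open>The stochastic heat equation\<close>

definition heat_kernel :: "real \<Rightarrow> real \<Rightarrow> real" where
  "heat_kernel r z = exp (- z\<^sup>2 / (2 * r)) / sqrt (2 * pi * r)"

text \<open>
  The mild formulation.  The initial datum is only assumed Lebesgue measurable, which is why its
  convolution with the heat kernel is an integral with respect to \<open>lebesgue\<close>.
\<close>

definition random_field_solution ::
  "'a measure \<Rightarrow> ((real \<times> real \<Rightarrow> real) \<Rightarrow> 'a \<Rightarrow> real) \<Rightarrow> (real \<Rightarrow> real) \<Rightarrow> (real \<Rightarrow> real) \<Rightarrow>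
   (real \<Rightarrow> real) \<Rightarrow> (real \<Rightarrow> real \<Rightarrow> 'a \<Rightarrow> real) \<Rightarrow> bool" where
  "random_field_solution M W \<sigma> c u\<^sub>0 u \<longleftrightarrow> predictable M W u \<and>
     (\<forall>t>0. \<forall>x. \<exists>I.
        has_walsh_integral M W
          (\<lambda>s y \<omega>. indicat_real {0<..<t} s * (heat_kernel (t - s) (y - x) * \<sigma> (u s y \<omega>))) I \<and>
        (AE \<omega> in M.
          set_integrable lborel ({0<..<t} \<times> UNIV)
            (\<lambda>(s, y). heat_kernel (t - s) (y - x) * c (u s y \<omega>)) \<and>
          u t x \<omega> = (\<integral>y. heat_kernel t (x - y) * u\<^sub>0 y \<partial>lebesgue)
            + (LINT z:{0<..<t} \<times> UNIV|lborel.
                 (case z of (s, y) \<Rightarrow> heat_kernel (t - s) (y - x) * c (u s y \<omega>)))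
            + I \<omega>))"

text \<open>The solution \<open>u\<^bsub>c\<^esub>\<close>: almost surely continuous, with locally bounded second moments.\<close>

definition classical_solution ::
  "'a measure \<Rightarrow> ((real \<times> real \<Rightarrow> real) \<Rightarrow> 'a \<Rightarrow> real) \<Rightarrow> (real \<Rightarrow> real) \<Rightarrow> (real \<Rightarrow> real) \<Rightarrow>
   (real \<Rightarrow> real) \<Rightarrow> (real \<Rightarrow> real \<Rightarrow> 'a \<Rightarrow> real) \<Rightarrow> bool" where
  "classical_solution M W \<sigma> c u\<^sub>0 u \<longleftrightarrow> random_field_solution M W \<sigma> c u\<^sub>0 u \<and>
     (AE \<omega> in M. continuous_on ({0<..} \<times> UNIV) (\<lambda>(t, x). u t x \<omega>)) \<and>
     (\<forall>T>0. (SUP t\<in>{0<..<T}. SUP x. \<integral>\<^sup>+\<omega>. ennreal (\<bar>u t x \<omega>\<bar>\<^sup>2) \<partial>M) < \<infinity>)"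

text \<open>
  The minimal solution is \<open>lim u\<^bsub>min(b,n)\<^esub>\<close> as \<open>n \<rightarrow> \<infinity>\<close>.  The truncation level starts at \<open>n = 1\<close>, so that the
  truncated drifts are positive.  A locally Lipschitz nondecreasing \<open>b > 0\<close> can have unbounded slopes
  near \<open>-\<infinity>\<close>, so that \<open>min(b,n)\<close> need not be globally Lipschitz; this is not required here.  When it is,
  \<open>u\<^bsub>min(b,n)\<^esub>\<close> is determined up to a null set that does not depend on \<open>(t, x)\<close>, and so is the limit.
\<close>

definition minimal_solution ::
  "'a measure \<Rightarrow> ((real \<times> real \<Rightarrow> real) \<Rightarrow> 'a \<Rightarrow> real) \<Rightarrow> (real \<Rightarrow> real) \<Rightarrow> (real \<Rightarrow> real) \<Rightarrow>
   (real \<Rightarrow> real) \<Rightarrow> (real \<Rightarrow> real \<Rightarrow> 'a \<Rightarrow> ereal) \<Rightarrow> bool" where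
  "minimal_solution M W \<sigma> b u\<^sub>0 u \<longleftrightarrow>
     (\<exists>v :: nat \<Rightarrow> real \<Rightarrow> real \<Rightarrow> 'a \<Rightarrow> real.
        (\<forall>n\<ge>1. classical_solution M W \<sigma> (\<lambda>y. min (b y) (real n)) u\<^sub>0 (v n)) \<and>
        (AE \<omega> in M. \<forall>t>0. \<forall>x. (\<lambda>n. ereal (v n t x \<omega>)) \<longlonglongrightarrow> u t x \<omega>))"

definition locally_lipschitz :: "(real \<Rightarrow> real) \<Rightarrow> bool" where
  "locally_lipschitz f \<longleftrightarrow> local_lipschitz (UNIV :: real set) UNIV (\<lambda>_. f)"

end

theory Submission
  imports Defs
begin

text \<open>
  The truncated solutions satisfy \<open>v\<^sub>n = p\<^sub>t * u\<^sub>0 + drift + Z\<close> with a stochastic convolution \<open>Z\<close>.  Neither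
  comparison nor monotonicity in \<open>n\<close> is needed: by Borel-Cantelli it suffices that, on each compact box and for
  each level \<open>K\<close>, \<open>v\<^sub>n \<ge> K\<close> with probability tending to \<open>1\<close>.

  Under the density \<open>D = exp (h W(1\<^sub>R) - h\<^sup>2 |R| / 2)\<close> of a rectangle \<open>R = (0, t\<^sub>0] \<times> (c - 1, c + 1]\<close>, the field \<open>Z\<close> is at
  least \<open>h (inf \<sigma>)\<close> times the integral of the heat kernel over \<open>R\<close>, up to an error that an exponential
  supermartingale bound and chaining control uniformly in \<open>n\<close> and \<open>c\<close>.  If \<open>h\<close> is large, the Osgood condition then
  drives \<open>v\<^sub>n\<close> through all levels below the truncation on this island before time \<open>t\<^sub>0\<close>.  The densities of disjoint
  islands are orthogonal, so that their average over many islands is close to \<open>1\<close> in \<open>L\<^sup>2\<close>; hence with high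
  probability under the original law there is such an island.  There \<open>b(v\<^sub>n)\<close> is huge, and the heat kernel spreads it
  to the whole box.
\<close>

section \<open>Gaussian calculus for white noise\<close>

text \<open>The order in which the constants are chosen carries the argument. The chaining error
  depends on the bound for \<open>\<sigma>\<close>, the box and the tolerated probability, but not
  on \<open>h\<close>, the island, the solution or the truncation. So \<open>h\<close> can be fixed
  afterwards, large enough to lift the island above the fluctuations. The second moment exp (h^2
  |R|) of its density is then just a number, against which the number of islands is taken large.
  That number bounds the distance from the islands to the box, the distance fixes the loss in the
  heat kernel, the loss fixes the level to be reached, and the truncation is placed above
  \<open>b\<close> at that level. Tilts replace spatial independence: distant parts of the solution
  are in general neither independent nor equally distributed, whereas densities attached to disjoint
  rectangles are exactly uncorrelated. The upper bound of \<open>\<sigma>\<close> bounds quadratic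
  variations by constants, the lower bound turns a tilt into an upward push. The mild equation gives
  \<open>Z\<close> as one random variable per point, with no continuity in the point. It is
  controlled at dyadic points only, and the continuity of \<open>v\<^sub>n\<close> fills in the
  rest.\<close>

abbreviation ip :: "(real \<times> real \<Rightarrow> real) \<Rightarrow> (real \<times> real \<Rightarrow> real) \<Rightarrow> real" where
  "ip \<phi> \<psi> \<equiv> \<integral>z. \<phi> z * \<psi> z \<partial>lborel"

lemma integrable_mult_of_squares:
  fixes f g :: "'a \<Rightarrow> real"
  assumes [measurable]: "f \<in> borel_measurable M" "g \<in> borel_measurable M"
    and "integrable M (\<lambda>x. (f x)\<^sup>2)" "integrable M (\<lambda>x. (g x)\<^sup>2)"
  shows "integrable M (\<lambda>x. f x * g x)"
proof (rule Bochner_Integration.integrable_bound[of _ "\<lambda>x. (f x)\<^sup>2 + (g x)\<^sup>2"])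
  show "AE x in M. norm (f x * g x) \<le> norm ((f x)\<^sup>2 + (g x)\<^sup>2)"
  proof (rule AE_I2)
    fix x
    have "2 * (\<bar>f x\<bar> * \<bar>g x\<bar>) \<le> (f x)\<^sup>2 + (g x)\<^sup>2"
      using sum_squares_bound[of "\<bar>f x\<bar>" "\<bar>g x\<bar>"] by (simp add: mult.assoc)
    moreover have "0 \<le> \<bar>f x\<bar> * \<bar>g x\<bar>" by simp
    ultimately have "\<bar>f x\<bar> * \<bar>g x\<bar> \<le> (f x)\<^sup>2 + (g x)\<^sup>2" by linarith
    then show "norm (f x * g x) \<le> norm ((f x)\<^sup>2 + (g x)\<^sup>2)"
      by (simp add: abs_mult)
  qed
qed (use assms in auto)

lemma L2_halfplaneD:
  assumes "\<phi> \<in> L2_halfplane"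
  shows "\<phi> \<in> borel_measurable borel" "integrable lborel (\<lambda>z. (\<phi> z)\<^sup>2)" "s < 0 \<Longrightarrow> \<phi> (s, y) = 0"
  using assms by (auto simp: L2_halfplane_def)

lemma integrable_ip:
  assumes "\<phi> \<in> L2_halfplane" "\<psi> \<in> L2_halfplane"
  shows "integrable lborel (\<lambda>z. \<phi> z * \<psi> z)"
  using assms by (intro integrable_mult_of_squares) (auto simp: L2_halfplane_def)

lemma L2_halfplane_lincomb:
  assumes "\<phi> \<in> L2_halfplane" "\<psi> \<in> L2_halfplane"
  shows "(\<lambda>z. a * \<phi> z + b * \<psi> z) \<in> L2_halfplane"
proof -
  have [measurable]: "\<phi> \<in> borel_measurable borel" "\<psi> \<in> borel_measurable borel"
    using assms by (auto dest: L2_halfplaneD)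
  have "integrable lborel (\<lambda>z. a\<^sup>2 * (\<phi> z)\<^sup>2 + 2 * a * b * (\<phi> z * \<psi> z) + b\<^sup>2 * (\<psi> z)\<^sup>2)"
    using assms by (intro Bochner_Integration.integrable_add integrable_mult_right integrable_ip L2_halfplaneD)
  also have "(\<lambda>z. a\<^sup>2 * (\<phi> z)\<^sup>2 + 2 * a * b * (\<phi> z * \<psi> z) + b\<^sup>2 * (\<psi> z)\<^sup>2) = (\<lambda>z. (a * \<phi> z + b * \<psi> z)\<^sup>2)"
    by (auto simp: fun_eq_iff power2_eq_square algebra_simps)
  finally show ?thesis
    using assms by (auto simp: L2_halfplane_def)
qed

lemma L2_halfplane_add:
  "\<phi> \<in> L2_halfplane \<Longrightarrow> \<psi> \<in> L2_halfplane \<Longrightarrow> (\<lambda>z. \<phi> z + \<psi> z) \<in> L2_halfplane"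
  using L2_halfplane_lincomb[of \<phi> \<psi> 1 1] by simp

lemma L2_halfplane_scale: "\<phi> \<in> L2_halfplane \<Longrightarrow> (\<lambda>z. a * \<phi> z) \<in> L2_halfplane"
  using L2_halfplane_lincomb[of \<phi> \<phi> a 0] by simp

lemma L2_halfplane_zero: "(\<lambda>z. 0) \<in> L2_halfplane"
  by (simp add: L2_halfplane_def)

lemma L2_halfplane_sum:
  "(\<And>i. i \<in> I \<Longrightarrow> \<phi> i \<in> L2_halfplane) \<Longrightarrow> (\<lambda>z. \<Sum>i\<in>I. a i * \<phi> i z) \<in> L2_halfplane"
proof (induction I rule: infinite_finite_induct)
  case (insert x F)
  have "(\<lambda>z. a x * \<phi> x z + 1 * (\<Sum>i\<in>F. a i * \<phi> i z)) \<in> L2_halfplane"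
    by (intro L2_halfplane_lincomb insert) (auto simp: insert)
  then show ?case using insert by simp
qed (simp_all add: L2_halfplane_zero)

lemma L2_halfplane_indicator:
  assumes "0 \<le> r" "A \<in> sets borel" "emeasure lborel A < \<infinity>"
  shows "indicat_real ({r<..t} \<times> A) \<in> L2_halfplane"
proof -
  have [measurable]: "A \<in> sets borel" by fact
  have [measurable]: "{r<..t} \<times> A \<in> sets borel"
    unfolding borel_prod[symmetric] by (intro pair_measureI) auto
  have "emeasure lborel ({r<..t} \<times> A) = emeasure lborel {r<..t} * emeasure lborel A"
    unfolding lborel_prod[symmetric] by (intro lborel.emeasure_pair_measure_Times) auto
  also have "\<dots> < \<infinity>"
    using assms(3) by (cases "r \<le> t") (auto simp: ennreal_mult_less_top)
  finally have "integrable lborel (indicat_real ({r<..t} \<times> A))"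
    by (intro integrable_real_indicator) (auto simp: borel_prod[symmetric])
  moreover have "(\<lambda>z. (indicat_real ({r<..t} \<times> A) z)\<^sup>2) = indicat_real ({r<..t} \<times> A)"
    by (auto simp: fun_eq_iff indicator_def)
  ultimately show ?thesis
    using assms(1) by (auto simp: L2_halfplane_def)
qed

section \<open>Centred Gaussian variables and their transforms\<close>

context prob_space
begin

lemma mgf_normal:
  assumes "s > 0" "distributed M lborel X (\<lambda>x. ennreal (normal_density 0 s x))"
  shows "(\<integral>\<^sup>+\<omega>. ennreal (exp (X \<omega>)) \<partial>M) = ennreal (exp (s\<^sup>2 / 2))"
proof -
  have "(\<integral>\<^sup>+\<omega>. ennreal (exp (X \<omega>)) \<partial>M)
     = (\<integral>\<^sup>+x. ennreal (normal_density 0 s x) * ennreal (exp x) \<partial>lborel)"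
    by (subst distributed_nn_integral[OF assms(2)]) auto
  also have "\<dots> = (\<integral>\<^sup>+x. ennreal (exp (s\<^sup>2 / 2)) * ennreal (normal_density (s\<^sup>2) s x) \<partial>lborel)"
  proof (intro nn_integral_cong)
    fix x
    \<comment> \<open>Completing the square: the weight \<open>exp x\<close> moves the mean of the
      normal density from 0 to \<open>s\<^sup>2\<close>.\<close>
    have "- x\<^sup>2 / (2 * s\<^sup>2) + x = s\<^sup>2 / 2 + (- (x - s\<^sup>2)\<^sup>2 / (2 * s\<^sup>2))"
      using assms(1) by (simp add: field_simps power2_eq_square)
    then have "exp (- x\<^sup>2 / (2 * s\<^sup>2)) * exp x = exp (s\<^sup>2 / 2) * exp (- (x - s\<^sup>2)\<^sup>2 / (2 * s\<^sup>2))"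
      by (simp add: exp_add[symmetric])
    then have "normal_density 0 s x * exp x = exp (s\<^sup>2 / 2) * normal_density (s\<^sup>2) s x"
      by (simp add: normal_density_def)
    then show "ennreal (normal_density 0 s x) * ennreal (exp x) = ennreal (exp (s\<^sup>2 / 2)) * ennreal (normal_density (s\<^sup>2) s x)"
      by (simp add: ennreal_mult'[symmetric])
  qed
  also have "\<dots> = ennreal (exp (s\<^sup>2 / 2)) * (\<integral>\<^sup>+x. ennreal (normal_density (s\<^sup>2) s x) \<partial>lborel)"
    by (intro nn_integral_cmult) auto
  also have "(\<integral>\<^sup>+x. ennreal (normal_density (s\<^sup>2) s x) \<partial>lborel) = 1"
    using assms(1) by (subst nn_integral_eq_integral) auto
  finally show ?thesis by simp
qed

text \<open>Rescaling to a standard normal variable, whose characteristic function is evaluated at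
  \<open>s\<close>.\<close>

lemma char_normal:
  assumes "s > 0" "distributed M lborel X (\<lambda>x. ennreal (normal_density 0 s x))"
  shows "(CLINT \<omega>|M. iexp (X \<omega>)) = exp (- (s\<^sup>2) / 2)"
proof -
  have X[measurable]: "X \<in> borel_measurable M"
    using distributed_measurable[OF assms(2)] by simp
  have D: "distributed M lborel (\<lambda>\<omega>. X \<omega> / s) std_normal_density"
    using normal_standard_normal_convert[of s X 0] assms by simp
  have "distr M borel (\<lambda>\<omega>. X \<omega> / s) = std_normal_distribution"
    using distributed_distr_eq_density[OF D]
    by (metis (no_types, lifting) distr_cong sets_lborel)
  then have "char (distr M borel (\<lambda>\<omega>. X \<omega> / s)) s = complex_of_real (exp (- (s\<^sup>2) / 2))"
    by (simp add: char_std_normal_distribution)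
  moreover have "char (distr M borel (\<lambda>\<omega>. X \<omega> / s)) s = (CLINT \<omega>|M. iexp (X \<omega>))"
    unfolding char_def using assms(1) by (subst integral_distr) auto
  ultimately show ?thesis by simp
qed

lemma gaussian_centered_cases:
  assumes "gaussian_rv M X" "expectation X = 0"
  obtains "AE \<omega> in M. X \<omega> = 0"
  | s where "s > 0" "distributed M lborel X (\<lambda>x. ennreal (normal_density 0 s x))"
      "expectation (\<lambda>\<omega>. (X \<omega>)\<^sup>2) = s\<^sup>2" "integrable M (\<lambda>\<omega>. (X \<omega>)\<^sup>2)"
proof -
  have [measurable]: "X \<in> borel_measurable M" using assms by (simp add: gaussian_rv_def)
  from assms(1) obtain m where
    "(AE \<omega> in M. X \<omega> = m) \<or> (\<exists>s>0. distributed M lborel X (\<lambda>x. ennreal (normal_density m s x)))"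
    by (auto simp: gaussian_rv_def)
  then show thesis
  proof
    assume ae: "AE \<omega> in M. X \<omega> = m"
    then have "expectation X = expectation (\<lambda>_. m)"
      by (intro integral_cong_AE) auto
    then have "m = 0" using assms(2) by (simp add: prob_space)
    with ae that(1) show thesis by simp
  next
    assume "\<exists>s>0. distributed M lborel X (\<lambda>x. ennreal (normal_density m s x))"
    then obtain s where s: "s > 0" "distributed M lborel X (\<lambda>x. ennreal (normal_density m s x))" by auto
    then have "m = 0" using normal_distributed_expectation[OF s(1) s(2)] assms(2) by simp
    with s have d: "distributed M lborel X (\<lambda>x. ennreal (normal_density 0 s x))" by simp
    have v: "expectation (\<lambda>\<omega>. (X \<omega>)\<^sup>2) = s\<^sup>2"
      using normal_distributed_variance[OF s(1) d] assms(2) by simp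
    \<comment> \<open>The Bochner integral of a non-integrable function is 0 by convention, so a
      positive variance already forces integrability.\<close>
    have i: "integrable M (\<lambda>\<omega>. (X \<omega>)\<^sup>2)"
    proof (rule ccontr)
      assume "\<not> integrable M (\<lambda>\<omega>. (X \<omega>)\<^sup>2)"
      then have "expectation (\<lambda>\<omega>. (X \<omega>)\<^sup>2) = 0" by (rule not_integrable_integral_eq)
      with v s show False by simp
    qed
    show thesis by (rule that(2)[OF s(1) d v i])
  qed
qed

lemma gaussian_square_integrable:
  assumes "gaussian_rv M X" "expectation X = 0"
  shows "integrable M (\<lambda>\<omega>. (X \<omega>)\<^sup>2)"
  using assms
proof (cases rule: gaussian_centered_cases)
  case 1
  have [measurable]: "X \<in> borel_measurable M" using assms by (simp add: gaussian_rv_def)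
  have "integrable M (\<lambda>\<omega>. (X \<omega>)\<^sup>2) \<longleftrightarrow> integrable M (\<lambda>_. 0::real)"
    using 1 by (intro integrable_cong_AE) auto
  then show ?thesis by simp
qed

lemma gaussian_mgf_char:
  assumes "gaussian_rv M X" "expectation X = 0" "expectation (\<lambda>\<omega>. (X \<omega>)\<^sup>2) = v"
  shows "(\<integral>\<^sup>+\<omega>. ennreal (exp (X \<omega>)) \<partial>M) = ennreal (exp (v / 2))"
    and "(CLINT \<omega>|M. iexp (X \<omega>)) = exp (- v / 2)"
proof -
  have [measurable]: "X \<in> borel_measurable M" using assms by (simp add: gaussian_rv_def)
  have "(\<integral>\<^sup>+\<omega>. ennreal (exp (X \<omega>)) \<partial>M) = ennreal (exp (v / 2)) \<and> (CLINT \<omega>|M. iexp (X \<omega>)) = exp (- v / 2)"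
    using assms(1,2)
  proof (cases rule: gaussian_centered_cases)
    case 1
    have "expectation (\<lambda>\<omega>. (X \<omega>)\<^sup>2) = expectation (\<lambda>_. 0)"
      using 1 by (intro integral_cong_AE) auto
    then have v: "v = 0" using assms(3) by simp
    have "(\<integral>\<^sup>+\<omega>. ennreal (exp (X \<omega>)) \<partial>M) = (\<integral>\<^sup>+\<omega>. 1 \<partial>M)"
      using 1 by (intro nn_integral_cong_AE) auto
    moreover have "(CLINT \<omega>|M. iexp (X \<omega>)) = (CLINT \<omega>|M. 1)"
      using 1 by (intro integral_cong_AE) auto
    ultimately show ?thesis using v by (simp add: emeasure_space_1 prob_space)
  next
    case (2 s)
    then show ?thesis using mgf_normal[of s X] char_normal[of s X] assms(3) by simp
  qed
  then show "(\<integral>\<^sup>+\<omega>. ennreal (exp (X \<omega>)) \<partial>M) = ennreal (exp (v / 2))"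
    and "(CLINT \<omega>|M. iexp (X \<omega>)) = exp (- v / 2)" by auto
qed

end

section \<open>The noise as a linear isometry, up to null sets\<close>

locale noise_space = prob_space M for M :: "'a measure" +
  fixes W :: "(real \<times> real \<Rightarrow> real) \<Rightarrow> 'a \<Rightarrow> real"
  assumes noise: "white_noise M W"
begin

lemma W_gaussian: "\<phi> \<in> L2_halfplane \<Longrightarrow> gaussian_rv M (W \<phi>)"
  using noise unfolding white_noise_def
  by (auto dest!: conjunct1 spec[of _ "{\<phi>}"] spec[of _ "\<lambda>_. 1::real"])

lemma W_measurable [measurable]: "\<phi> \<in> L2_halfplane \<Longrightarrow> W \<phi> \<in> borel_measurable M"
  using W_gaussian by (auto simp: gaussian_rv_def)

lemma W_mean: "\<phi> \<in> L2_halfplane \<Longrightarrow> expectation (W \<phi>) = 0"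
  using noise unfolding white_noise_def by auto

lemma W_cov: "\<phi> \<in> L2_halfplane \<Longrightarrow> \<psi> \<in> L2_halfplane \<Longrightarrow>
    expectation (\<lambda>\<omega>. W \<phi> \<omega> * W \<psi> \<omega>) = ip \<phi> \<psi>"
  using noise unfolding white_noise_def by auto

lemma W_square_integrable: "\<phi> \<in> L2_halfplane \<Longrightarrow> integrable M (\<lambda>\<omega>. (W \<phi> \<omega>)\<^sup>2)"
  by (intro gaussian_square_integrable W_gaussian W_mean)

lemma W_prod_integrable: "\<phi> \<in> L2_halfplane \<Longrightarrow> \<psi> \<in> L2_halfplane \<Longrightarrow>
    integrable M (\<lambda>\<omega>. W \<phi> \<omega> * W \<psi> \<omega>)"
  by (intro integrable_mult_of_squares W_square_integrable W_measurable)

lemma W_mgf: "\<phi> \<in> L2_halfplane \<Longrightarrow> (\<integral>\<^sup>+\<omega>. ennreal (exp (W \<phi> \<omega>)) \<partial>M) = ennreal (exp (ip \<phi> \<phi> / 2))"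
  using W_cov[of \<phi> \<phi>] by (intro gaussian_mgf_char W_gaussian W_mean) (auto simp: power2_eq_square)

lemma W_char: "\<phi> \<in> L2_halfplane \<Longrightarrow> (CLINT \<omega>|M. iexp (W \<phi> \<omega>)) = exp (- ip \<phi> \<phi> / 2)"
  using W_cov[of \<phi> \<phi>] by (intro gaussian_mgf_char W_gaussian W_mean) (auto simp: power2_eq_square)

text \<open>The second moment of the difference of the two sides, expanded by the covariance
  formula, is 0.\<close>

lemma W_lincomb:
  assumes \<phi>: "\<phi> \<in> L2_halfplane" and \<psi>: "\<psi> \<in> L2_halfplane"
  shows "AE \<omega> in M. W (\<lambda>z. a * \<phi> z + b * \<psi> z) \<omega> = a * W \<phi> \<omega> + b * W \<psi> \<omega>"
proof -
  let ?\<chi> = "\<lambda>z. a * \<phi> z + b * \<psi> z"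
  have \<chi>: "?\<chi> \<in> L2_halfplane" using assms by (rule L2_halfplane_lincomb)
  note ms = W_measurable[OF \<phi>] W_measurable[OF \<psi>] W_measurable[OF \<chi>]
  let ?D = "\<lambda>\<omega>. W ?\<chi> \<omega> - a * W \<phi> \<omega> - b * W \<psi> \<omega>"
  let ?E = "\<lambda>\<omega>. W ?\<chi> \<omega> * W ?\<chi> \<omega> - 2 * a * (W ?\<chi> \<omega> * W \<phi> \<omega>) - 2 * b * (W ?\<chi> \<omega> * W \<psi> \<omega>)
      + a\<^sup>2 * (W \<phi> \<omega> * W \<phi> \<omega>) + 2 * a * b * (W \<phi> \<omega> * W \<psi> \<omega>) + b\<^sup>2 * (W \<psi> \<omega> * W \<psi> \<omega>)"
  have eq: "(\<lambda>\<omega>. (?D \<omega>)\<^sup>2) = ?E" by (auto simp: fun_eq_iff power2_eq_square algebra_simps)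
  note I = W_prod_integrable[OF \<chi> \<chi>] W_prod_integrable[OF \<chi> \<phi>] W_prod_integrable[OF \<chi> \<psi>]
    W_prod_integrable[OF \<phi> \<phi>] W_prod_integrable[OF \<phi> \<psi>] W_prod_integrable[OF \<psi> \<psi>]
  have int: "integrable M (\<lambda>\<omega>. (?D \<omega>)\<^sup>2)" unfolding eq using I by auto
  note J = integrable_ip[OF \<phi> \<phi>] integrable_ip[OF \<phi> \<psi>] integrable_ip[OF \<psi> \<psi>]
  have c1: "ip ?\<chi> \<phi> = a * ip \<phi> \<phi> + b * ip \<phi> \<psi>"
  proof -
    have "ip ?\<chi> \<phi> = (\<integral>z. a * (\<phi> z * \<phi> z) + b * (\<phi> z * \<psi> z) \<partial>lborel)"
      by (intro Bochner_Integration.integral_cong) (auto simp: algebra_simps)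
    then show ?thesis using J by simp
  qed
  have c2: "ip ?\<chi> \<psi> = a * ip \<phi> \<psi> + b * ip \<psi> \<psi>"
  proof -
    have "ip ?\<chi> \<psi> = (\<integral>z. a * (\<phi> z * \<psi> z) + b * (\<psi> z * \<psi> z) \<partial>lborel)"
      by (intro Bochner_Integration.integral_cong) (auto simp: algebra_simps)
    then show ?thesis using J by simp
  qed
  have c3: "ip ?\<chi> ?\<chi> = a * ip ?\<chi> \<phi> + b * ip ?\<chi> \<psi>"
  proof -
    have "ip ?\<chi> ?\<chi> = (\<integral>z. a * (?\<chi> z * \<phi> z) + b * (?\<chi> z * \<psi> z) \<partial>lborel)"
      by (intro Bochner_Integration.integral_cong) (auto simp: algebra_simps)
    then show ?thesis using integrable_ip[OF \<chi> \<phi>] integrable_ip[OF \<chi> \<psi>] by simp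
  qed
  have "expectation (\<lambda>\<omega>. (?D \<omega>)\<^sup>2) = ip ?\<chi> ?\<chi> - 2 * a * ip ?\<chi> \<phi> - 2 * b * ip ?\<chi> \<psi>
      + a\<^sup>2 * ip \<phi> \<phi> + 2 * a * b * ip \<phi> \<psi> + b\<^sup>2 * ip \<psi> \<psi>"
    unfolding eq using I W_cov \<phi> \<psi> \<chi> by simp
  also have "\<dots> = 0" unfolding c3 c1 c2 by (simp add: algebra_simps power2_eq_square)
  finally have "AE \<omega> in M. (?D \<omega>)\<^sup>2 = 0"
    using int by (subst (asm) integral_nonneg_eq_0_iff_AE) auto
  then show ?thesis by eventually_elim simp
qed

lemma W_zero: "AE \<omega> in M. W (\<lambda>_. 0) \<omega> = 0"
  using W_lincomb[OF L2_halfplane_zero L2_halfplane_zero, of 0 0] by simp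

lemma W_add: "\<phi> \<in> L2_halfplane \<Longrightarrow> \<psi> \<in> L2_halfplane \<Longrightarrow>
    AE \<omega> in M. W (\<lambda>z. \<phi> z + \<psi> z) \<omega> = W \<phi> \<omega> + W \<psi> \<omega>"
  using W_lincomb[of \<phi> \<psi> 1 1] by simp

lemma W_scale: "\<phi> \<in> L2_halfplane \<Longrightarrow> AE \<omega> in M. W (\<lambda>z. a * \<phi> z) \<omega> = a * W \<phi> \<omega>"
  using W_lincomb[of \<phi> \<phi> a 0] by simp

lemma W_sum:
  "finite I \<Longrightarrow> (\<And>i. i \<in> I \<Longrightarrow> \<phi> i \<in> L2_halfplane) \<Longrightarrow>
    AE \<omega> in M. W (\<lambda>z. \<Sum>i\<in>I. a i * \<phi> i z) \<omega> = (\<Sum>i\<in>I. a i * W (\<phi> i) \<omega>)"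
proof (induction I rule: finite_induct)
  case empty
  then show ?case using W_zero by simp
next
  case (insert x F)
  have "AE \<omega> in M. W (\<lambda>z. a x * \<phi> x z + 1 * (\<Sum>i\<in>F. a i * \<phi> i z)) \<omega> = a x * W (\<phi> x) \<omega> + 1 * W (\<lambda>z. \<Sum>i\<in>F. a i * \<phi> i z) \<omega>"
    by (intro W_lincomb L2_halfplane_sum insert) (auto simp: insert)
  moreover have "AE \<omega> in M. W (\<lambda>z. \<Sum>i\<in>F. a i * \<phi> i z) \<omega> = (\<Sum>i\<in>F. a i * W (\<phi> i) \<omega>)"
    by (rule insert.IH) (use insert.prems in auto)
  ultimately show ?case
    by eventually_elim (use insert.hyps in simp)
qed

end

text \<open>A signed form of Levy's uniqueness theorem. Since \<open>Z\<close> is at most 1 in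
  modulus and has mean 0 (take \<open>\<theta>\<close> = 0), \<open>1 + Z\<close> is a probability
  density; the laws of \<open>Y\<close> under this density and under \<open>M\<close> have the same
  characteristic function, hence coincide.\<close>

lemma (in prob_space) fourier_uniqueness_real:
  fixes Y Z :: "'a \<Rightarrow> real"
  assumes [measurable]: "Y \<in> borel_measurable M" "Z \<in> borel_measurable M"
    and bd: "\<And>\<omega>. \<bar>Z \<omega>\<bar> \<le> 1"
    and ft: "\<And>\<theta>. (CLINT \<omega>|M. complex_of_real (Z \<omega>) * iexp (\<theta> * Y \<omega>)) = 0"
    and B: "B \<in> sets borel"
  shows "expectation (\<lambda>\<omega>. Z \<omega> * indicator B (Y \<omega>)) = 0"
proof -
  have iZ: "integrable M Z"
    by (rule integrable_const_bound[of _ 1]) (use bd in auto)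
  have nn: "0 \<le> 1 + Z \<omega>" for \<omega> using bd[of \<omega>] by linarith
  have "complex_of_real (expectation Z) = 0" using ft[of 0] by simp
  then have EZ: "expectation Z = 0" by simp
  let ?N = "density M (\<lambda>\<omega>. ennreal (1 + Z \<omega>))"
  have N: "prob_space ?N"
  proof (rule prob_spaceI)
    have "emeasure ?N (space ?N) = (\<integral>\<^sup>+\<omega>. ennreal (1 + Z \<omega>) \<partial>M)"
      by (subst emeasure_density) (auto intro!: nn_integral_cong)
    also have "\<dots> = ennreal (expectation (\<lambda>\<omega>. 1 + Z \<omega>))"
      by (rule nn_integral_eq_integral) (use iZ nn in auto)
    also have "expectation (\<lambda>\<omega>. 1 + Z \<omega>) = 1" using iZ EZ by (simp add: prob_space)
    finally show "emeasure ?N (space ?N) = 1" by simp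
  qed
  then interpret N: prob_space ?N .
  have Ym: "Y \<in> measurable ?N borel" by simp
  have ci: "integrable M (\<lambda>\<omega>. iexp (t * Y \<omega>))" for t
    by (rule integrable_const_bound[of _ 1]) auto
  have ciZ: "integrable M (\<lambda>\<omega>. complex_of_real (Z \<omega>) * iexp (t * Y \<omega>))" for t
    by (rule integrable_const_bound[of _ 1]) (use bd in \<open>auto simp: norm_mult\<close>)
  have "char (distr ?N borel Y) = char (distr M borel Y)"
  proof
    fix t
    have "char (distr ?N borel Y) t = (CLINT \<omega>|?N. iexp (t * Y \<omega>))"
      unfolding char_def by (subst integral_distr) auto
    also have "\<dots> = (CLINT \<omega>|M. (1 + Z \<omega>) *\<^sub>R iexp (t * Y \<omega>))"
      by (subst integral_density) (use nn in auto)
    also have "\<dots> = (CLINT \<omega>|M. iexp (t * Y \<omega>) + complex_of_real (Z \<omega>) * iexp (t * Y \<omega>))"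
      by (intro Bochner_Integration.integral_cong) (auto simp: scaleR_conv_of_real algebra_simps)
    also have "\<dots> = (CLINT \<omega>|M. iexp (t * Y \<omega>))"
      using ft ci[of t] ciZ[of t] by simp
    also have "\<dots> = char (distr M borel Y) t"
      unfolding char_def by (subst integral_distr) auto
    finally show "char (distr ?N borel Y) t = char (distr M borel Y) t" .
  qed
  then have eq: "distr ?N borel Y = distr M borel Y"
    by (intro Levy_uniqueness real_distribution.intro real_distribution_axioms.intro
        N.prob_space_distr prob_space_distr) auto
  have "N.prob (Y -` B \<inter> space M) = prob (Y -` B \<inter> space M)"
    using arg_cong[OF eq, of "\<lambda>N. measure N B"] B by (simp add: measure_distr)
  moreover have "N.prob (Y -` B \<inter> space M) = expectation (\<lambda>\<omega>. (1 + Z \<omega>) * indicator B (Y \<omega>))"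
  proof -
    have "emeasure ?N (Y -` B \<inter> space M) = (\<integral>\<^sup>+\<omega>. ennreal ((1 + Z \<omega>) * indicator B (Y \<omega>)) \<partial>M)"
      using B by (subst emeasure_density) (auto intro!: nn_integral_cong simp: indicator_def)
    also have "\<dots> = ennreal (expectation (\<lambda>\<omega>. (1 + Z \<omega>) * indicator B (Y \<omega>)))"
      by (rule nn_integral_eq_integral, rule integrable_const_bound[of _ 2])
        (use nn bd B in \<open>auto simp: indicator_def abs_le_iff intro: order_trans[of _ 1]\<close>)
    finally show ?thesis using nn by (simp add: measure_def)
  qed
  moreover have "prob (Y -` B \<inter> space M) = expectation (\<lambda>\<omega>. indicator B (Y \<omega>))"
  proof -
    have "expectation (\<lambda>\<omega>. indicat_real B (Y \<omega>)) = expectation (indicator (Y -` B \<inter> space M))"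
      by (intro Bochner_Integration.integral_cong) (auto simp: indicator_def)
    then show ?thesis by simp
  qed
  moreover have "expectation (\<lambda>\<omega>. (1 + Z \<omega>) * indicator B (Y \<omega>))
     = expectation (\<lambda>\<omega>. indicator B (Y \<omega>)) + expectation (\<lambda>\<omega>. Z \<omega> * indicator B (Y \<omega>))"
  proof -
    have [measurable]: "B \<in> sets borel" by fact
    have "integrable M (\<lambda>\<omega>. indicator B (Y \<omega>) :: real)"
      by (rule integrable_const_bound[of _ 1]) auto
    moreover have "integrable M (\<lambda>\<omega>. Z \<omega> * indicator B (Y \<omega>))"
      by (rule integrable_const_bound[of _ 1]) (use bd in \<open>auto simp: indicator_def\<close>)
    ultimately show ?thesis by (simp add: distrib_right)
  qed
  ultimately show ?thesis by simp
qed

text \<open>Real and imaginary parts are treated separately. The Fourier condition for the conjugate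
  of \<open>Z\<close> is the conjugate of the condition for \<open>Z\<close> at
  \<open>- \<theta>\<close>, so both parts satisfy it as well.\<close>

lemma (in prob_space) fourier_uniqueness:
  fixes Y :: "'a \<Rightarrow> real" and Z :: "'a \<Rightarrow> complex"
  assumes [measurable]: "Y \<in> borel_measurable M" "Z \<in> borel_measurable M"
    and bd: "\<And>\<omega>. cmod (Z \<omega>) \<le> C"
    and ft: "\<And>\<theta>. (CLINT \<omega>|M. Z \<omega> * iexp (\<theta> * Y \<omega>)) = 0"
    and B[measurable]: "B \<in> sets borel"
  shows "(CLINT \<omega>|M. Z \<omega> * indicator B (Y \<omega>)) = 0"
proof -
  \<comment> \<open>The maximum with 1 makes \<open>K\<close> a legitimate divisor; dividing by it
    brings both parts into the range required by the real version.\<close>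
  define K where "K = max C 1"
  have K: "K > 0" by (simp add: K_def)
  have bd': "cmod (Z \<omega>) \<le> K" for \<omega> using bd[of \<omega>] by (simp add: K_def)
  have iZ: "integrable M (\<lambda>\<omega>. Z \<omega> * iexp (\<theta> * Y \<omega>))" for \<theta>
    by (rule integrable_const_bound[of _ K]) (use bd' in \<open>auto simp: norm_mult\<close>)
  have ft': "(CLINT \<omega>|M. cnj (Z \<omega>) * iexp (\<theta> * Y \<omega>)) = 0" for \<theta>
  proof -
    have "(CLINT \<omega>|M. cnj (Z \<omega>) * iexp (\<theta> * Y \<omega>)) = (CLINT \<omega>|M. cnj (Z \<omega> * iexp ((-\<theta>) * Y \<omega>)))"
      by (intro Bochner_Integration.integral_cong) (auto simp: exp_cnj)
    then show ?thesis using ft[of "-\<theta>"] by (simp only: Bochner_Integration.integral_cnj) simp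
  qed
  have [measurable]: "(\<lambda>\<omega>. cnj (Z \<omega>)) \<in> borel_measurable M"
    by (rule measurable_compose[OF assms(2)]) (intro borel_measurable_continuous_onI continuous_intros)
  have iZ': "integrable M (\<lambda>\<omega>. cnj (Z \<omega>) * iexp (\<theta> * Y \<omega>))" for \<theta>
    by (rule integrable_const_bound[of _ K]) (use bd' in \<open>auto simp: norm_mult\<close>)
  have re: "(CLINT \<omega>|M. complex_of_real (Re (Z \<omega>) / K) * iexp (\<theta> * Y \<omega>)) = 0" for \<theta>
  proof -
    have "(CLINT \<omega>|M. complex_of_real (Re (Z \<omega>) / K) * iexp (\<theta> * Y \<omega>))
       = (CLINT \<omega>|M. (1 / (2 * K)) * (Z \<omega> * iexp (\<theta> * Y \<omega>) + cnj (Z \<omega>) * iexp (\<theta> * Y \<omega>)))"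
      by (intro Bochner_Integration.integral_cong refl)
        (use K in \<open>simp add: complex_add_cnj distrib_right[symmetric] field_simps\<close>)
    also have "\<dots> = (1 / (2 * K)) * ((CLINT \<omega>|M. Z \<omega> * iexp (\<theta> * Y \<omega>)) + (CLINT \<omega>|M. cnj (Z \<omega>) * iexp (\<theta> * Y \<omega>)))"
      using iZ[of \<theta>] iZ'[of \<theta>] by simp
    finally show ?thesis using ft ft' by simp
  qed
  have im: "(CLINT \<omega>|M. complex_of_real (Im (Z \<omega>) / K) * iexp (\<theta> * Y \<omega>)) = 0" for \<theta>
  proof -
    have "(CLINT \<omega>|M. complex_of_real (Im (Z \<omega>) / K) * iexp (\<theta> * Y \<omega>))
       = (CLINT \<omega>|M. (1 / (2 * K * \<i>)) * (Z \<omega> * iexp (\<theta> * Y \<omega>) - cnj (Z \<omega>) * iexp (\<theta> * Y \<omega>)))"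
      by (intro Bochner_Integration.integral_cong refl)
        (use K in \<open>simp add: complex_diff_cnj left_diff_distrib[symmetric] field_simps\<close>)
    also have "\<dots> = (1 / (2 * K * \<i>)) * ((CLINT \<omega>|M. Z \<omega> * iexp (\<theta> * Y \<omega>)) - (CLINT \<omega>|M. cnj (Z \<omega>) * iexp (\<theta> * Y \<omega>)))"
      using iZ[of \<theta>] iZ'[of \<theta>] by simp
    finally show ?thesis using ft ft' by simp
  qed
  have b1: "\<bar>Re (Z \<omega>) / K\<bar> \<le> 1" "\<bar>Im (Z \<omega>) / K\<bar> \<le> 1" for \<omega>
    using abs_Re_le_cmod[of "Z \<omega>"] abs_Im_le_cmod[of "Z \<omega>"] bd'[of \<omega>] K by (auto simp: field_simps)
  have r: "expectation (\<lambda>\<omega>. Re (Z \<omega>) / K * indicator B (Y \<omega>)) = 0"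
    by (rule fourier_uniqueness_real[OF _ _ b1(1) re B]) auto
  have i: "expectation (\<lambda>\<omega>. Im (Z \<omega>) / K * indicator B (Y \<omega>)) = 0"
    by (rule fourier_uniqueness_real[OF _ _ b1(2) im B]) auto
  have intB: "integrable M (\<lambda>\<omega>. Re (Z \<omega>) / K * indicator B (Y \<omega>))" "integrable M (\<lambda>\<omega>. Im (Z \<omega>) / K * indicator B (Y \<omega>))"
    by (rule integrable_const_bound[of _ 1]; use b1 in \<open>auto simp: indicator_def\<close>)+
  have lin: "(CLINT \<omega>|M. K * (complex_of_real (a \<omega>) + \<i> * complex_of_real (b \<omega>)))
      = K * (complex_of_real (expectation a) + \<i> * complex_of_real (expectation b))"
    if "integrable M a" "integrable M b" for a b using that by simp
  have "(CLINT \<omega>|M. Z \<omega> * indicator B (Y \<omega>))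
      = (CLINT \<omega>|M. K * (complex_of_real (Re (Z \<omega>) / K * indicator B (Y \<omega>)) + \<i> * complex_of_real (Im (Z \<omega>) / K * indicator B (Y \<omega>))))"
    by (intro Bochner_Integration.integral_cong refl) (use K in \<open>auto simp: complex_eq_iff indicator_def\<close>)
  also have "\<dots> = K * (complex_of_real (expectation (\<lambda>\<omega>. Re (Z \<omega>) / K * indicator B (Y \<omega>)))
      + \<i> * complex_of_real (expectation (\<lambda>\<omega>. Im (Z \<omega>) / K * indicator B (Y \<omega>))))"
    by (rule lin[OF intB])
  finally show ?thesis unfolding r i by simp
qed

lemma ip_add_self:
  assumes "\<phi> \<in> L2_halfplane" "\<psi> \<in> L2_halfplane"
  shows "ip (\<lambda>z. \<phi> z + \<psi> z) (\<lambda>z. \<phi> z + \<psi> z) = ip \<phi> \<phi> + 2 * ip \<phi> \<psi> + ip \<psi> \<psi>"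
proof -
  have "ip (\<lambda>z. \<phi> z + \<psi> z) (\<lambda>z. \<phi> z + \<psi> z)
      = (\<integral>z. \<phi> z * \<phi> z + 2 * (\<phi> z * \<psi> z) + \<psi> z * \<psi> z \<partial>lborel)"
    by (intro Bochner_Integration.integral_cong) (auto simp: algebra_simps)
  then show ?thesis using integrable_ip assms by simp
qed

lemma ip_disjoint: "(\<And>z. \<phi> z = 0 \<or> \<psi> z = 0) \<Longrightarrow> ip \<phi> \<psi> = 0"
proof -
  assume "\<And>z. \<phi> z = 0 \<or> \<psi> z = 0"
  then have "(\<lambda>z. \<phi> z * \<psi> z) = (\<lambda>z. 0)" by (auto simp: fun_eq_iff)
  then show ?thesis by simp
qed

section \<open>Independence of the noise after time \<open>r\<close> from events before it\<close>

context noise_space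
begin

text \<open>Finite intersections of events about the noise up to time \<open>r\<close>, built one
  constraint at a time so that an identity for characteristic functions can be carried along by
  induction. Together with the null sets they form an intersection-stable generator of
  \<open>noise_history\<close>.\<close>

inductive cyl :: "real \<Rightarrow> 'a set \<Rightarrow> bool" for r where
  cyl_space: "cyl r (space M)"
| cyl_Int: "cyl r G \<Longrightarrow> \<psi> \<in> L2_halfplane \<Longrightarrow> (\<And>s y. r < s \<Longrightarrow> \<psi> (s, y) = 0) \<Longrightarrow> B \<in> sets borel \<Longrightarrow>
    cyl r (G \<inter> (W \<psi> -` B \<inter> space M))"

lemma cyl_sets: "cyl r G \<Longrightarrow> G \<in> sets M"
  by (induction rule: cyl.induct) (auto intro!: measurable_sets[OF W_measurable])

lemma cyl_Int_stable: "cyl r H \<Longrightarrow> cyl r G \<Longrightarrow> cyl r (G \<inter> H)"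
proof (induction rule: cyl.induct)
  case cyl_space
  then have "G \<inter> space M = G" using cyl_sets sets.sets_into_space by blast
  then show ?case using cyl_space by simp
next
  case (cyl_Int H \<psi> B)
  have "G \<inter> (H \<inter> (W \<psi> -` B \<inter> space M)) = (G \<inter> H) \<inter> (W \<psi> -` B \<inter> space M)" by blast
  then show ?case using cyl.cyl_Int[OF cyl_Int.IH[OF cyl_Int.prems] cyl_Int.hyps(2-4)] by simp
qed

text \<open>Independence in Fourier form. On the whole space it follows from the Gaussian
  characteristic function, since \<open>\<eta>\<close> and \<open>\<phi>\<close> live at disjoint
  times and are orthogonal. A further constraint on \<open>W \<psi>\<close> is added by Fourier
  uniqueness in the variable \<open>W \<psi>\<close>: the extra factor
  \<open>iexp (\<theta> * W \<psi> \<omega>)\<close> merely replaces \<open>\<eta>\<close> by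
  \<open>\<eta> + \<theta> \<psi>\<close>, which is why \<open>\<eta>\<close> is arbitrary in the
  induction.\<close>

lemma cyl_char:
  assumes \<phi>: "\<phi> \<in> L2_halfplane" "\<And>s y. s \<le> r \<Longrightarrow> \<phi> (s, y) = 0"
  shows "cyl r G \<Longrightarrow> \<eta> \<in> L2_halfplane \<Longrightarrow> (\<And>s y. r < s \<Longrightarrow> \<eta> (s, y) = 0) \<Longrightarrow>
    (CLINT \<omega>|M. indicator G \<omega> * iexp (W \<eta> \<omega>) * (iexp (W \<phi> \<omega>) - exp (- ip \<phi> \<phi> / 2))) = 0"
proof (induction arbitrary: \<eta> rule: cyl.induct)
  case cyl_space
  note [measurable] = W_measurable[OF \<phi>(1)] W_measurable[OF cyl_space(1)]
  have s: "(\<lambda>z. \<eta> z + \<phi> z) \<in> L2_halfplane" using cyl_space \<phi> by (intro L2_halfplane_add)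
  note [measurable] = W_measurable[OF s]
  have d: "ip \<eta> \<phi> = 0"
  proof (rule ip_disjoint)
    fix z :: "real \<times> real"
    show "\<eta> z = 0 \<or> \<phi> z = 0" using cyl_space(2)[of "fst z" "snd z"] \<phi>(2)[of "fst z" "snd z"] by force
  qed
  have "(CLINT \<omega>|M. indicator (space M) \<omega> * iexp (W \<eta> \<omega>) * (iexp (W \<phi> \<omega>) - exp (- ip \<phi> \<phi> / 2)))
      = (CLINT \<omega>|M. iexp (W (\<lambda>z. \<eta> z + \<phi> z) \<omega>) - exp (- ip \<phi> \<phi> / 2) * iexp (W \<eta> \<omega>))"
  proof (rule integral_cong_AE)
    show "AE \<omega> in M. indicator (space M) \<omega> * iexp (W \<eta> \<omega>) * (iexp (W \<phi> \<omega>) - exp (- ip \<phi> \<phi> / 2))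
        = iexp (W (\<lambda>z. \<eta> z + \<phi> z) \<omega>) - exp (- ip \<phi> \<phi> / 2) * iexp (W \<eta> \<omega>)"
      using W_add[OF cyl_space(1) \<phi>(1)] AE_space
      by eventually_elim (simp add: algebra_simps exp_add)
  qed measurable
  also have "\<dots> = (CLINT \<omega>|M. iexp (W (\<lambda>z. \<eta> z + \<phi> z) \<omega>)) - exp (- ip \<phi> \<phi> / 2) * (CLINT \<omega>|M. iexp (W \<eta> \<omega>))"
    by (subst Bochner_Integration.integral_diff) (auto intro!: integrable_iexp)
  also have "\<dots> = 0"
    unfolding W_char[OF s] W_char[OF cyl_space(1)] ip_add_self[OF cyl_space(1) \<phi>(1)] d
    by (simp add: exp_add[symmetric] diff_divide_distrib add_divide_distrib flip: of_real_mult)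
  finally show ?case .
next
  case (cyl_Int G \<psi> B)
  note [measurable] = W_measurable[OF \<phi>(1)] W_measurable[OF cyl_Int.prems(1)] W_measurable[OF cyl_Int.hyps(2)]
    cyl_sets[OF cyl_Int.hyps(1)] cyl_Int.hyps(4)
  let ?Z = "\<lambda>\<omega>. indicator G \<omega> * iexp (W \<eta> \<omega>) * (iexp (W \<phi> \<omega>) - exp (- ip \<phi> \<phi> / 2))"
  have "(CLINT \<omega>|M. ?Z \<omega> * indicator B (W \<psi> \<omega>)) = 0"
  proof (rule fourier_uniqueness)
    show "cmod (?Z \<omega>) \<le> 1 + exp (- ip \<phi> \<phi> / 2)" for \<omega>
    proof -
      have "cmod (iexp (W \<phi> \<omega>) - exp (- ip \<phi> \<phi> / 2)) \<le> 1 + exp (- ip \<phi> \<phi> / 2)"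
        using norm_triangle_ineq4[of "iexp (W \<phi> \<omega>)" "complex_of_real (exp (- ip \<phi> \<phi> / 2))"] by simp
      then show ?thesis by (auto simp: norm_mult indicator_def)
    qed
    fix \<theta> :: real
    have l: "(\<lambda>z. 1 * \<eta> z + \<theta> * \<psi> z) \<in> L2_halfplane" by (intro L2_halfplane_lincomb cyl_Int)
    note [measurable] = W_measurable[OF l]
    have "(CLINT \<omega>|M. ?Z \<omega> * iexp (\<theta> * W \<psi> \<omega>))
      = (CLINT \<omega>|M. indicator G \<omega> * iexp (W (\<lambda>z. 1 * \<eta> z + \<theta> * \<psi> z) \<omega>) * (iexp (W \<phi> \<omega>) - exp (- ip \<phi> \<phi> / 2)))"
    proof (rule integral_cong_AE)
      show "AE \<omega> in M. ?Z \<omega> * iexp (\<theta> * W \<psi> \<omega>)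
        = indicator G \<omega> * iexp (W (\<lambda>z. 1 * \<eta> z + \<theta> * \<psi> z) \<omega>) * (iexp (W \<phi> \<omega>) - exp (- ip \<phi> \<phi> / 2))"
        using W_lincomb[OF cyl_Int.prems(1) cyl_Int.hyps(2), of 1 \<theta>]
        by eventually_elim (simp add: algebra_simps exp_add)
    qed measurable
    also have "\<dots> = 0"
      by (rule cyl_Int.IH[OF l]) (use cyl_Int in auto)
    finally show "(CLINT \<omega>|M. ?Z \<omega> * iexp (\<theta> * W \<psi> \<omega>)) = 0" .
  qed measurable
  also have "(CLINT \<omega>|M. ?Z \<omega> * indicator B (W \<psi> \<omega>))
     = (CLINT \<omega>|M. indicator (G \<inter> (W \<psi> -` B \<inter> space M)) \<omega> * iexp (W \<eta> \<omega>) * (iexp (W \<phi> \<omega>) - exp (- ip \<phi> \<phi> / 2)))"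
    by (intro Bochner_Integration.integral_cong) (auto simp: indicator_def)
  finally show ?case .
qed

text \<open>The Fourier identity with zero \<open>\<eta>\<close>, applied to all multiples of
  \<open>\<phi>\<close>, says that the indicator of \<open>G\<close> minus its probability has
  vanishing Fourier transform against \<open>W \<phi>\<close>. Fourier uniqueness turns this into a
  statement about events.\<close>

lemma cyl_indep:
  assumes \<phi>: "\<phi> \<in> L2_halfplane" "\<And>s y. s \<le> r \<Longrightarrow> \<phi> (s, y) = 0"
    and G: "cyl r G" and B[measurable]: "B \<in> sets borel"
  shows "prob (G \<inter> (W \<phi> -` B \<inter> space M)) = prob G * prob (W \<phi> -` B \<inter> space M)"
proof -
  note [measurable] = W_measurable[OF \<phi>(1)] cyl_sets[OF G]
  have iG: "integrable M (\<lambda>\<omega>. indicator G \<omega> * iexp (W \<psi> \<omega>))" if "\<psi> \<in> L2_halfplane" for \<psi>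
    using W_measurable[OF that]
    by (intro integrable_const_bound[of _ 1]) (auto simp: norm_mult indicator_def)
  have iG1: "integrable M (\<lambda>\<omega>. indicator G \<omega> :: complex)"
    by (intro integrable_const_bound[of _ 1]) (auto simp: indicator_def)
  have EG: "(CLINT \<omega>|M. indicator G \<omega>) = complex_of_real (prob G)"
  proof -
    have "(CLINT \<omega>|M. indicator G \<omega>) = (CLINT \<omega>|M. complex_of_real (indicator G \<omega>))"
      by (intro Bochner_Integration.integral_cong) (auto simp: indicator_def)
    then show ?thesis using sets.sets_into_space[OF cyl_sets[OF G]] by (simp add: Int_absorb2)
  qed
  have "(CLINT \<omega>|M. complex_of_real (indicator G \<omega> - prob G) * indicator B (W \<phi> \<omega>)) = 0"
  proof (rule fourier_uniqueness[where C=2])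
    show "cmod (complex_of_real (indicator G \<omega> - prob G)) \<le> 2" for \<omega>
    proof -
      have "\<bar>indicator G \<omega> - prob G\<bar> \<le> 2"
        using prob_le_1[of G] measure_nonneg[of M G] by (auto simp: indicator_def simp del: measure_nonneg prob_le_1 split: if_splits)
      then show ?thesis by (metis norm_of_real)
    qed
    fix \<theta> :: real
    have l: "(\<lambda>z. \<theta> * \<phi> z) \<in> L2_halfplane" by (intro L2_halfplane_scale \<phi>)
    note [measurable] = W_measurable[OF l] W_measurable[OF L2_halfplane_zero]
    have z: "\<theta> * \<phi> (s, y) = 0" if "s \<le> r" for s y using \<phi>(2)[OF that] by simp
    have "(CLINT \<omega>|M. complex_of_real (indicator G \<omega> - prob G) * iexp (\<theta> * W \<phi> \<omega>))
      = (CLINT \<omega>|M. complex_of_real (indicator G \<omega> - prob G) * iexp (W (\<lambda>z. \<theta> * \<phi> z) \<omega>))"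
    proof (rule integral_cong_AE)
      show "AE \<omega> in M. complex_of_real (indicator G \<omega> - prob G) * iexp (\<theta> * W \<phi> \<omega>)
        = complex_of_real (indicator G \<omega> - prob G) * iexp (W (\<lambda>z. \<theta> * \<phi> z) \<omega>)"
        using W_scale[OF \<phi>(1), of \<theta>] by eventually_elim simp
    qed measurable
    also have "\<dots> = (CLINT \<omega>|M. indicator G \<omega> * iexp (W (\<lambda>z. \<theta> * \<phi> z) \<omega>) - prob G * iexp (W (\<lambda>z. \<theta> * \<phi> z) \<omega>))"
      by (intro Bochner_Integration.integral_cong) (auto simp: indicator_def algebra_simps)
    also have "\<dots> = (CLINT \<omega>|M. indicator G \<omega> * iexp (W (\<lambda>z. \<theta> * \<phi> z) \<omega>)) - prob G * exp (- ip (\<lambda>z. \<theta> * \<phi> z) (\<lambda>z. \<theta> * \<phi> z) / 2)"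
      using iG[OF l] by (subst Bochner_Integration.integral_diff) (auto intro!: integrable_iexp simp: W_char[OF l])
    also have "(CLINT \<omega>|M. indicator G \<omega> * iexp (W (\<lambda>z. \<theta> * \<phi> z) \<omega>)) = prob G * exp (- ip (\<lambda>z. \<theta> * \<phi> z) (\<lambda>z. \<theta> * \<phi> z) / 2)"
    proof -
      have "0 = (CLINT \<omega>|M. indicator G \<omega> * iexp (W (\<lambda>_. 0) \<omega>) * (iexp (W (\<lambda>z. \<theta> * \<phi> z) \<omega>) - exp (- ip (\<lambda>z. \<theta> * \<phi> z) (\<lambda>z. \<theta> * \<phi> z) / 2)))"
        by (rule cyl_char[OF l z G L2_halfplane_zero, symmetric]) auto
      also have "\<dots> = (CLINT \<omega>|M. indicator G \<omega> * iexp (W (\<lambda>z. \<theta> * \<phi> z) \<omega>) - (indicator G \<omega> :: complex) * exp (- ip (\<lambda>z. \<theta> * \<phi> z) (\<lambda>z. \<theta> * \<phi> z) / 2))"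
      proof (rule integral_cong_AE)
        show "AE \<omega> in M. indicator G \<omega> * iexp (W (\<lambda>_. 0) \<omega>) * (iexp (W (\<lambda>z. \<theta> * \<phi> z) \<omega>) - exp (- ip (\<lambda>z. \<theta> * \<phi> z) (\<lambda>z. \<theta> * \<phi> z) / 2))
           = indicator G \<omega> * iexp (W (\<lambda>z. \<theta> * \<phi> z) \<omega>) - (indicator G \<omega> :: complex) * exp (- ip (\<lambda>z. \<theta> * \<phi> z) (\<lambda>z. \<theta> * \<phi> z) / 2)"
          using W_zero by eventually_elim (auto simp: algebra_simps indicator_def)
      qed measurable
      also have "\<dots> = (CLINT \<omega>|M. indicator G \<omega> * iexp (W (\<lambda>z. \<theta> * \<phi> z) \<omega>)) - prob G * exp (- ip (\<lambda>z. \<theta> * \<phi> z) (\<lambda>z. \<theta> * \<phi> z) / 2)"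
        using iG[OF l] iG1 EG by (subst Bochner_Integration.integral_diff) auto
      finally show ?thesis by simp
    qed
    finally show "(CLINT \<omega>|M. complex_of_real (indicator G \<omega> - prob G) * iexp (\<theta> * W \<phi> \<omega>)) = 0" by simp
  qed measurable
  also have "(CLINT \<omega>|M. complex_of_real (indicator G \<omega> - prob G) * indicator B (W \<phi> \<omega>))
     = (CLINT \<omega>|M. complex_of_real (indicator (G \<inter> (W \<phi> -` B \<inter> space M)) \<omega> - prob G * indicator (W \<phi> -` B \<inter> space M) \<omega>))"
    by (intro Bochner_Integration.integral_cong) (auto simp: indicator_def)
  also have "\<dots> = complex_of_real (prob (G \<inter> (W \<phi> -` B \<inter> space M)) - prob G * prob (W \<phi> -` B \<inter> space M))"
  proof -
    have 1: "integrable M (\<lambda>\<omega>. indicator (G \<inter> (W \<phi> -` B \<inter> space M)) \<omega> :: real)"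
      "integrable M (\<lambda>\<omega>. prob G * indicator (W \<phi> -` B \<inter> space M) \<omega>)"
      by (intro integrable_mult_right integrable_real_indicator emeasure_finite; simp add: less_top[symmetric])+
    have 2: "G \<inter> (W \<phi> -` B \<inter> space M) \<inter> space M = G \<inter> (W \<phi> -` B \<inter> space M)" by blast
    show ?thesis
      unfolding integral_complex_of_real Bochner_Integration.integral_diff[OF 1] by (simp add: Int_assoc)
  qed
  finally have "complex_of_real (prob (G \<inter> (W \<phi> -` B \<inter> space M)) - prob G * prob (W \<phi> -` B \<inter> space M)) = 0" .
  then show ?thesis by (simp only: of_real_eq_0_iff right_minus_eq)
qed

text \<open>The Cameron-Martin density: under it the noise behaves like the original noise plus the
  deterministic drift \<open>\<phi>\<close>. The subtracted term normalises its mean to 1.\<close>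

definition dens :: "(real \<times> real \<Rightarrow> real) \<Rightarrow> 'a \<Rightarrow> real" where
  "dens \<phi> \<omega> = exp (W \<phi> \<omega> - ip \<phi> \<phi> / 2)"

lemma dens_pos: "0 < dens \<phi> \<omega>" by (simp add: dens_def)

lemma dens_measurable [measurable]: "\<phi> \<in> L2_halfplane \<Longrightarrow> dens \<phi> \<in> borel_measurable M"
  unfolding dens_def[abs_def]
  by (rule measurable_compose[OF W_measurable, of _ "\<lambda>x. exp (x - c)" for c]) auto

text \<open>Almost surely the product is \<open>exp (ip \<phi> \<psi>)\<close> times the density of
  the sum of the two drifts. In particular densities of orthogonal drifts are uncorrelated.\<close>

lemma dens_prod:
  assumes \<phi>: "\<phi> \<in> L2_halfplane" and \<psi>: "\<psi> \<in> L2_halfplane"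
  shows "(\<integral>\<^sup>+\<omega>. ennreal (dens \<phi> \<omega> * dens \<psi> \<omega>) \<partial>M) = ennreal (exp (ip \<phi> \<psi>))"
proof -
  have s: "(\<lambda>z. \<phi> z + \<psi> z) \<in> L2_halfplane" using \<phi> \<psi> by (rule L2_halfplane_add)
  note [measurable] = W_measurable[OF s]
  let ?c = "exp (- (ip \<phi> \<phi> + ip \<psi> \<psi>) / 2)"
  have "(\<integral>\<^sup>+\<omega>. ennreal (dens \<phi> \<omega> * dens \<psi> \<omega>) \<partial>M)
      = (\<integral>\<^sup>+\<omega>. ennreal ?c * ennreal (exp (W (\<lambda>z. \<phi> z + \<psi> z) \<omega>)) \<partial>M)"
  proof (rule nn_integral_cong_AE)
    show "AE \<omega> in M. ennreal (dens \<phi> \<omega> * dens \<psi> \<omega>) = ennreal ?c * ennreal (exp (W (\<lambda>z. \<phi> z + \<psi> z) \<omega>))"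
      using W_add[OF \<phi> \<psi>]
      by eventually_elim (simp add: dens_def ennreal_mult'[symmetric] exp_add[symmetric] field_simps)
  qed
  also have "\<dots> = ennreal ?c * ennreal (exp (ip (\<lambda>z. \<phi> z + \<psi> z) (\<lambda>z. \<phi> z + \<psi> z) / 2))"
    by (subst nn_integral_cmult) (auto simp: W_mgf[OF s])
  also have "\<dots> = ennreal (exp (ip \<phi> \<psi>))"
    unfolding ip_add_self[OF \<phi> \<psi>] by (simp add: ennreal_mult'[symmetric] exp_add[symmetric] field_simps)
  finally show ?thesis .
qed

lemma dens_prod_expectation:
  assumes \<phi>: "\<phi> \<in> L2_halfplane" and \<psi>: "\<psi> \<in> L2_halfplane"
  shows "integrable M (\<lambda>\<omega>. dens \<phi> \<omega> * dens \<psi> \<omega>)"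
    and "expectation (\<lambda>\<omega>. dens \<phi> \<omega> * dens \<psi> \<omega>) = exp (ip \<phi> \<psi>)"
proof -
  note [measurable] = dens_measurable[OF \<phi>] dens_measurable[OF \<psi>]
  have nn: "AE \<omega> in M. 0 \<le> dens \<phi> \<omega> * dens \<psi> \<omega>"
    using dens_pos by (auto intro!: mult_nonneg_nonneg less_imp_le)
  show "integrable M (\<lambda>\<omega>. dens \<phi> \<omega> * dens \<psi> \<omega>)"
    using dens_prod[OF assms] nn by (intro integrableI_nonneg) auto
  then show "expectation (\<lambda>\<omega>. dens \<phi> \<omega> * dens \<psi> \<omega>) = exp (ip \<phi> \<psi>)"
    using dens_prod[OF assms] nn by (subst integral_eq_nn_integral) auto
qed

lemma dens_nn_integral: "\<phi> \<in> L2_halfplane \<Longrightarrow> (\<integral>\<^sup>+\<omega>. ennreal (dens \<phi> \<omega>) \<partial>M) = 1"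
proof -
  assume \<phi>: "\<phi> \<in> L2_halfplane"
  note [measurable] = W_measurable[OF \<phi>]
  have "(\<integral>\<^sup>+\<omega>. ennreal (dens \<phi> \<omega>) \<partial>M) = (\<integral>\<^sup>+\<omega>. ennreal (exp (- ip \<phi> \<phi> / 2)) * ennreal (exp (W \<phi> \<omega>)) \<partial>M)"
    by (intro nn_integral_cong) (simp add: dens_def ennreal_mult'[symmetric] exp_add[symmetric] field_simps)
  also have "\<dots> = ennreal (exp (- ip \<phi> \<phi> / 2)) * ennreal (exp (ip \<phi> \<phi> / 2))"
    by (subst nn_integral_cmult) (auto simp: W_mgf[OF \<phi>])
  finally show ?thesis by (simp add: ennreal_mult'[symmetric] exp_add[symmetric])
qed

lemma dens_expectation:
  assumes "\<phi> \<in> L2_halfplane"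
  shows "integrable M (dens \<phi>)" "expectation (dens \<phi>) = 1"
proof -
  note [measurable] = dens_measurable[OF assms]
  show "integrable M (dens \<phi>)"
    using dens_nn_integral[OF assms] dens_pos by (intro integrableI_nonneg) (auto intro: less_imp_le)
  show "expectation (dens \<phi>) = 1"
    using dens_nn_integral[OF assms] dens_pos by (subst integral_eq_nn_integral) (auto intro: less_imp_le)
qed

text \<open>The density is a function of \<open>W \<phi>\<close> alone, which is independent of
  \<open>G\<close>, and it has mean 1. A drift that acts only after \<open>r\<close> therefore does
  not change probabilities of events up to \<open>r\<close>.\<close>

lemma cyl_dens:
  assumes \<phi>: "\<phi> \<in> L2_halfplane" "\<And>s y. s \<le> r \<Longrightarrow> \<phi> (s, y) = 0" and G: "cyl r G"
  shows "emeasure (density M (\<lambda>\<omega>. ennreal (dens \<phi> \<omega>))) G = emeasure M G"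
proof -
  note [measurable] = W_measurable[OF \<phi>(1)] cyl_sets[OF G] dens_measurable[OF \<phi>(1)]
  let ?G = "density M (indicator G)"
  \<comment> \<open>Independence as an identity of measures: restricted to \<open>G\<close>, the law
    of \<open>W \<phi>\<close> is its full law scaled by the probability of
    \<open>G\<close>.\<close>
  have eq: "distr ?G borel (W \<phi>) = scale_measure (ennreal (prob G)) (distr M borel (W \<phi>))"
  proof (rule measure_eqI)
    fix B assume "B \<in> sets (distr ?G borel (W \<phi>))"
    then have [measurable]: "B \<in> sets borel" by simp
    have "emeasure (distr ?G borel (W \<phi>)) B = emeasure ?G (W \<phi> -` B \<inter> space M)"
      by (subst emeasure_distr) auto
    also have "\<dots> = emeasure M (G \<inter> (W \<phi> -` B \<inter> space M))"
      by (subst emeasure_density) (auto simp: nn_integral_indicator[symmetric] indicator_def intro!: nn_integral_cong)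
    also have "\<dots> = ennreal (prob G) * emeasure M (W \<phi> -` B \<inter> space M)"
      using cyl_indep[OF \<phi> G, of B] by (simp add: emeasure_eq_measure ennreal_mult'[symmetric])
    finally show "emeasure (distr ?G borel (W \<phi>)) B = emeasure (scale_measure (ennreal (prob G)) (distr M borel (W \<phi>))) B"
      by (simp add: emeasure_distr)
  qed simp
  have "emeasure (density M (\<lambda>\<omega>. ennreal (dens \<phi> \<omega>))) G = (\<integral>\<^sup>+\<omega>. indicator G \<omega> * ennreal (dens \<phi> \<omega>) \<partial>M)"
    by (subst emeasure_density) (auto simp: mult.commute)
  also have "\<dots> = (\<integral>\<^sup>+x. ennreal (exp (x - ip \<phi> \<phi> / 2)) \<partial>distr ?G borel (W \<phi>))"
    by (subst nn_integral_distr; simp?) (subst nn_integral_density; simp add: dens_def)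
  also have "\<dots> = ennreal (prob G) * (\<integral>\<^sup>+x. ennreal (exp (x - ip \<phi> \<phi> / 2)) \<partial>distr M borel (W \<phi>))"
    unfolding eq by (subst nn_integral_scale_measure) auto
  also have "(\<integral>\<^sup>+x. ennreal (exp (x - ip \<phi> \<phi> / 2)) \<partial>distr M borel (W \<phi>)) = 1"
    using dens_nn_integral[OF \<phi>(1)] by (subst nn_integral_distr) (auto simp: dens_def)
  finally show ?thesis by (simp add: emeasure_eq_measure)
qed

end

text \<open>AM-GM with a free weight. It stands in for Cauchy-Schwarz below, the weight being chosen
  where it is used.\<close>

lemma abs_le_square_bound:
  fixes x :: real assumes "\<eta> > 0" shows "\<bar>x\<bar> \<le> (\<eta> + x\<^sup>2 / \<eta>) / 2"
proof -
  have "2 * \<eta> * \<bar>x\<bar> \<le> \<eta>\<^sup>2 + x\<^sup>2"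
    using sum_squares_bound[of \<eta> "\<bar>x\<bar>"] by simp
  then show ?thesis using assms by (simp add: field_simps power2_eq_square)
qed

section \<open>The augmented, right-continuous filtration\<close>

context noise_space
begin

lemma noise_history_subset: "noise_history M W r \<subseteq> sets M"
  unfolding noise_history_def
  by (intro sets.sigma_sets_subset) (auto intro!: measurable_sets[OF W_measurable])

text \<open>Every history is already a sigma-algebra, so their intersection is one too, and
  generating from it adds nothing.\<close>

lemma sets_noise_filtration: "sets (noise_filtration M W t) = (\<Inter>r\<in>{t<..}. noise_history M W r)"
  and space_noise_filtration [simp]: "space (noise_filtration M W t) = space M"
proof -
  have sub: "(\<Inter>r\<in>{t<..}. noise_history M W r) \<subseteq> Pow (space M)"
    using noise_history_subset[of "t + 1"] sets.space_closed[of M] by force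
  show "space (noise_filtration M W t) = space M"
    unfolding noise_filtration_def using sub by simp
  have "sigma_sets (space M) (\<Inter>r\<in>{t<..}. noise_history M W r) \<subseteq> noise_history M W r" if "r > t" for r
  proof -
    have "sigma_sets (space M) (\<Inter>r\<in>{t<..}. noise_history M W r) \<subseteq> sigma_sets (space M) (noise_history M W r)"
      using that by (intro sigma_sets_mono') auto
    also have "\<dots> = noise_history M W r"
      unfolding noise_history_def
      by (rule sigma_sets_sigma_sets_eq)
        (use sets.sets_into_space[of _ M] in \<open>auto simp: null_sets_def\<close>)
    finally show ?thesis .
  qed
  then have "sigma_sets (space M) (\<Inter>r\<in>{t<..}. noise_history M W r) = (\<Inter>r\<in>{t<..}. noise_history M W r)"
    by (auto intro: sigma_sets.Basic)
  then show "sets (noise_filtration M W t) = (\<Inter>r\<in>{t<..}. noise_history M W r)"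
    unfolding noise_filtration_def using sub by simp
qed

lemma noise_filtration_subalgebra: "subalgebra M (noise_filtration M W t)"
  using noise_history_subset[of "t + 1"] by (auto simp: subalgebra_def sets_noise_filtration)

lemma noise_filtration_mono: "r \<le> t \<Longrightarrow> sets (noise_filtration M W r) \<subseteq> sets (noise_filtration M W t)"
  unfolding sets_noise_filtration by auto

lemma measurable_noise_filtration_mono:
  "r \<le> t \<Longrightarrow> X \<in> measurable (noise_filtration M W r) N \<Longrightarrow> X \<in> measurable (noise_filtration M W t) N"
  using noise_filtration_mono[of r t] by (auto simp: measurable_def)

lemma measurable_noise_filtration_M:
  "X \<in> measurable (noise_filtration M W r) N \<Longrightarrow> X \<in> measurable M N"
  by (rule measurable_from_subalg[OF noise_filtration_subalgebra])

lemma W_measurable_noise_filtration: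
  assumes "\<phi> \<in> L2_halfplane" "\<And>s y. t < s \<Longrightarrow> \<phi> (s, y) = 0"
  shows "W \<phi> \<in> borel_measurable (noise_filtration M W t)"
proof (rule measurableI)
  fix B :: "real set" assume B: "B \<in> sets borel"
  have "W \<phi> -` B \<inter> space M \<in> noise_history M W r" if "r > t" for r
  proof -
    have "\<forall>s y. r < s \<longrightarrow> \<phi> (s, y) = 0" using assms(2) that by force
    then show ?thesis unfolding noise_history_def using assms(1) B by (intro sigma_sets.Basic) blast
  qed
  then show "W \<phi> -` B \<inter> space (noise_filtration M W t) \<in> sets (noise_filtration M W t)"
    by (simp add: sets_noise_filtration)
qed simp

text \<open>The two finite measures agree on cylinder events and on null sets. This family is stable
  under intersection, so they agree on the sigma-algebra that it generates.\<close>

lemma noise_history_dens: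
  assumes \<phi>: "\<phi> \<in> L2_halfplane" "\<And>s y. s \<le> r \<Longrightarrow> \<phi> (s, y) = 0" and G: "G \<in> noise_history M W r"
  shows "emeasure (density M (\<lambda>\<omega>. ennreal (dens \<phi> \<omega>))) G = emeasure M G"
proof -
  note [measurable] = dens_measurable[OF \<phi>(1)]
  let ?N = "density M (\<lambda>\<omega>. ennreal (dens \<phi> \<omega>))"
  let ?E = "{G. cyl r G} \<union> null_sets M"
  have EM: "?E \<subseteq> sets M" using cyl_sets by auto
  then have EP: "?E \<subseteq> Pow (space M)" using sets.space_closed by blast
  define F where "F = sigma (space M) ?E"
  have sF: "sets F = sigma_sets (space M) ?E" "space F = space M"
    unfolding F_def using EP by auto
  have sub: "subalgebra M F"
    unfolding subalgebra_def sF using EM sets.sigma_sets_subset[of ?E M] by simp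
  have subN: "subalgebra ?N F" using sub by (simp add: subalgebra_def)
  have eq: "restr_to_subalg ?N F = restr_to_subalg M F"
  proof (rule measure_eqI_generator_eq[where \<Omega>="space M" and E="?E" and A="\<lambda>_. space M"])
    show "Int_stable ?E"
    proof (rule Int_stableI)
      fix a b assume "a \<in> ?E" "b \<in> ?E"
      then show "a \<inter> b \<in> ?E"
        using cyl_Int_stable[of r b a] cyl_sets by (auto intro: null_set_Int1 null_set_Int2)
    qed
    show "?E \<subseteq> Pow (space M)" by (rule EP)
    fix X assume X: "X \<in> ?E"
    then have XF: "X \<in> sets F" by (auto simp: sF intro: sigma_sets.Basic)
    have "emeasure ?N X = emeasure M X"
    proof (cases "cyl r X")
      case True then show ?thesis using cyl_dens[OF \<phi>] by simp
    next
      case False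
      then have n: "X \<in> null_sets M" using X by auto
      then have "X \<in> null_sets ?N" by (subst null_sets_density_iff) (auto intro: AE_not_in[THEN AE_mp])
      then show ?thesis using n by (simp add: null_setsD1)
    qed
    then show "emeasure (restr_to_subalg ?N F) X = emeasure (restr_to_subalg M F) X"
      by (simp add: emeasure_restr_to_subalg[OF sub XF] emeasure_restr_to_subalg[OF subN XF])
  next
    show "sets (restr_to_subalg ?N F) = sigma_sets (space M) ?E"
      by (simp add: sets_restr_to_subalg[OF subN] sF)
    show "sets (restr_to_subalg M F) = sigma_sets (space M) ?E"
      by (simp add: sets_restr_to_subalg[OF sub] sF)
    show "range (\<lambda>_. space M) \<subseteq> ?E" by (auto intro: cyl_space)
    fix i :: nat
    have "emeasure ?N (space M) = 1"
      using cyl_dens[OF \<phi> cyl_space] emeasure_space_1 by simp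
    moreover have "space M \<in> sets F" by (metis sF(2) sets.top)
    ultimately show "emeasure (restr_to_subalg ?N F) (space M) \<noteq> \<infinity>"
      using emeasure_restr_to_subalg[OF subN] by simp
  qed auto
  have GF: "G \<in> sets F"
  proof -
    have "noise_history M W r \<subseteq> sigma_sets (space M) ?E"
      unfolding noise_history_def
    proof (rule sigma_sets_mono)
      show "{W \<psi> -` B \<inter> space M |\<psi> B. \<psi> \<in> L2_halfplane \<and> (\<forall>s y. r < s \<longrightarrow> \<psi> (s, y) = 0) \<and> B \<in> sets borel} \<union> null_sets M
        \<subseteq> sigma_sets (space M) ?E"
      proof
        fix X assume "X \<in> {W \<psi> -` B \<inter> space M |\<psi> B. \<psi> \<in> L2_halfplane \<and> (\<forall>s y. r < s \<longrightarrow> \<psi> (s, y) = 0) \<and> B \<in> sets borel} \<union> null_sets M"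
        then consider \<psi> B where "X = W \<psi> -` B \<inter> space M" "\<psi> \<in> L2_halfplane" "\<forall>s y. r < s \<longrightarrow> \<psi> (s, y) = 0" "B \<in> sets borel"
          | "X \<in> null_sets M" by auto
        then show "X \<in> sigma_sets (space M) ?E"
        proof cases
          case 1
          have "cyl r (space M \<inter> (W \<psi> -` B \<inter> space M))"
            by (rule cyl_Int[OF cyl_space]) (use 1 in auto)
          moreover have "space M \<inter> (W \<psi> -` B \<inter> space M) = X" using 1 by auto
          ultimately show ?thesis by (auto intro: sigma_sets.Basic)
        qed (auto intro: sigma_sets.Basic)
      qed
    qed
    then show ?thesis using G sF by auto
  qed
  show ?thesis
    using arg_cong[OF eq, of "\<lambda>N. emeasure N G"]
    by (simp add: emeasure_restr_to_subalg[OF sub GF] emeasure_restr_to_subalg[OF subN GF])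
qed

text \<open>Right-continuity is the obstacle: an event of the filtration at \<open>r\<close> is only
  known to lie in the histories at strictly later times, whereas \<open>\<phi>\<close> acts
  immediately after \<open>r\<close>. The drift is therefore switched on with a delay 1/(n+1), and
  the delay is removed by convergence of the densities in \<open>L\<^sup>2\<close>.\<close>

lemma noise_filtration_dens:
  assumes \<phi>: "\<phi> \<in> L2_halfplane" "\<And>s y. s \<le> r \<Longrightarrow> \<phi> (s, y) = 0" and G: "G \<in> sets (noise_filtration M W r)"
  shows "emeasure (density M (\<lambda>\<omega>. ennreal (dens \<phi> \<omega>))) G = emeasure M G"
proof -
  note [measurable] = dens_measurable[OF \<phi>(1)]
  have [measurable]: "\<phi> \<in> borel_measurable borel" using \<phi> by (auto dest: L2_halfplaneD)
  define \<psi> where "\<psi> n z = indicator ({r + 1 / Suc n<..} \<times> UNIV) z * \<phi> z" for n z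
  have [measurable]: "{r + 1 / Suc n<..} \<times> (UNIV :: real set) \<in> sets borel" for n
    unfolding borel_prod[symmetric] by (intro pair_measureI) auto
  have \<psi>m[measurable]: "\<psi> n \<in> borel_measurable borel" for n unfolding \<psi>_def[abs_def] by measurable
  have \<psi>: "\<psi> n \<in> L2_halfplane" for n
  proof -
    have "integrable lborel (\<lambda>z. (\<psi> n z)\<^sup>2)"
    proof (rule Bochner_Integration.integrable_bound[OF L2_halfplaneD(2)[OF \<phi>(1)]])
      show "(\<lambda>z. (\<psi> n z)\<^sup>2) \<in> borel_measurable lborel" by measurable
    qed (auto simp: \<psi>_def indicator_def)
    then show ?thesis using \<psi>m L2_halfplaneD(3)[OF \<phi>(1)] by (auto simp: L2_halfplane_def \<psi>_def)
  qed
  have ip1: "ip (\<psi> n) \<phi> = ip (\<psi> n) (\<psi> n)" for n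
    by (intro Bochner_Integration.integral_cong) (auto simp: \<psi>_def indicator_def)
  have lim: "(\<lambda>n. ip (\<psi> n) \<phi>) \<longlonglongrightarrow> ip \<phi> \<phi>"
  proof (rule integral_dominated_convergence[where w="\<lambda>z. (\<phi> z)\<^sup>2"])
    show "AE z in lborel. (\<lambda>n. \<psi> n z * \<phi> z) \<longlonglongrightarrow> \<phi> z * \<phi> z"
    proof (rule AE_I2)
      fix z :: "real \<times> real"
      obtain s y where z: "z = (s, y)" by (cases z)
      show "(\<lambda>n. \<psi> n z * \<phi> z) \<longlonglongrightarrow> \<phi> z * \<phi> z"
      proof (cases "s \<le> r")
        case True then show ?thesis using \<phi>(2) z by simp
      next
        case False
        then have "s - r > 0" by simp
        then have "\<forall>\<^sub>F n in sequentially. inverse (real (Suc n)) < s - r"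
          by (rule order_tendstoD(2)[OF LIMSEQ_inverse_real_of_nat])
        then have "\<forall>\<^sub>F n in sequentially. \<psi> n z * \<phi> z = \<phi> z * \<phi> z"
          by eventually_elim (auto simp: \<psi>_def z indicator_def inverse_eq_divide)
        then show ?thesis by (rule tendsto_eventually)
      qed
    qed
    show "integrable lborel (\<lambda>z. (\<phi> z)\<^sup>2)" by (rule L2_halfplaneD(2)[OF \<phi>(1)])
    show "AE z in lborel. norm (\<psi> n z * \<phi> z) \<le> (\<phi> z)\<^sup>2" for n
      by (auto simp: \<psi>_def indicator_def power2_eq_square)
  qed measurable
  have [measurable]: "G \<in> sets M" using G noise_filtration_subalgebra by (auto simp: subalgebra_def)
  have nnd: "0 \<le> indicat_real G \<omega> * dens \<phi> \<omega>" for \<omega> \<phi>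
    using dens_pos[of \<phi> \<omega>] by (intro mult_nonneg_nonneg) auto
  have eqn: "expectation (\<lambda>\<omega>. indicator G \<omega> * dens (\<psi> n) \<omega>) = prob G" for n
  proof -
    note [measurable] = dens_measurable[OF \<psi>]
    have "emeasure (density M (\<lambda>\<omega>. ennreal (dens (\<psi> n) \<omega>))) G = emeasure M G"
      by (rule noise_history_dens[OF \<psi>, of "r + 1 / Suc n"])
        (use G in \<open>auto simp: sets_noise_filtration \<psi>_def indicator_def\<close>)
    moreover have "emeasure (density M (\<lambda>\<omega>. ennreal (dens (\<psi> n) \<omega>))) G = (\<integral>\<^sup>+\<omega>. ennreal (indicator G \<omega> * dens (\<psi> n) \<omega>) \<partial>M)"
      by (subst emeasure_density) (auto intro!: nn_integral_cong simp: indicator_def)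
    ultimately have "(\<integral>\<^sup>+\<omega>. ennreal (indicator G \<omega> * dens (\<psi> n) \<omega>) \<partial>M) = emeasure M G" by simp
    then show ?thesis using nnd[of _ "\<psi> n"] by (subst integral_eq_nn_integral) (auto simp: measure_def)
  qed
  let ?a = "expectation (\<lambda>\<omega>. indicator G \<omega> * dens \<phi> \<omega>)"
  have ind: "integrable M (\<lambda>\<omega>. indicator G \<omega> * dens \<psi> \<omega>)" if "\<psi> \<in> L2_halfplane" for \<psi>
    using dens_measurable[OF that]
    by (intro Bochner_Integration.integrable_bound[OF dens_expectation(1)[OF that]]) (auto simp: indicator_def)
  have key: "\<bar>?a - prob G\<bar> \<le> (\<eta> + (exp (ip \<phi> \<phi>) - exp (ip (\<psi> n) \<phi>)) / \<eta>) / 2" if "\<eta> > 0" for \<eta> n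
  proof -
    note [measurable] = dens_measurable[OF \<psi>]
    note I = dens_prod_expectation[OF \<phi>(1) \<phi>(1)] dens_prod_expectation[OF \<psi> \<phi>(1), of n] dens_prod_expectation[OF \<psi> \<psi>, of n n]
    \<comment> \<open>The delayed drift has the same inner product with itself as with
      \<open>\<phi>\<close>, so the mixed term and the square of the delayed density combine into
      one exponential.\<close>
    have sq: "integrable M (\<lambda>\<omega>. (dens \<phi> \<omega> - dens (\<psi> n) \<omega>)\<^sup>2)"
      "expectation (\<lambda>\<omega>. (dens \<phi> \<omega> - dens (\<psi> n) \<omega>)\<^sup>2) = exp (ip \<phi> \<phi>) - exp (ip (\<psi> n) \<phi>)"
    proof -
      have e: "(\<lambda>\<omega>. (dens \<phi> \<omega> - dens (\<psi> n) \<omega>)\<^sup>2) = (\<lambda>\<omega>. dens \<phi> \<omega> * dens \<phi> \<omega> - 2 * (dens (\<psi> n) \<omega> * dens \<phi> \<omega>) + dens (\<psi> n) \<omega> * dens (\<psi> n) \<omega>)"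
        by (auto simp: fun_eq_iff power2_eq_square algebra_simps)
      show "integrable M (\<lambda>\<omega>. (dens \<phi> \<omega> - dens (\<psi> n) \<omega>)\<^sup>2)" unfolding e using I by auto
      show "expectation (\<lambda>\<omega>. (dens \<phi> \<omega> - dens (\<psi> n) \<omega>)\<^sup>2) = exp (ip \<phi> \<phi>) - exp (ip (\<psi> n) \<phi>)"
        unfolding e using I ip1[of n] by simp
    qed
    have "?a - prob G = expectation (\<lambda>\<omega>. indicator G \<omega> * dens \<phi> \<omega> - indicator G \<omega> * dens (\<psi> n) \<omega>)"
      using eqn[of n] ind[OF \<phi>(1)] ind[OF \<psi>] by simp
    also have "\<bar>\<dots>\<bar> \<le> expectation (\<lambda>\<omega>. \<bar>indicator G \<omega> * dens \<phi> \<omega> - indicator G \<omega> * dens (\<psi> n) \<omega>\<bar>)"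
      by (rule integral_abs_bound)
    also have "\<dots> \<le> expectation (\<lambda>\<omega>. (\<eta> + (dens \<phi> \<omega> - dens (\<psi> n) \<omega>)\<^sup>2 / \<eta>) / 2)"
    proof (rule integral_mono)
      show "integrable M (\<lambda>\<omega>. \<bar>indicator G \<omega> * dens \<phi> \<omega> - indicator G \<omega> * dens (\<psi> n) \<omega>\<bar>)"
        using ind[OF \<phi>(1)] ind[OF \<psi>] by auto
      show "integrable M (\<lambda>\<omega>. (\<eta> + (dens \<phi> \<omega> - dens (\<psi> n) \<omega>)\<^sup>2 / \<eta>) / 2)" using sq by auto
      show "\<bar>indicator G \<omega> * dens \<phi> \<omega> - indicator G \<omega> * dens (\<psi> n) \<omega>\<bar> \<le> (\<eta> + (dens \<phi> \<omega> - dens (\<psi> n) \<omega>)\<^sup>2 / \<eta>) / 2" for \<omega>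
        using abs_le_square_bound[OF that, of "dens \<phi> \<omega> - dens (\<psi> n) \<omega>"] that
        by (auto simp: indicator_def)
    qed
    also have "\<dots> = (\<eta> + (exp (ip \<phi> \<phi>) - exp (ip (\<psi> n) \<phi>)) / \<eta>) / 2"
      using sq by (simp add: prob_space)
    finally show ?thesis .
  qed
  have "\<bar>?a - prob G\<bar> \<le> \<eta> / 2" if "\<eta> > 0" for \<eta>
  proof (rule LIMSEQ_le_const)
    have "(\<lambda>n. (\<eta> + (exp (ip \<phi> \<phi>) - exp (ip (\<psi> n) \<phi>)) / \<eta>) / 2) \<longlonglongrightarrow> (\<eta> + (exp (ip \<phi> \<phi>) - exp (ip \<phi> \<phi>)) / \<eta>) / 2"
      by (intro tendsto_intros lim) (use that in auto)
    then show "(\<lambda>n. (\<eta> + (exp (ip \<phi> \<phi>) - exp (ip (\<psi> n) \<phi>)) / \<eta>) / 2) \<longlonglongrightarrow> \<eta> / 2" by simp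
    show "\<exists>N. \<forall>n\<ge>N. \<bar>?a - prob G\<bar> \<le> (\<eta> + (exp (ip \<phi> \<phi>) - exp (ip (\<psi> n) \<phi>)) / \<eta>) / 2"
      using key[OF that] by auto
  qed
  from this[of "2 * e" for e] have "\<bar>?a - prob G\<bar> \<le> 0 + e" if "e > 0" for e using that by simp
  then have "\<bar>?a - prob G\<bar> \<le> 0" by (rule field_le_epsilon)
  then have a: "?a = prob G" by simp
  have "emeasure (density M (\<lambda>\<omega>. ennreal (dens \<phi> \<omega>))) G = (\<integral>\<^sup>+\<omega>. ennreal (indicator G \<omega> * dens \<phi> \<omega>) \<partial>M)"
    by (subst emeasure_density) (auto intro!: nn_integral_cong simp: indicator_def)
  also have "\<dots> = ennreal ?a"
    using nnd[of _ \<phi>] by (intro nn_integral_eq_integral ind \<phi>) auto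
  finally show ?thesis using a by (simp add: emeasure_eq_measure)
qed

lemma dens_nn_integral_noise_filtration:
  assumes \<phi>: "\<phi> \<in> L2_halfplane" "\<And>s y. s \<le> r \<Longrightarrow> \<phi> (s, y) = 0"
    and V: "V \<in> borel_measurable (noise_filtration M W r)"
  shows "(\<integral>\<^sup>+\<omega>. ennreal (dens \<phi> \<omega>) * V \<omega> \<partial>M) = (\<integral>\<^sup>+\<omega>. V \<omega> \<partial>M)"
proof -
  note [measurable] = dens_measurable[OF \<phi>(1)] measurable_noise_filtration_M[OF V]
  let ?N = "density M (\<lambda>\<omega>. ennreal (dens \<phi> \<omega>))" and ?F = "noise_filtration M W r"
  have sub: "subalgebra M ?F" by (rule noise_filtration_subalgebra)
  then have subN: "subalgebra ?N ?F" by (simp add: subalgebra_def)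
  have eq: "restr_to_subalg ?N ?F = restr_to_subalg M ?F"
    by (rule measure_eqI)
      (auto simp: sets_restr_to_subalg[OF sub] sets_restr_to_subalg[OF subN]
        emeasure_restr_to_subalg[OF sub] emeasure_restr_to_subalg[OF subN] noise_filtration_dens[OF \<phi>])
  have "(\<integral>\<^sup>+\<omega>. ennreal (dens \<phi> \<omega>) * V \<omega> \<partial>M) = (\<integral>\<^sup>+\<omega>. V \<omega> \<partial>?N)"
    by (subst nn_integral_density) auto
  also have "\<dots> = (\<integral>\<^sup>+\<omega>. V \<omega> \<partial>restr_to_subalg ?N ?F)"
    by (rule nn_integral_subalgebra2[OF subN V, symmetric])
  also have "\<dots> = (\<integral>\<^sup>+\<omega>. V \<omega> \<partial>M)"
    unfolding eq by (rule nn_integral_subalgebra2[OF sub V])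
  finally show ?thesis .
qed

end

section \<open>Exponential bounds for Walsh integrals\<close>

lemma ip_sum_sum:
  assumes "\<And>i. i \<in> I \<Longrightarrow> \<phi> i \<in> L2_halfplane"
  shows "ip (\<lambda>z. \<Sum>i\<in>I. a i * \<phi> i z) (\<lambda>z. \<Sum>i\<in>I. a i * \<phi> i z) = (\<Sum>i\<in>I. \<Sum>j\<in>I. a i * a j * ip (\<phi> i) (\<phi> j))"
proof -
  have "ip (\<lambda>z. \<Sum>i\<in>I. a i * \<phi> i z) (\<lambda>z. \<Sum>i\<in>I. a i * \<phi> i z)
      = (\<integral>z. (\<Sum>i\<in>I. \<Sum>j\<in>I. a i * a j * (\<phi> i z * \<phi> j z)) \<partial>lborel)"
    by (intro Bochner_Integration.integral_cong) (auto simp: sum_product algebra_simps)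
  also have "\<dots> = (\<Sum>i\<in>I. \<integral>z. (\<Sum>j\<in>I. a i * a j * (\<phi> i z * \<phi> j z)) \<partial>lborel)"
    by (intro Bochner_Integration.integral_sum Bochner_Integration.integrable_sum integrable_mult_right integrable_ip assms)
  also have "\<dots> = (\<Sum>i\<in>I. \<Sum>j\<in>I. a i * a j * ip (\<phi> i) (\<phi> j))"
  proof (rule sum.cong[OF refl])
    fix i assume i: "i \<in> I"
    have "(\<integral>z. (\<Sum>j\<in>I. a i * a j * (\<phi> i z * \<phi> j z)) \<partial>lborel) = (\<Sum>j\<in>I. \<integral>z. a i * a j * (\<phi> i z * \<phi> j z) \<partial>lborel)"
      by (intro Bochner_Integration.integral_sum integrable_mult_right integrable_ip assms i)
    then show "(\<integral>z. (\<Sum>j\<in>I. a i * a j * (\<phi> i z * \<phi> j z)) \<partial>lborel) = (\<Sum>j\<in>I. a i * a j * ip (\<phi> i) (\<phi> j))"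
      by simp
  qed
  finally show ?thesis .
qed

section \<open>One time step of the exponential inequality\<close>

context noise_space
begin

text \<open>For deterministic coefficients the exponential is the density of a drift acting after
  \<open>\<tau>\<close>, and equality holds. Coefficients known at \<open>\<tau>\<close> are rounded
  down to dyadic values; this splits the space into countably many events known at
  \<open>\<tau>\<close> on which they are constant. Fatou's lemma then removes the rounding, at the
  price of an inequality.\<close>

lemma exp_adapted_step:
  fixes V :: "'a \<Rightarrow> real" and X :: "nat \<Rightarrow> 'a \<Rightarrow> real"
  assumes \<phi>: "\<And>i. i < k \<Longrightarrow> \<phi> i \<in> L2_halfplane" "\<And>i s y. i < k \<Longrightarrow> s \<le> \<tau> \<Longrightarrow> \<phi> i (s, y) = 0"
    and X: "\<And>i. i < k \<Longrightarrow> X i \<in> borel_measurable (noise_filtration M W \<tau>)"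
    and V: "V \<in> borel_measurable (noise_filtration M W \<tau>)" "\<And>\<omega>. 0 \<le> V \<omega>"
  shows "(\<integral>\<^sup>+\<omega>. ennreal (V \<omega> * exp ((\<Sum>i<k. X i \<omega> * W (\<phi> i) \<omega>)
      - (\<Sum>i<k. \<Sum>j<k. X i \<omega> * X j \<omega> * ip (\<phi> i) (\<phi> j)) / 2)) \<partial>M) \<le> (\<integral>\<^sup>+\<omega>. ennreal (V \<omega>) \<partial>M)"
proof -
  define f where "f x \<omega> = exp ((\<Sum>i<k. x i * W (\<phi> i) \<omega>) - (\<Sum>i<k. \<Sum>j<k. x i * x j * ip (\<phi> i) (\<phi> j)) / 2)"
    for x :: "nat \<Rightarrow> real" and \<omega>
  define Y where "Y m i \<omega> = of_int \<lfloor>2 ^ m * X i \<omega>\<rfloor> / (2 ^ m :: real)" for m i \<omega>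
  have XM[measurable]: "i < k \<Longrightarrow> X i \<in> borel_measurable M" for i
    using X by (rule measurable_noise_filtration_M)
  have VM[measurable]: "V \<in> borel_measurable M"
    using V(1) by (rule measurable_noise_filtration_M)
  have WM[measurable]: "i < k \<Longrightarrow> W (\<phi> i) \<in> borel_measurable M" for i
    using \<phi> by (intro W_measurable)
  have YM[measurable]: "i < k \<Longrightarrow> Y m i \<in> borel_measurable M" for m i
    unfolding Y_def[abs_def] by measurable
  have fY: "(\<lambda>\<omega>. f (\<lambda>i. Y m i \<omega>) \<omega>) \<in> borel_measurable M" for m
  proof -
    have 1: "(\<lambda>\<omega>. \<Sum>i<k. Y m i \<omega> * W (\<phi> i) \<omega>) \<in> borel_measurable M"
      by (intro borel_measurable_sum borel_measurable_times WM YM) auto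
    have 2: "(\<lambda>\<omega>. \<Sum>i<k. \<Sum>j<k. Y m i \<omega> * Y m j \<omega> * ip (\<phi> i) (\<phi> j)) \<in> borel_measurable M"
      by (intro borel_measurable_sum borel_measurable_times YM borel_measurable_const) auto
    show ?thesis unfolding f_def using 1 2 by simp
  qed
  have eq: "(\<integral>\<^sup>+\<omega>. ennreal (V \<omega> * f (\<lambda>i. Y m i \<omega>) \<omega>) \<partial>M) = (\<integral>\<^sup>+\<omega>. ennreal (V \<omega>) \<partial>M)" for m
  proof -
    \<comment> \<open>The vector of rounded coefficients is encoded as a natural number, so that the
      cells \<open>E n\<close> form a sequence. A number that is not the code of a list of length
      \<open>k\<close> has an empty cell.\<close>
    define \<Xi> where "\<Xi> \<omega> = map (\<lambda>i. \<lfloor>2 ^ m * X i \<omega>\<rfloor>) [0..<k]" for \<omega>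
    define E where "E n = {\<omega> \<in> space M. to_nat (\<Xi> \<omega>) = n}" for n
    define x where "x n i = of_int ((from_nat n :: int list) ! i) / (2 ^ m :: real)" for n i
    define \<psi> where "\<psi> n z = (\<Sum>i<k. x n i * \<phi> i z)" for n z
    have Y: "Y m i \<omega> = x n i" if "\<omega> \<in> E n" "i < k" for i \<omega> n
      using that by (auto simp: Y_def x_def E_def \<Xi>_def)
    have EF: "E n \<in> sets (noise_filtration M W \<tau>)" for n
    proof -
      have "E n = (if \<exists>zs :: int list. to_nat zs = n \<and> length zs = k then {\<omega> \<in> space (noise_filtration M W \<tau>). \<forall>i\<in>{..<k}. \<lfloor>2 ^ m * X i \<omega>\<rfloor> = (from_nat n :: int list) ! i} else {})"
      proof (cases "\<exists>zs :: int list. to_nat zs = n \<and> length zs = k")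
        case True
        then obtain zs :: "int list" where zs: "to_nat zs = n" "length zs = k" by auto
        then have "to_nat (\<Xi> \<omega>) = n \<longleftrightarrow> (\<forall>i\<in>{..<k}. \<lfloor>2 ^ m * X i \<omega>\<rfloor> = zs ! i)" for \<omega>
          unfolding zs(1)[symmetric] to_nat_split by (simp add: \<Xi>_def list_eq_iff_nth_eq Ball_def)
        moreover have "from_nat n = zs" using zs(1) by auto
        ultimately have "E n = {\<omega> \<in> space (noise_filtration M W \<tau>). \<forall>i\<in>{..<k}. \<lfloor>2 ^ m * X i \<omega>\<rfloor> = (from_nat n :: int list) ! i}"
          by (simp add: E_def)
        then show ?thesis using True by simp
      next
        case False
        then have "to_nat (\<Xi> \<omega>) \<noteq> n" for \<omega> by (auto simp: \<Xi>_def)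
        then show ?thesis using False by (auto simp: E_def)
      qed
      also have "\<dots> \<in> sets (noise_filtration M W \<tau>)"
      proof -
        have "{\<omega> \<in> space (noise_filtration M W \<tau>). \<forall>i\<in>{..<k}. \<lfloor>2 ^ m * X i \<omega>\<rfloor> = (from_nat n :: int list) ! i} \<in> sets (noise_filtration M W \<tau>)"
        proof (rule sets.sets_Collect_finite_All)
          fix i assume "i \<in> {..<k}"
          then have [measurable]: "X i \<in> borel_measurable (noise_filtration M W \<tau>)" using X by simp
          show "{\<omega> \<in> space (noise_filtration M W \<tau>). \<lfloor>2 ^ m * X i \<omega>\<rfloor> = (from_nat n :: int list) ! i} \<in> sets (noise_filtration M W \<tau>)"
            by measurable
        qed simp
        then show ?thesis by auto
      qed
      finally show ?thesis .
    qed
    have EM[measurable]: "E n \<in> sets M" for n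
      using EF noise_filtration_subalgebra by (auto simp: subalgebra_def)
    have \<psi>: "\<psi> n \<in> L2_halfplane" for n
      unfolding \<psi>_def[abs_def] by (rule L2_halfplane_sum) (use \<phi> in auto)
    note [measurable] = dens_measurable[OF \<psi>]
    have fd: "AE \<omega> in M. f (x n) \<omega> = dens (\<psi> n) \<omega>" for n
    proof -
      have "AE \<omega> in M. W (\<psi> n) \<omega> = (\<Sum>i<k. x n i * W (\<phi> i) \<omega>)"
        unfolding \<psi>_def[abs_def] by (rule W_sum) (use \<phi> in auto)
      moreover have "ip (\<psi> n) (\<psi> n) = (\<Sum>i<k. \<Sum>j<k. x n i * x n j * ip (\<phi> i) (\<phi> j))"
        unfolding \<psi>_def[abs_def] by (rule ip_sum_sum) (use \<phi> in auto)
      ultimately show ?thesis by (auto simp: f_def dens_def)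
    qed
    have disj: "disjoint_family E" by (auto simp: disjoint_family_on_def E_def)
    have "(\<integral>\<^sup>+\<omega>. ennreal (V \<omega> * f (\<lambda>i. Y m i \<omega>) \<omega>) \<partial>M)
      = (\<integral>\<^sup>+\<omega>. (\<Sum>n. ennreal (dens (\<psi> n) \<omega>) * (ennreal (V \<omega>) * indicator (E n) \<omega>)) \<partial>M)"
    proof (rule nn_integral_cong_AE)
      have "AE \<omega> in M. \<forall>n. f (x n) \<omega> = dens (\<psi> n) \<omega>" using fd by (simp add: AE_all_countable)
      then show "AE \<omega> in M. ennreal (V \<omega> * f (\<lambda>i. Y m i \<omega>) \<omega>)
        = (\<Sum>n. ennreal (dens (\<psi> n) \<omega>) * (ennreal (V \<omega>) * indicator (E n) \<omega>))"
      using AE_space proof eventually_elim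
        case (elim \<omega>)
        define n where "n = to_nat (\<Xi> \<omega>)"
        have \<omega>: "\<omega> \<in> E n" using elim by (simp add: E_def n_def)
        have "(\<Sum>n. ennreal (dens (\<psi> n) \<omega>) * (ennreal (V \<omega>) * indicator (E n) \<omega>))
           = (\<Sum>n. (ennreal (dens (\<psi> n) \<omega>) * ennreal (V \<omega>)) * indicator (E n) \<omega>)"
          by (simp add: mult.assoc)
        also have "\<dots> = ennreal (dens (\<psi> n) \<omega>) * ennreal (V \<omega>)"
          by (rule suminf_cmult_indicator[OF disj \<omega>])
        also have "dens (\<psi> n) \<omega> = f (x n) \<omega>" using elim by simp
        also have "f (x n) \<omega> = f (\<lambda>i. Y m i \<omega>) \<omega>"
          using Y[OF \<omega>] by (simp add: f_def)
        finally show ?case using V(2)[of \<omega>] by (simp add: ennreal_mult f_def mult.commute)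
      qed
    qed
    also have "\<dots> = (\<Sum>n. \<integral>\<^sup>+\<omega>. ennreal (dens (\<psi> n) \<omega>) * (ennreal (V \<omega>) * indicator (E n) \<omega>) \<partial>M)"
      by (rule nn_integral_suminf) measurable
    \<comment> \<open>On the cell \<open>E n\<close> the exponential is one fixed density, and
      \<open>V\<close> times the indicator of the cell is known at \<open>\<tau>\<close>, so the
      density integrates out.\<close>
    also have "\<dots> = (\<Sum>n. \<integral>\<^sup>+\<omega>. ennreal (V \<omega>) * indicator (E n) \<omega> \<partial>M)"
    proof (intro suminf_cong dens_nn_integral_noise_filtration \<psi>)
      fix n s y assume "s \<le> \<tau>" then show "\<psi> n (s, y) = 0" using \<phi>(2) by (simp add: \<psi>_def)
    next
      fix n
      note [measurable] = V(1) EF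
      show "(\<lambda>\<omega>. ennreal (V \<omega>) * indicator (E n) \<omega>) \<in> borel_measurable (noise_filtration M W \<tau>)"
        by measurable
    qed
    also have "\<dots> = (\<integral>\<^sup>+\<omega>. (\<Sum>n. ennreal (V \<omega>) * indicator (E n) \<omega>) \<partial>M)"
      by (rule nn_integral_suminf[symmetric]) measurable
    also have "\<dots> = (\<integral>\<^sup>+\<omega>. ennreal (V \<omega>) \<partial>M)"
    proof (rule nn_integral_cong)
      fix \<omega> assume "\<omega> \<in> space M"
      then have "\<omega> \<in> E (to_nat (\<Xi> \<omega>))" by (simp add: E_def)
      then show "(\<Sum>n. ennreal (V \<omega>) * indicator (E n) \<omega>) = ennreal (V \<omega>)"
        by (rule suminf_cmult_indicator[OF disj])
    qed
    finally show ?thesis .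
  qed
  have Ylim: "(\<lambda>m. Y m i \<omega>) \<longlonglongrightarrow> X i \<omega>" for i \<omega>
  proof (rule tendsto_sandwich)
    show "\<forall>\<^sub>F m in sequentially. X i \<omega> - (1 / 2) ^ m \<le> Y m i \<omega>"
    proof (intro always_eventually allI)
      fix m
      have "2 ^ m * X i \<omega> - 1 \<le> of_int \<lfloor>2 ^ m * X i \<omega>\<rfloor>" by linarith
      then have "(2 ^ m * X i \<omega> - 1) / 2 ^ m \<le> Y m i \<omega>" unfolding Y_def by (intro divide_right_mono) auto
      then show "X i \<omega> - (1 / 2) ^ m \<le> Y m i \<omega>" by (simp add: field_simps)
    qed
    show "\<forall>\<^sub>F m in sequentially. Y m i \<omega> \<le> X i \<omega>"
    proof (intro always_eventually allI)
      fix m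
      have "of_int \<lfloor>2 ^ m * X i \<omega>\<rfloor> \<le> 2 ^ m * X i \<omega>" by linarith
      then have "Y m i \<omega> \<le> (2 ^ m * X i \<omega>) / 2 ^ m" unfolding Y_def by (intro divide_right_mono) auto
      then show "Y m i \<omega> \<le> X i \<omega>" by simp
    qed
    have "(\<lambda>m. X i \<omega> - (1 / 2) ^ m) \<longlonglongrightarrow> X i \<omega> - 0"
      by (intro tendsto_diff tendsto_const LIMSEQ_realpow_zero) auto
    then show "(\<lambda>m. X i \<omega> - (1 / 2) ^ m) \<longlonglongrightarrow> X i \<omega>" by simp
  qed simp
  have "(\<integral>\<^sup>+\<omega>. ennreal (V \<omega> * f (\<lambda>i. X i \<omega>) \<omega>) \<partial>M)
      = (\<integral>\<^sup>+\<omega>. liminf (\<lambda>m. ennreal (V \<omega> * f (\<lambda>i. Y m i \<omega>) \<omega>)) \<partial>M)"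
  proof (rule nn_integral_cong)
    fix \<omega>
    have "(\<lambda>m. ennreal (V \<omega> * f (\<lambda>i. Y m i \<omega>) \<omega>)) \<longlonglongrightarrow> ennreal (V \<omega> * f (\<lambda>i. X i \<omega>) \<omega>)"
      unfolding f_def by (intro tendsto_intros Ylim) auto
    then show "ennreal (V \<omega> * f (\<lambda>i. X i \<omega>) \<omega>) = liminf (\<lambda>m. ennreal (V \<omega> * f (\<lambda>i. Y m i \<omega>) \<omega>))"
      by (intro lim_imp_Liminf[symmetric]) auto
  qed
  also have "\<dots> \<le> liminf (\<lambda>m. \<integral>\<^sup>+\<omega>. ennreal (V \<omega> * f (\<lambda>i. Y m i \<omega>) \<omega>) \<partial>M)"
    by (rule nn_integral_liminf) (use fY in measurable)
  also have "\<dots> = (\<integral>\<^sup>+\<omega>. ennreal (V \<omega>) \<partial>M)" unfolding eq by (rule Liminf_const) simp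
  finally show ?thesis unfolding f_def .
qed

end

section \<open>Simple integrands and their exponential bound\<close>

definition ephi :: "'a elementary \<Rightarrow> real \<times> real \<Rightarrow> real" where
  "ephi = (\<lambda>(X, r, t, A). indicat_real ({r<..t} \<times> A))"

text \<open>The total quadratic variation of the simple integral at the given outcome.\<close>

definition sq :: "'a elementary list \<Rightarrow> 'a \<Rightarrow> real" where
  "sq S \<omega> = (\<integral>z. (simple_value S (fst z) (snd z) \<omega>)\<^sup>2 \<partial>lborel)"

lemma simple_value_Nil [simp]: "simple_value [] s y \<omega> = 0"
  and simple_value_Cons: "simple_value (e # S) s y \<omega> = fst e \<omega> * ephi e (s, y) + simple_value S s y \<omega>"
  and simple_value_append: "simple_value (S @ S') s y \<omega> = simple_value S s y \<omega> + simple_value S' s y \<omega>"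
  by (auto simp: simple_value_def ephi_def indicator_times mult.assoc split: prod.splits)

lemma simple_integral_Nil [simp]: "simple_integral W [] \<omega> = 0"
  and simple_integral_Cons: "simple_integral W (e # S) \<omega> = fst e \<omega> * W (ephi e) \<omega> + simple_integral W S \<omega>"
  and simple_integral_append: "simple_integral W (S @ S') \<omega> = simple_integral W S \<omega> + simple_integral W S' \<omega>"
  by (auto simp: simple_integral_def ephi_def split: prod.splits)

lemma simple_value_sum:
  "simple_value S s y \<omega> = (\<Sum>i<length S. fst (S ! i) \<omega> * ephi (S ! i) (s, y))"
proof -
  have "simple_value S s y \<omega> = sum_list (map (\<lambda>e. fst e \<omega> * ephi e (s, y)) S)"
    by (induction S) (auto simp: simple_value_Cons)
  then show ?thesis by (simp add: sum_list_sum_nth atLeast0LessThan)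
qed

lemma simple_integral_sum:
  "simple_integral W S \<omega> = (\<Sum>i<length S. fst (S ! i) \<omega> * W (ephi (S ! i)) \<omega>)"
proof -
  have "simple_integral W S \<omega> = sum_list (map (\<lambda>e. fst e \<omega> * W (ephi e) \<omega>) S)"
    by (induction S) (auto simp: simple_integral_Cons)
  then show ?thesis by (simp add: sum_list_sum_nth atLeast0LessThan)
qed

context noise_space
begin

lemma ephi_L2: "elementary_integrand M W e \<Longrightarrow> ephi e \<in> L2_halfplane"
  by (auto simp: elementary_integrand_def ephi_def intro!: L2_halfplane_indicator split: prod.splits)

lemma simple_value_L2:
  assumes "\<forall>e\<in>set S. elementary_integrand M W e"
  shows "(\<lambda>z. simple_value S (fst z) (snd z) \<omega>) \<in> L2_halfplane"
  unfolding simple_value_sum using assms by (intro L2_halfplane_sum) (auto intro: ephi_L2)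

lemma sq_sum:
  assumes "\<forall>e\<in>set S. elementary_integrand M W e"
  shows "sq S \<omega> = (\<Sum>i<length S. \<Sum>j<length S. fst (S ! i) \<omega> * fst (S ! j) \<omega> * ip (ephi (S ! i)) (ephi (S ! j)))"
proof -
  have "sq S \<omega> = ip (\<lambda>z. \<Sum>i<length S. fst (S ! i) \<omega> * ephi (S ! i) z) (\<lambda>z. \<Sum>i<length S. fst (S ! i) \<omega> * ephi (S ! i) z)"
    unfolding sq_def simple_value_sum by (simp add: power2_eq_square)
  also have "\<dots> = (\<Sum>i<length S. \<Sum>j<length S. fst (S ! i) \<omega> * fst (S ! j) \<omega> * ip (ephi (S ! i)) (ephi (S ! j)))"
    by (rule ip_sum_sum) (use assms in \<open>auto intro: ephi_L2\<close>)
  finally show ?thesis .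
qed

lemma sq_measurable:
  assumes "\<forall>e\<in>set S. elementary_integrand M W e" "\<forall>e\<in>set S. fst e \<in> borel_measurable N"
  shows "sq S \<in> borel_measurable N"
proof -
  have [measurable]: "i < length S \<Longrightarrow> fst (S ! i) \<in> borel_measurable N" for i using assms by auto
  have "(\<lambda>\<omega>. \<Sum>i<length S. \<Sum>j<length S. fst (S ! i) \<omega> * fst (S ! j) \<omega> * ip (ephi (S ! i)) (ephi (S ! j))) \<in> borel_measurable N"
    by (intro borel_measurable_sum borel_measurable_times borel_measurable_const) auto
  then show ?thesis by (subst measurable_cong[OF sq_sum[OF assms(1)]])
qed

lemma simple_integral_measurable:
  assumes "\<forall>e\<in>set S. fst e \<in> borel_measurable N" "\<forall>e\<in>set S. W (ephi e) \<in> borel_measurable N"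
  shows "simple_integral W S \<in> borel_measurable N"
proof -
  have "(\<lambda>\<omega>. \<Sum>i<length S. fst (S ! i) \<omega> * W (ephi (S ! i)) \<omega>) \<in> borel_measurable N"
    by (intro borel_measurable_sum borel_measurable_times) (use assms in auto)
  then show ?thesis by (subst measurable_cong[OF simple_integral_sum])
qed

lemma elementary_measurable: "elementary_integrand M W e \<Longrightarrow> fst e \<in> borel_measurable M"
  by (auto simp: elementary_integrand_def intro: measurable_noise_filtration_M)

lemma simple_integral_M: "\<forall>e\<in>set S. elementary_integrand M W e \<Longrightarrow> simple_integral W S \<in> borel_measurable M"
  by (intro simple_integral_measurable) (auto intro: W_measurable ephi_L2 elementary_measurable)

lemma sq_append:
  assumes "\<forall>e\<in>set S. elementary_integrand M W e" "\<forall>e\<in>set S'. elementary_integrand M W e"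
    and "\<forall>e\<in>set S. \<forall>e'\<in>set S'. \<forall>z. ephi e z = 0 \<or> ephi e' z = 0"
  shows "sq (S @ S') \<omega> = sq S \<omega> + sq S' \<omega>"
proof -
  let ?f = "\<lambda>z. simple_value S (fst z) (snd z) \<omega>" and ?g = "\<lambda>z. simple_value S' (fst z) (snd z) \<omega>"
  have "ip ?f ?g = 0"
  proof (rule ip_disjoint)
    fix z
    have "(\<forall>e\<in>set S. ephi e z = 0) \<or> (\<forall>e\<in>set S'. ephi e z = 0)" using assms(3) by metis
    then show "?f z = 0 \<or> ?g z = 0"
      unfolding simple_value_sum by (auto intro!: sum.neutral)
  qed
  then show ?thesis
    using ip_add_self[OF simple_value_L2[OF assms(1)] simple_value_L2[OF assms(2)], of \<omega> \<omega>]
    by (simp add: sq_def simple_value_append power2_eq_square)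
qed

text \<open>The entries of \<open>S\<close> have ended by \<open>\<tau>\<close> and those of
  \<open>S'\<close> all start there. The exponential belonging to \<open>S\<close> is thus known at
  \<open>\<tau>\<close> and serves as \<open>V\<close> in the one-step inequality; the quadratic
  variations add up because the supports are disjoint.\<close>

lemma simple_exp_step:
  assumes S: "\<forall>e\<in>set S. elementary_integrand M W e" "\<forall>(X, r, t, A)\<in>set S. t \<le> \<tau>"
    and S': "\<forall>e\<in>set S'. elementary_integrand M W e" "\<forall>(X, r, t, A)\<in>set S'. r = \<tau>"
  shows "(\<integral>\<^sup>+\<omega>. ennreal (exp (simple_integral W (S @ S') \<omega> - sq (S @ S') \<omega> / 2)) \<partial>M)
     \<le> (\<integral>\<^sup>+\<omega>. ennreal (exp (simple_integral W S \<omega> - sq S \<omega> / 2)) \<partial>M)"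
proof -
  let ?V = "\<lambda>\<omega>. exp (simple_integral W S \<omega> - sq S \<omega> / 2)"
  let ?k = "length S'"
  have S'e: "elementary_integrand M W (S' ! i)" "fst (snd (S' ! i)) = \<tau>" if "i < ?k" for i
  proof -
    have "S' ! i \<in> set S'" using that by simp
    from bspec[OF S'(1) this] bspec[OF S'(2) this] show "elementary_integrand M W (S' ! i)" "fst (snd (S' ! i)) = \<tau>" by (auto split: prod.splits)
  qed
  have fm: "\<forall>e\<in>set S. fst e \<in> borel_measurable (noise_filtration M W \<tau>)"
  proof
    fix e assume e: "e \<in> set S"
    obtain X r t A where eq: "e = (X, r, t, A)" by (cases e)
    have "X \<in> borel_measurable (noise_filtration M W r)" "r \<le> \<tau>"
      using bspec[OF S(1) e] bspec[OF S(2) e] eq by (auto simp: elementary_integrand_def)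
    then show "fst e \<in> borel_measurable (noise_filtration M W \<tau>)"
      using measurable_noise_filtration_mono eq by auto
  qed
  have Wm: "\<forall>e\<in>set S. W (ephi e) \<in> borel_measurable (noise_filtration M W \<tau>)"
  proof
    fix e assume e: "e \<in> set S"
    show "W (ephi e) \<in> borel_measurable (noise_filtration M W \<tau>)"
      using bspec[OF S(1) e] bspec[OF S(2) e]
      by (intro W_measurable_noise_filtration ephi_L2) (auto simp: ephi_def split: prod.splits)
  qed
  have Vm: "?V \<in> borel_measurable (noise_filtration M W \<tau>)"
  proof -
    have a: "simple_integral W S \<in> borel_measurable (noise_filtration M W \<tau>)" by (rule simple_integral_measurable[OF fm Wm])
    have b: "sq S \<in> borel_measurable (noise_filtration M W \<tau>)" by (rule sq_measurable[OF S(1) fm])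
    show ?thesis using a b by measurable
  qed
  have "(\<integral>\<^sup>+\<omega>. ennreal (?V \<omega> * exp ((\<Sum>i<?k. fst (S' ! i) \<omega> * W (ephi (S' ! i)) \<omega>)
      - (\<Sum>i<?k. \<Sum>j<?k. fst (S' ! i) \<omega> * fst (S' ! j) \<omega> * ip (ephi (S' ! i)) (ephi (S' ! j))) / 2)) \<partial>M)
      \<le> (\<integral>\<^sup>+\<omega>. ennreal (?V \<omega>) \<partial>M)"
  proof (rule exp_adapted_step[OF _ _ _ Vm])
    fix i assume i: "i < ?k"
    show "ephi (S' ! i) \<in> L2_halfplane" using S'e[OF i] by (intro ephi_L2)
    show "fst (S' ! i) \<in> borel_measurable (noise_filtration M W \<tau>)"
      using S'e[OF i] by (auto simp: elementary_integrand_def split: prod.splits)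
    fix s y :: real assume "s \<le> \<tau>"
    then show "ephi (S' ! i) (s, y) = 0" using S'e[OF i] by (auto simp: ephi_def split: prod.splits)
  qed simp
  also have "(\<lambda>\<omega>. ennreal (?V \<omega> * exp ((\<Sum>i<?k. fst (S' ! i) \<omega> * W (ephi (S' ! i)) \<omega>)
      - (\<Sum>i<?k. \<Sum>j<?k. fst (S' ! i) \<omega> * fst (S' ! j) \<omega> * ip (ephi (S' ! i)) (ephi (S' ! j))) / 2)))
     = (\<lambda>\<omega>. ennreal (exp (simple_integral W (S @ S') \<omega> - sq (S @ S') \<omega> / 2)))"
  proof
    fix \<omega>
    have "sq (S @ S') \<omega> = sq S \<omega> + sq S' \<omega>"
    proof (intro sq_append S S' ballI allI)
      fix e e' z assume e: "e \<in> set S" "e' \<in> set S'"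
      show "ephi e z = 0 \<or> ephi e' z = 0"
        using bspec[OF S(2) e(1)] bspec[OF S'(2) e(2)] by (auto simp: ephi_def indicator_def split: prod.splits)
    qed
    then show "ennreal (?V \<omega> * exp ((\<Sum>i<?k. fst (S' ! i) \<omega> * W (ephi (S' ! i)) \<omega>)
      - (\<Sum>i<?k. \<Sum>j<?k. fst (S' ! i) \<omega> * fst (S' ! j) \<omega> * ip (ephi (S' ! i)) (ephi (S' ! j))) / 2))
      = ennreal (exp (simple_integral W (S @ S') \<omega> - sq (S @ S') \<omega> / 2))"
      unfolding simple_integral_sum[symmetric, of S'] sq_sum[OF S'(1), symmetric] simple_integral_append exp_add[symmetric]
      by (simp add: algebra_simps add_divide_distrib)
  qed
  finally show ?thesis .
qed

text \<open>A list is cut at \<open>\<tau>\<close>: an entry running across \<open>\<tau>\<close> up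
  to \<open>\<tau>'\<close> is shortened by \<open>before\<close> and restarted at
  \<open>\<tau>\<close> by \<open>after\<close>. In the use below an entry starting later than
  \<open>\<tau>\<close> has an empty time interval, and both halves drop it.\<close>

definition before :: "real \<Rightarrow> 'b elementary list \<Rightarrow> 'b elementary list" where
  "before \<tau> S = map (\<lambda>(X, r, t, A). (X, r, min t \<tau>, A)) (filter (\<lambda>(X, r, t, A). r \<le> \<tau>) S)"

definition after :: "real \<Rightarrow> real \<Rightarrow> 'b elementary list \<Rightarrow> 'b elementary list" where
  "after \<tau> \<tau>' S = map (\<lambda>(X, r, t, A). (X, \<tau>, \<tau>', A)) (filter (\<lambda>(X, r, t, A). r \<le> \<tau> \<and> t = \<tau>') S)"

lemma split_value:
  assumes "\<tau> < \<tau>'" "\<forall>(X, r, t, A)\<in>set S. r \<le> t \<and> (t \<le> \<tau> \<or> r \<le> \<tau> \<and> t = \<tau>' \<or> r = \<tau>' \<and> t = \<tau>')"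
  shows "simple_value S s y \<omega> = simple_value (before \<tau> S @ after \<tau> \<tau>' S) s y \<omega>"
  using assms(2)
proof (induction S)
  case Nil then show ?case by (simp add: before_def after_def)
next
  case (Cons e S)
  obtain X r t A where e: "e = (X, r, t, A)" by (cases e)
  from Cons.prems have "r \<le> t" and c: "t \<le> \<tau> \<or> r \<le> \<tau> \<and> t = \<tau>' \<or> r = \<tau>' \<and> t = \<tau>'" by (auto simp: e)
  have IH: "simple_value S s y \<omega> = simple_value (before \<tau> S @ after \<tau> \<tau>' S) s y \<omega>" using Cons by auto
  from c show ?case
    using assms(1) \<open>r \<le> t\<close>
    by (elim disjE conjE)
      (auto simp: e simple_value_Cons IH before_def after_def simple_value_append ephi_def indicator_def min_def)
qed

text \<open>Unlike for the integrands, equality is only almost sure here, because the noise is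
  additive only up to null sets.\<close>

lemma split_integral:
  assumes "\<tau> < \<tau>'" "\<forall>(X, r, t, A)\<in>set S. (t \<le> \<tau> \<or> r \<le> \<tau> \<and> t = \<tau>' \<or> r = \<tau>' \<and> t = \<tau>')"
    "\<forall>e\<in>set S. elementary_integrand M W e"
  shows "AE \<omega> in M. simple_integral W S \<omega> = simple_integral W (before \<tau> S @ after \<tau> \<tau>' S) \<omega>"
  using assms(2,3)
proof (induction S)
  case Nil then show ?case by (simp add: before_def after_def)
next
  case (Cons e S)
  obtain X r t A where e: "e = (X, r, t, A)" by (cases e)
  from Cons.prems have el: "0 \<le> r" "r \<le> t" "A \<in> sets borel" "emeasure lborel A < \<infinity>"
    and c: "t \<le> \<tau> \<or> r \<le> \<tau> \<and> t = \<tau>' \<or> r = \<tau>' \<and> t = \<tau>'" by (auto simp: e elementary_integrand_def)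
  have IH: "AE \<omega> in M. simple_integral W S \<omega> = simple_integral W (before \<tau> S @ after \<tau> \<tau>' S) \<omega>" using Cons by auto
  consider "t \<le> \<tau>" | "r \<le> \<tau>" "t = \<tau>'" | "r = \<tau>'" "t = \<tau>'" using c by auto
  then show ?case
  proof cases
    case 1
    then have "before \<tau> (e # S) = e # before \<tau> S" "after \<tau> \<tau>' (e # S) = after \<tau> \<tau>' S"
      using assms(1) el by (auto simp: e before_def after_def)
    then show ?thesis using IH by (auto simp: simple_integral_Cons elim!: eventually_mono)
  next
    case 2
    then have b: "before \<tau> (e # S) = (X, r, \<tau>, A) # before \<tau> S" "after \<tau> \<tau>' (e # S) = (X, \<tau>, \<tau>', A) # after \<tau> \<tau>' S"
      using assms(1) el by (auto simp: e before_def after_def)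
    have l: "indicat_real ({r<..\<tau>} \<times> A) \<in> L2_halfplane" "indicat_real ({\<tau><..\<tau>'} \<times> A) \<in> L2_halfplane"
      using 2 el by (auto intro!: L2_halfplane_indicator)
    have s: "(\<lambda>z. indicat_real ({r<..\<tau>} \<times> A) z + indicat_real ({\<tau><..\<tau>'} \<times> A) z) = indicat_real ({r<..\<tau>'} \<times> A)"
      using 2 assms(1) by (auto simp: fun_eq_iff indicator_def)
    have "AE \<omega> in M. W (indicat_real ({r<..\<tau>'} \<times> A)) \<omega> = W (indicat_real ({r<..\<tau>} \<times> A)) \<omega> + W (indicat_real ({\<tau><..\<tau>'} \<times> A)) \<omega>"
      using W_add[OF l] unfolding s .
    with IH show ?thesis
      by eventually_elim (simp only: b simple_integral_Cons simple_integral_append, simp add: e ephi_def 2 algebra_simps)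
  next
    case 3
    then have b: "before \<tau> (e # S) = before \<tau> S" "after \<tau> \<tau>' (e # S) = after \<tau> \<tau>' S"
      using assms(1) el by (auto simp: e before_def after_def)
    have "ephi e = (\<lambda>_. 0)" using 3 by (auto simp: ephi_def e fun_eq_iff)
    with IH W_zero show ?thesis
      by (auto simp: b simple_integral_Cons elim: eventually_elim2)
  qed
qed

text \<open>Induction on the grid of all end points. The last time slab is peeled off, and by the
  one-step inequality this does not decrease the expectation.\<close>

lemma simple_exp_grid:
  assumes "finite T"
  shows "\<forall>e\<in>set S. elementary_integrand M W e \<Longrightarrow> \<forall>(X, r, t, A)\<in>set S. r \<in> T \<and> t \<in> T \<Longrightarrow>
    (\<integral>\<^sup>+\<omega>. ennreal (exp (simple_integral W S \<omega> - sq S \<omega> / 2)) \<partial>M) \<le> 1"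
  using assms
proof (induction T arbitrary: S rule: finite_linorder_max_induct)
  case empty
  then have "S = []" by (cases S) auto
  then show ?case by (simp add: sq_def emeasure_space_1)
next
  case (insert \<tau>' T)
  \<comment> \<open>If \<open>\<tau>'\<close> is the only grid point, all time intervals are empty
    and any earlier time serves as the cut.\<close>
  define \<tau> where "\<tau> = (if T = {} then \<tau>' - 1 else Max T)"
  have \<tau>: "\<tau> < \<tau>'" "T \<noteq> {} \<Longrightarrow> \<tau> \<in> T" "\<And>r. r \<in> T \<Longrightarrow> r \<le> \<tau>" using insert.hyps by (auto simp: \<tau>_def)
  have c: "r \<le> t \<and> (t \<in> T \<and> r \<in> T \<or> r \<in> T \<and> t = \<tau>' \<or> r = \<tau>' \<and> t = \<tau>')" if "(X, r, t, A) \<in> set S" for X r t A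
  proof -
    have "r \<in> insert \<tau>' T" "t \<in> insert \<tau>' T" "r \<le> t" using that insert.prems by (auto simp: elementary_integrand_def)
    then show ?thesis using insert.hyps(2) by force
  qed
  then have c': "r \<le> t \<and> (t \<le> \<tau> \<or> r \<le> \<tau> \<and> t = \<tau>' \<or> r = \<tau>' \<and> t = \<tau>')" if "(X, r, t, A) \<in> set S" for X r t A
    using that \<tau>(3) by blast
  let ?S0 = "before \<tau> S" and ?S1 = "after \<tau> \<tau>' S"
  have rT: "r \<in> T" if "(X, r, t, A) \<in> set S" "r \<le> \<tau>" for X r t A using c[OF that(1)] that(2) \<tau>(1) by auto
  have S0: "\<forall>e\<in>set ?S0. elementary_integrand M W e"
    using insert.prems(1) by (fastforce simp: before_def elementary_integrand_def)
  have S1: "\<forall>e\<in>set ?S1. elementary_integrand M W e"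
  proof
    fix e assume "e \<in> set ?S1"
    then obtain X r t A where e: "e = (X, \<tau>, \<tau>', A)" "(X, r, t, A) \<in> set S" "r \<le> \<tau>" by (auto simp: after_def)
    then show "elementary_integrand M W e"
      using insert.prems(1) \<tau>(1) by (fastforce simp: elementary_integrand_def intro: measurable_noise_filtration_mono)
  qed
  have g: "\<forall>(X, r, t, A)\<in>set ?S0. r \<in> T \<and> t \<in> T"
  proof -
    have "r \<in> T \<and> min t \<tau> \<in> T" if "(X, r, t, A) \<in> set S" "r \<le> \<tau>" for X r t A
    proof -
      have "T \<noteq> {}" using rT[OF that] by auto
      moreover have "t \<in> T \<or> t = \<tau>'" using c[OF that(1)] by auto
      ultimately show ?thesis using rT[OF that] \<tau> by (auto simp: min_def)
    qed
    then show ?thesis by (auto simp: before_def)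
  qed
  have "sq S = sq (?S0 @ ?S1)"
  proof
    fix \<omega>
    have "simple_value S s y \<omega> = simple_value (?S0 @ ?S1) s y \<omega>" for s y
      by (rule split_value[OF \<tau>(1)]) (use c' in auto)
    then show "sq S \<omega> = sq (?S0 @ ?S1) \<omega>" by (simp only: sq_def)
  qed
  then have "(\<integral>\<^sup>+\<omega>. ennreal (exp (simple_integral W S \<omega> - sq S \<omega> / 2)) \<partial>M)
     = (\<integral>\<^sup>+\<omega>. ennreal (exp (simple_integral W (?S0 @ ?S1) \<omega> - sq (?S0 @ ?S1) \<omega> / 2)) \<partial>M)"
  proof (intro nn_integral_cong_AE)
    have "AE \<omega> in M. simple_integral W S \<omega> = simple_integral W (?S0 @ ?S1) \<omega>"
      using c' insert.prems(1) by (intro split_integral \<tau>) auto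
    then show "sq S = sq (?S0 @ ?S1) \<Longrightarrow> AE \<omega> in M. ennreal (exp (simple_integral W S \<omega> - sq S \<omega> / 2)) = ennreal (exp (simple_integral W (?S0 @ ?S1) \<omega> - sq (?S0 @ ?S1) \<omega> / 2))"
      by eventually_elim simp
  qed
  also have "\<dots> \<le> (\<integral>\<^sup>+\<omega>. ennreal (exp (simple_integral W ?S0 \<omega> - sq ?S0 \<omega> / 2)) \<partial>M)"
    by (rule simple_exp_step[OF S0 _ S1]) (auto simp: before_def after_def)
  also have "\<dots> \<le> 1"
    by (rule insert.IH[OF S0 g])
  finally show ?case .
qed

lemma simple_exp:
  assumes "\<forall>e\<in>set S. elementary_integrand M W e"
  shows "(\<integral>\<^sup>+\<omega>. ennreal (exp (simple_integral W S \<omega> - sq S \<omega> / 2)) \<partial>M) \<le> 1"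
  by (rule simple_exp_grid[OF _ assms, of "(\<lambda>e. fst (snd e)) ` set S \<union> (\<lambda>e. fst (snd (snd e))) ` set S"]) force+

end

section \<open>Passage to limits in \<open>L\<^sup>2\<close>\<close>

lemma nn_L1_AE_subseq:
  fixes h :: "nat \<Rightarrow> 'a \<Rightarrow> ennreal"
  assumes [measurable]: "\<And>n. h n \<in> borel_measurable M"
    and lim: "(\<lambda>n. \<integral>\<^sup>+\<omega>. h n \<omega> \<partial>M) \<longlonglongrightarrow> 0"
  obtains r :: "nat \<Rightarrow> nat" where "strict_mono r" "AE \<omega> in M. (\<lambda>n. h (r n) \<omega>) \<longlonglongrightarrow> 0"
proof -
  have "\<exists>k>m. (\<integral>\<^sup>+\<omega>. h k \<omega> \<partial>M) < ennreal ((1/2) ^ n)" for m n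
  proof -
    have "\<forall>\<^sub>F k in sequentially. (\<integral>\<^sup>+\<omega>. h k \<omega> \<partial>M) < ennreal ((1/2) ^ n)"
      by (rule order_tendstoD(2)[OF lim]) (simp add: ennreal_zero_less_one)
    then have "\<forall>\<^sub>F k in sequentially. (\<integral>\<^sup>+\<omega>. h k \<omega> \<partial>M) < ennreal ((1/2) ^ n) \<and> k > m"
      using eventually_gt_at_top by (rule eventually_conj)
    then show ?thesis by (auto simp: eventually_sequentially)
  qed
  then obtain f where f: "\<And>m n. f m n > m" "\<And>m n. (\<integral>\<^sup>+\<omega>. h (f m n) \<omega> \<partial>M) < ennreal ((1/2) ^ n)" by metis
  define r where "r = rec_nat (f 0 0) (\<lambda>n m. f m (Suc n))"
  have r: "r (Suc n) = f (r n) (Suc n)" "r 0 = f 0 0" for n by (auto simp: r_def)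
  have "strict_mono r" using f by (auto simp: strict_mono_Suc_iff r)
  moreover have "AE \<omega> in M. (\<lambda>n. h (r n) \<omega>) \<longlonglongrightarrow> 0"
  proof -
    have le: "(\<integral>\<^sup>+\<omega>. h (r n) \<omega> \<partial>M) \<le> ennreal ((1/2) ^ n)" for n
    proof (cases n)
      case 0 then show ?thesis using f(2)[of 0 0] by (simp add: r less_imp_le)
    next
      case (Suc m)
      show ?thesis unfolding Suc r by (rule less_imp_le[OF f(2)])
    qed
    have "(\<integral>\<^sup>+\<omega>. (\<Sum>n. h (r n) \<omega>) \<partial>M) = (\<Sum>n. \<integral>\<^sup>+\<omega>. h (r n) \<omega> \<partial>M)"
      by (rule nn_integral_suminf) measurable
    also have "\<dots> \<le> (\<Sum>n. ennreal ((1/2) ^ n))"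
      by (intro suminf_le le) auto
    also have "\<dots> = ennreal (\<Sum>n. (1/2) ^ n)"
      by (rule suminf_ennreal2) (auto intro: summable_geometric)
    finally have "(\<integral>\<^sup>+\<omega>. (\<Sum>n. h (r n) \<omega>) \<partial>M) \<noteq> \<infinity>"
      by (metis ennreal_less_top infinity_ennreal_def leD)
    then have "AE \<omega> in M. (\<Sum>n. h (r n) \<omega>) \<noteq> \<infinity>"
      by (intro nn_integral_PInf_AE) auto
    then show ?thesis
    proof eventually_elim
      case (elim \<omega>)
      then have fin: "h (r n) \<omega> < \<top>" for n
        by (metis ennreal_suminf_lessD infinity_ennreal_def top.not_eq_extremum)
      have eq: "(\<lambda>n. h (r n) \<omega>) = (\<lambda>n. ennreal (enn2real (h (r n) \<omega>)))"
        using fin by auto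
      have "summable (\<lambda>n. enn2real (h (r n) \<omega>))"
        using elim eq by (intro summable_suminf_not_top) auto
      then have "(\<lambda>n. enn2real (h (r n) \<omega>)) \<longlonglongrightarrow> 0" by (rule summable_LIMSEQ_zero)
      then have "(\<lambda>n. ennreal (enn2real (h (r n) \<omega>))) \<longlonglongrightarrow> ennreal 0" by (rule tendsto_ennrealI)
      then show ?case using eq by simp
    qed
  qed
  ultimately show thesis by (rule that)
qed

lemma young_inequality:
  fixes a e :: real assumes "\<eta> > 0" shows "2 * \<bar>a\<bar> * \<bar>e\<bar> \<le> \<eta> * a\<^sup>2 + e\<^sup>2 / \<eta>"
proof -
  have "2 * (\<bar>a\<bar> * \<eta>) * \<bar>e\<bar> \<le> (\<bar>a\<bar> * \<eta>)\<^sup>2 + \<bar>e\<bar>\<^sup>2" by (rule sum_squares_bound)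
  then show ?thesis using assms by (simp add: field_simps power2_eq_square)
qed

text \<open>With e = F - G the difference of the squares is e^2 + 2 G e. The mixed term is split by
  a weight \<open>\<eta>\<close>, which is taken small before the index is sent to infinity.\<close>

lemma L2_convergence:
  fixes F :: "nat \<Rightarrow> 'a \<Rightarrow> real"
  assumes [measurable]: "\<And>n. F n \<in> borel_measurable M" "G \<in> borel_measurable M"
    and F: "\<And>n. integrable M (\<lambda>x. (F n x)\<^sup>2)"
    and lim: "(\<lambda>n. \<integral>\<^sup>+x. ennreal ((F n x - G x)\<^sup>2) \<partial>M) \<longlonglongrightarrow> 0"
  shows "integrable M (\<lambda>x. (G x)\<^sup>2)" "(\<lambda>n. \<integral>x. (F n x)\<^sup>2 \<partial>M) \<longlonglongrightarrow> (\<integral>x. (G x)\<^sup>2 \<partial>M)"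
proof -
  have G: "integrable M (\<lambda>x. (G x)\<^sup>2)" if "(\<integral>\<^sup>+x. ennreal ((F n x - G x)\<^sup>2) \<partial>M) < \<infinity>" for n
  proof -
    have i: "integrable M (\<lambda>x. (F n x - G x)\<^sup>2)"
      using that by (intro integrableI_nonneg) auto
    show ?thesis
    proof (rule Bochner_Integration.integrable_bound[of _ "\<lambda>x. 2 * (F n x)\<^sup>2 + 2 * (F n x - G x)\<^sup>2"])
      show "AE x in M. norm ((G x)\<^sup>2) \<le> norm (2 * (F n x)\<^sup>2 + 2 * (F n x - G x)\<^sup>2)"
      proof (rule AE_I2)
        fix x
        have "0 \<le> (2 * F n x - G x)\<^sup>2" by simp
        then have "(G x)\<^sup>2 \<le> 2 * (F n x)\<^sup>2 + 2 * (F n x - G x)\<^sup>2" by (simp add: power2_eq_square algebra_simps)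
        then show "norm ((G x)\<^sup>2) \<le> norm (2 * (F n x)\<^sup>2 + 2 * (F n x - G x)\<^sup>2)" by simp
      qed
    qed (use F i in auto)
  qed
  have ev: "\<forall>\<^sub>F n in sequentially. (\<integral>\<^sup>+x. ennreal ((F n x - G x)\<^sup>2) \<partial>M) < \<infinity>"
    by (rule order_tendstoD(2)[OF lim]) simp
  then obtain n0 where "(\<integral>\<^sup>+x. ennreal ((F n0 x - G x)\<^sup>2) \<partial>M) < \<infinity>" by (auto simp: eventually_sequentially)
  then show IG: "integrable M (\<lambda>x. (G x)\<^sup>2)" by (rule G)
  have i: "integrable M (\<lambda>x. (F n x - G x)\<^sup>2)" for n
  proof -
    have e: "(\<lambda>x. (F n x - G x)\<^sup>2) = (\<lambda>x. (F n x)\<^sup>2 - 2 * (F n x * G x) + (G x)\<^sup>2)"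
      by (auto simp: power2_eq_square algebra_simps)
    show ?thesis unfolding e
      using F IG integrable_mult_of_squares[OF _ _ F IG, of n] by auto
  qed
  define d where "d n = (\<integral>x. (F n x - G x)\<^sup>2 \<partial>M)" for n
  define g where "g = (\<integral>x. (G x)\<^sup>2 \<partial>M)"
  have g0: "0 \<le> g" unfolding g_def by simp
  have "ennreal (d n) = (\<integral>\<^sup>+x. ennreal ((F n x - G x)\<^sup>2) \<partial>M)" for n
    unfolding d_def by (rule nn_integral_eq_integral[symmetric]) (use i in auto)
  then have "(\<lambda>n. ennreal (d n)) \<longlonglongrightarrow> ennreal 0" using lim by simp
  then have d: "d \<longlonglongrightarrow> 0"
    by (subst (asm) tendsto_ennreal_iff) (auto simp: d_def)
  have bound: "\<bar>(\<integral>x. (F n x)\<^sup>2 \<partial>M) - g\<bar> \<le> d n + \<eta> * g + d n / \<eta>" if "\<eta> > 0" for n \<eta>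
  proof -
    have "(\<integral>x. (F n x)\<^sup>2 \<partial>M) - g = (\<integral>x. (F n x)\<^sup>2 - (G x)\<^sup>2 \<partial>M)"
      unfolding g_def using F IG by simp
    also have "\<bar>\<dots>\<bar> \<le> (\<integral>x. \<bar>(F n x)\<^sup>2 - (G x)\<^sup>2\<bar> \<partial>M)" by (rule integral_abs_bound)
    also have "\<dots> \<le> (\<integral>x. (F n x - G x)\<^sup>2 + \<eta> * (G x)\<^sup>2 + (F n x - G x)\<^sup>2 / \<eta> \<partial>M)"
    proof (rule integral_mono)
      show "integrable M (\<lambda>x. \<bar>(F n x)\<^sup>2 - (G x)\<^sup>2\<bar>)" using F IG by auto
      show "integrable M (\<lambda>x. (F n x - G x)\<^sup>2 + \<eta> * (G x)\<^sup>2 + (F n x - G x)\<^sup>2 / \<eta>)" using i IG by auto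
      fix x
      let ?e = "F n x - G x"
      have 1: "2 * \<bar>G x\<bar> * \<bar>?e\<bar> \<le> \<eta> * (G x)\<^sup>2 + ?e\<^sup>2 / \<eta>" by (rule young_inequality[OF that])
      have "(F n x)\<^sup>2 - (G x)\<^sup>2 = ?e\<^sup>2 + 2 * G x * ?e" by (simp add: power2_eq_square algebra_simps)
      then have "\<bar>(F n x)\<^sup>2 - (G x)\<^sup>2\<bar> \<le> ?e\<^sup>2 + \<bar>2 * G x * ?e\<bar>"
        by (metis abs_power2 abs_triangle_ineq)
      then show "\<bar>(F n x)\<^sup>2 - (G x)\<^sup>2\<bar> \<le> ?e\<^sup>2 + \<eta> * (G x)\<^sup>2 + ?e\<^sup>2 / \<eta>"
        using 1 by (simp add: abs_mult)
    qed
    also have "\<dots> = d n + \<eta> * g + d n / \<eta>" unfolding d_def g_def using i IG by simp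
    finally show ?thesis .
  qed
  show "(\<lambda>n. \<integral>x. (F n x)\<^sup>2 \<partial>M) \<longlonglongrightarrow> (\<integral>x. (G x)\<^sup>2 \<partial>M)"
    unfolding g_def[symmetric]
  proof (rule tendstoI)
    fix e :: real assume e: "e > 0"
    define \<eta> where "\<eta> = e / (2 * (g + 1))"
    have \<eta>: "\<eta> > 0" "\<eta> * g \<le> e / 2" using e g0 by (auto simp: \<eta>_def field_simps)
    have "(\<lambda>n. d n + d n / \<eta>) \<longlonglongrightarrow> 0 + 0 / \<eta>" by (intro tendsto_intros d) (use \<eta> in auto)
    then have "\<forall>\<^sub>F n in sequentially. d n + d n / \<eta> < e / 2" using e by (intro order_tendstoD(2)) auto
    then show "\<forall>\<^sub>F n in sequentially. dist (\<integral>x. (F n x)\<^sup>2 \<partial>M) g < e"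
    proof eventually_elim
      case (elim n)
      then show ?case using bound[OF \<eta>(1), of n] \<eta>(2) unfolding dist_real_def by linarith
    qed
  qed
qed

text \<open>Predictability speaks only of positive times. Cutting the field off elsewhere turns each
  path into a function on the whole plane that can be placed in \<open>L2_halfplane\<close>.\<close>

definition slice :: "(real \<Rightarrow> real \<Rightarrow> 'a \<Rightarrow> real) \<Rightarrow> 'a \<Rightarrow> real \<times> real \<Rightarrow> real" where
  "slice g \<omega> z = indicat_real {0<..} (fst z) * g (fst z) (snd z) \<omega>"

section \<open>Joint measurability and the exponential bound for Walsh integrals\<close>

context noise_space
begin

text \<open>After reordering the coordinates, the generators of the predictable sigma-algebra are
  measurable rectangles. This is what makes the path integrals of predictable fields measurable in
  the outcome.\<close>

lemma predictable_joint:
  assumes "predictable M W g"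
  shows "(\<lambda>(\<omega>, z). slice g \<omega> z) \<in> borel_measurable (M \<Otimes>\<^sub>M lborel)"
proof -
  let ?\<Omega> = "space M \<times> ({0<..} \<times> UNIV) :: ('a \<times> real \<times> real) set"
  let ?N = "restrict_space (M \<Otimes>\<^sub>M lborel) ?\<Omega>"
  let ?T = "\<lambda>(\<omega> :: 'a, s :: real, y :: real). (s, y, \<omega>)"
  let ?A = "{{r<..t} \<times> (A :: real set) \<times> G | r t A G. 0 \<le> r \<and> r \<le> t \<and> A \<in> sets borel \<and> G \<in> sets (noise_filtration M W r)}"
  have FM: "G \<in> sets M" if "G \<in> sets (noise_filtration M W r)" for G r
    using that noise_filtration_subalgebra by (auto simp: subalgebra_def)
  have half: "{r<..} \<times> UNIV \<in> sets (lborel :: (real \<times> real) measure)" for r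
    unfolding sets_lborel borel_prod[symmetric] by (intro pair_measureI) auto
  have \<Omega>: "?\<Omega> \<in> sets (M \<Otimes>\<^sub>M lborel)" using half by (intro pair_measureI) auto
  have sp: "space ?N = ?\<Omega>" by (auto simp: space_restrict_space space_pair_measure)
  have sub: "?A \<subseteq> Pow ({0<..} \<times> UNIV \<times> space M)"
    using FM sets.sets_into_space by fastforce
  have "?T \<in> measurable ?N (predictable_sigma M W)"
  proof (rule measurable_sigma_sets[of _ "{0<..} \<times> UNIV \<times> space M" ?A])
    show "sets (predictable_sigma M W) = sigma_sets ({0<..} \<times> UNIV \<times> space M) ?A"
      unfolding predictable_sigma_def by (rule sets_measure_of[OF sub])
    show "?A \<subseteq> Pow ({0<..} \<times> UNIV \<times> space M)" by (rule sub)
    show "?T \<in> space ?N \<rightarrow> {0<..} \<times> UNIV \<times> space M" unfolding sp by auto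
    fix Q assume "Q \<in> ?A"
    then obtain r t A G where Q: "Q = {r<..t} \<times> A \<times> G" "0 \<le> r" "A \<in> sets borel" "G \<in> sets (noise_filtration M W r)" by auto
    have "?T -` Q \<inter> space ?N = G \<times> ({r<..t} \<times> A)"
      unfolding sp using Q(2) sets.sets_into_space[OF FM[OF Q(4)]] by (auto simp: Q(1))
    moreover have "{r<..t} \<times> A \<in> sets (lborel :: (real \<times> real) measure)"
      unfolding sets_lborel borel_prod[symmetric] using Q(3) by (intro pair_measureI) auto
    then have "G \<times> ({r<..t} \<times> A) \<in> sets (M \<Otimes>\<^sub>M lborel)" using FM[OF Q(4)] by (intro pair_measureI)
    moreover have "G \<times> ({r<..t} \<times> A) \<subseteq> ?\<Omega>" using Q(2) sets.sets_into_space[OF FM[OF Q(4)]] by auto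
    ultimately show "?T -` Q \<inter> space ?N \<in> sets ?N"
      using \<Omega> by (auto simp: sets_restrict_space_iff)
  qed
  from measurable_compose[OF this assms[unfolded predictable_def]]
  have "(\<lambda>(\<omega>, s, y). g s y \<omega>) \<in> borel_measurable ?N" by (simp add: case_prod_beta')
  then have "(\<lambda>x. indicator ?\<Omega> x *\<^sub>R (case x of (\<omega>, s, y) \<Rightarrow> g s y \<omega>)) \<in> borel_measurable (M \<Otimes>\<^sub>M lborel)"
    using \<Omega> by (subst (asm) borel_measurable_restrict_space_iff) (auto simp: space_pair_measure)
  then show ?thesis
    by (rule measurable_cong[THEN iffD1, rotated])
      (auto simp: slice_def indicator_def space_pair_measure)
qed

lemma slice_measurable: "predictable M W g \<Longrightarrow> \<omega> \<in> space M \<Longrightarrow> slice g \<omega> \<in> borel_measurable borel"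
  using measurable_Pair2[OF predictable_joint, of g \<omega>] by (simp add: measurable_lborel1)

lemma simple_value_joint:
  assumes "\<forall>e\<in>set S. elementary_integrand M W e"
  shows "(\<lambda>(\<omega>, z). simple_value S (fst z) (snd z) \<omega>) \<in> borel_measurable (M \<Otimes>\<^sub>M lborel)"
proof -
  have "(\<lambda>x. \<Sum>i<length S. fst (S ! i) (fst x) * ephi (S ! i) (snd x)) \<in> borel_measurable (M \<Otimes>\<^sub>M lborel)"
  proof (intro borel_measurable_sum borel_measurable_times)
    fix i assume "i \<in> {..<length S}"
    then have e: "elementary_integrand M W (S ! i)" using assms by auto
    show "(\<lambda>x. fst (S ! i) (fst x)) \<in> borel_measurable (M \<Otimes>\<^sub>M lborel)"
      by (rule measurable_compose[OF measurable_fst elementary_measurable[OF e]])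
    have "ephi (S ! i) \<in> borel_measurable lborel" using ephi_L2[OF e] by (auto dest: L2_halfplaneD)
    then show "(\<lambda>x. ephi (S ! i) (snd x)) \<in> borel_measurable (M \<Otimes>\<^sub>M lborel)"
      by (rule measurable_compose[OF measurable_snd])
  qed
  then show ?thesis unfolding simple_value_sum by (simp add: case_prod_beta')
qed

lemma simple_value_nonpos:
  assumes "\<forall>e\<in>set S. elementary_integrand M W e" "s \<le> 0"
  shows "simple_value S s y \<omega> = 0"
  unfolding simple_value_sum
proof (intro sum.neutral ballI)
  fix i assume "i \<in> {..<length S}"
  then have "elementary_integrand M W (S ! i)" using assms by auto
  then show "fst (S ! i) \<omega> * ephi (S ! i) (s, y) = 0"
    using assms(2) by (auto simp: elementary_integrand_def ephi_def split: prod.splits)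
qed

lemma simple_error_eq:
  assumes "\<forall>e\<in>set S. elementary_integrand M W e"
  shows "(\<integral>\<^sup>+z\<in>{0<..} \<times> UNIV. (case z of (s, y) \<Rightarrow> ennreal ((simple_value S s y \<omega> - g s y \<omega>)\<^sup>2)) \<partial>lborel)
    = (\<integral>\<^sup>+z. ennreal ((simple_value S (fst z) (snd z) \<omega> - slice g \<omega> z)\<^sup>2) \<partial>lborel)"
proof (intro nn_integral_cong)
  fix z :: "real \<times> real"
  obtain s y where z: "z = (s, y)" by (cases z)
  show "(case z of (s, y) \<Rightarrow> ennreal ((simple_value S s y \<omega> - g s y \<omega>)\<^sup>2)) * indicator ({0<..} \<times> UNIV) z
    = ennreal ((simple_value S (fst z) (snd z) \<omega> - slice g \<omega> z)\<^sup>2)"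
    using simple_value_nonpos[OF assms, of s y \<omega>] by (cases "0 < s") (auto simp: z slice_def)
qed

lemma has_walsh_integralE:
  assumes "has_walsh_integral M W g I"
  obtains S where "predictable M W g" "I \<in> borel_measurable M" "\<And>n. \<forall>e\<in>set (S n). elementary_integrand M W e"
    "(\<lambda>n. \<integral>\<^sup>+\<omega>. (\<integral>\<^sup>+z. ennreal ((simple_value (S n) (fst z) (snd z) \<omega> - slice g \<omega> z)\<^sup>2) \<partial>lborel) \<partial>M) \<longlonglongrightarrow> 0"
    "(\<lambda>n. \<integral>\<^sup>+\<omega>. ennreal ((simple_integral W (S n) \<omega> - I \<omega>)\<^sup>2) \<partial>M) \<longlonglongrightarrow> 0"
proof -
  from assms obtain S where S: "predictable M W g" "I \<in> borel_measurable M" "\<forall>n. \<forall>e\<in>set (S n). elementary_integrand M W e"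
    "(\<lambda>n. \<integral>\<^sup>+\<omega>. (\<integral>\<^sup>+z\<in>{0<..} \<times> UNIV. (case z of (s, y) \<Rightarrow> ennreal ((simple_value (S n) s y \<omega> - g s y \<omega>)\<^sup>2)) \<partial>lborel) \<partial>M) \<longlonglongrightarrow> 0"
    "(\<lambda>n. \<integral>\<^sup>+\<omega>. ennreal ((simple_integral W (S n) \<omega> - I \<omega>)\<^sup>2) \<partial>M) \<longlonglongrightarrow> 0"
    unfolding has_walsh_integral_def by blast
  from S(3) have e: "\<And>n. \<forall>e\<in>set (S n). elementary_integrand M W e" by blast
  show thesis
    by (rule that[OF S(1,2) e _ S(5)]) (use S(4) in \<open>simp only: simple_error_eq[OF e]\<close>)
qed

lemma has_walsh_integralI:
  assumes "predictable M W g" "I \<in> borel_measurable M" "\<And>n. \<forall>e\<in>set (S n). elementary_integrand M W e"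
    "(\<lambda>n. \<integral>\<^sup>+\<omega>. (\<integral>\<^sup>+z. ennreal ((simple_value (S n) (fst z) (snd z) \<omega> - slice g \<omega> z)\<^sup>2) \<partial>lborel) \<partial>M) \<longlonglongrightarrow> 0"
    "(\<lambda>n. \<integral>\<^sup>+\<omega>. ennreal ((simple_integral W (S n) \<omega> - I \<omega>)\<^sup>2) \<partial>M) \<longlonglongrightarrow> 0"
  shows "has_walsh_integral M W g I"
  unfolding has_walsh_integral_def
  using assms(1,2)
proof (intro conjI exI[of _ S])
  show "(\<lambda>n. \<integral>\<^sup>+\<omega>. (\<integral>\<^sup>+z\<in>{0<..} \<times> UNIV. (case z of (s, y) \<Rightarrow> ennreal ((simple_value (S n) s y \<omega> - g s y \<omega>)\<^sup>2)) \<partial>lborel) \<partial>M) \<longlonglongrightarrow> 0"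
    using assms(4) by (simp only: simple_error_eq[OF assms(3)])
qed (use assms in auto)

lemma error_joint:
  assumes "\<forall>e\<in>set S. elementary_integrand M W e" "predictable M W g"
  shows "(\<lambda>(\<omega>, z). ennreal ((simple_value S (fst z) (snd z) \<omega> - slice g \<omega> z)\<^sup>2)) \<in> borel_measurable (M \<Otimes>\<^sub>M lborel)"
proof -
  have "(\<lambda>x. (case x of (\<omega>, z) \<Rightarrow> simple_value S (fst z) (snd z) \<omega>) - (case x of (\<omega>, z) \<Rightarrow> slice g \<omega> z)) \<in> borel_measurable (M \<Otimes>\<^sub>M lborel)"
    by (intro borel_measurable_diff simple_value_joint predictable_joint assms)
  then have "(\<lambda>x. ennreal (((case x of (\<omega>, z) \<Rightarrow> simple_value S (fst z) (snd z) \<omega>) - (case x of (\<omega>, z) \<Rightarrow> slice g \<omega> z))\<^sup>2)) \<in> borel_measurable (M \<Otimes>\<^sub>M lborel)"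
    by measurable
  then show ?thesis by (simp add: case_prod_beta')
qed

lemma error_measurable:
  assumes "\<forall>e\<in>set S. elementary_integrand M W e" "predictable M W g"
  shows "(\<lambda>\<omega>. \<integral>\<^sup>+z. ennreal ((simple_value S (fst z) (snd z) \<omega> - slice g \<omega> z)\<^sup>2) \<partial>lborel) \<in> borel_measurable M"
  using error_joint[OF assms] by (intro lborel.borel_measurable_nn_integral)

text \<open>The bound for simple integrands survives the limit: along a subsequence the integrals
  and, path by path, the quadratic variations converge almost surely, and Fatou's lemma preserves
  the inequality.\<close>

lemma walsh_exp:
  assumes "has_walsh_integral M W f J"
  shows "AE \<omega> in M. slice f \<omega> \<in> L2_halfplane"
    and "(\<integral>\<^sup>+\<omega>. ennreal (exp (J \<omega> - ip (slice f \<omega>) (slice f \<omega>) / 2)) \<partial>M) \<le> 1"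
proof -
  from assms obtain S where S: "predictable M W f" and J[measurable]: "J \<in> borel_measurable M"
    and el: "\<And>n. \<forall>e\<in>set (S n). elementary_integrand M W e"
    and l1: "(\<lambda>n. \<integral>\<^sup>+\<omega>. (\<integral>\<^sup>+z. ennreal ((simple_value (S n) (fst z) (snd z) \<omega> - slice f \<omega> z)\<^sup>2) \<partial>lborel) \<partial>M) \<longlonglongrightarrow> 0"
    and l2: "(\<lambda>n. \<integral>\<^sup>+\<omega>. ennreal ((simple_integral W (S n) \<omega> - J \<omega>)\<^sup>2) \<partial>M) \<longlonglongrightarrow> 0"
    by (rule has_walsh_integralE) blast
  define A where "A n \<omega> = (\<integral>\<^sup>+z. ennreal ((simple_value (S n) (fst z) (snd z) \<omega> - slice f \<omega> z)\<^sup>2) \<partial>lborel)" for n \<omega>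
  define B where "B n \<omega> = ennreal ((simple_integral W (S n) \<omega> - J \<omega>)\<^sup>2)" for n \<omega>
  have Im[measurable]: "simple_integral W (S n) \<in> borel_measurable M" for n by (rule simple_integral_M[OF el])
  have Am[measurable]: "A n \<in> borel_measurable M" for n
    unfolding A_def[abs_def] by (rule error_measurable[OF el S])
  have Bm[measurable]: "B n \<in> borel_measurable M" for n unfolding B_def[abs_def] by measurable
  \<comment> \<open>Adding the two errors lets a single subsequence serve both convergences.\<close>
  have "(\<lambda>n. \<integral>\<^sup>+\<omega>. A n \<omega> + B n \<omega> \<partial>M) = (\<lambda>n. (\<integral>\<^sup>+\<omega>. A n \<omega> \<partial>M) + (\<integral>\<^sup>+\<omega>. B n \<omega> \<partial>M))"
    by (intro ext nn_integral_add) auto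
  moreover have "(\<lambda>n. (\<integral>\<^sup>+\<omega>. A n \<omega> \<partial>M) + (\<integral>\<^sup>+\<omega>. B n \<omega> \<partial>M)) \<longlonglongrightarrow> 0 + 0"
    using l1 l2 unfolding A_def B_def by (intro tendsto_add) auto
  ultimately have "(\<lambda>n. \<integral>\<^sup>+\<omega>. A n \<omega> + B n \<omega> \<partial>M) \<longlonglongrightarrow> 0" by simp
  then obtain r where r: "strict_mono r" "AE \<omega> in M. (\<lambda>n. A (r n) \<omega> + B (r n) \<omega>) \<longlonglongrightarrow> 0"
    by (rule nn_L1_AE_subseq[rotated]) auto
  have lim: "AE \<omega> in M. slice f \<omega> \<in> L2_halfplane \<and>
      (\<lambda>n. exp (simple_integral W (S (r n)) \<omega> - sq (S (r n)) \<omega> / 2)) \<longlonglongrightarrow> exp (J \<omega> - ip (slice f \<omega>) (slice f \<omega>) / 2)"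
    using r(2) AE_space
  proof eventually_elim
    case (elim \<omega>)
    have a: "(\<lambda>n. A (r n) \<omega>) \<longlonglongrightarrow> 0"
      by (rule tendsto_sandwich[OF _ _ tendsto_const elim(1)]) auto
    have b: "(\<lambda>n. B (r n) \<omega>) \<longlonglongrightarrow> 0"
      by (rule tendsto_sandwich[OF _ _ tendsto_const elim(1)]) auto
    have fm: "slice f \<omega> \<in> borel_measurable borel" using slice_measurable[OF S] elim by simp
    have sv: "(\<lambda>z. simple_value (S (r n)) (fst z) (snd z) \<omega>) \<in> L2_halfplane" for n
      by (rule simple_value_L2[OF el])
    note L = L2_convergence[of "\<lambda>n z. simple_value (S (r n)) (fst z) (snd z) \<omega>" lborel "slice f \<omega>"]
    have 1: "integrable lborel (\<lambda>z. (slice f \<omega> z)\<^sup>2)"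
      by (rule L(1)) (use L2_halfplaneD[OF sv] fm a in \<open>auto simp: A_def\<close>)
    have 2: "(\<lambda>n. sq (S (r n)) \<omega>) \<longlonglongrightarrow> (\<integral>z. (slice f \<omega> z)\<^sup>2 \<partial>lborel)"
      unfolding sq_def by (rule L(2)) (use L2_halfplaneD[OF sv] fm a in \<open>auto simp: A_def\<close>)
    have "(\<lambda>n. ennreal ((simple_integral W (S (r n)) \<omega> - J \<omega>)\<^sup>2)) \<longlonglongrightarrow> ennreal 0" using b by (simp add: B_def)
    then have "(\<lambda>n. (simple_integral W (S (r n)) \<omega> - J \<omega>)\<^sup>2) \<longlonglongrightarrow> 0"
      by (subst (asm) tendsto_ennreal_iff) auto
    then have "(\<lambda>n. sqrt ((simple_integral W (S (r n)) \<omega> - J \<omega>)\<^sup>2)) \<longlonglongrightarrow> sqrt 0" by (rule tendsto_real_sqrt)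
    then have "(\<lambda>n. simple_integral W (S (r n)) \<omega> - J \<omega>) \<longlonglongrightarrow> 0" by (simp add: tendsto_rabs_zero_iff)
    then have 3: "(\<lambda>n. simple_integral W (S (r n)) \<omega>) \<longlonglongrightarrow> J \<omega>" by (simp add: LIM_zero_iff)
    have "slice f \<omega> \<in> L2_halfplane"
      using fm 1 by (auto simp: L2_halfplane_def slice_def)
    moreover have "(\<lambda>n. exp (simple_integral W (S (r n)) \<omega> - sq (S (r n)) \<omega> / 2)) \<longlonglongrightarrow> exp (J \<omega> - ip (slice f \<omega>) (slice f \<omega>) / 2)"
      using 2 by (intro tendsto_intros 3) (auto simp: power2_eq_square)
    ultimately show ?case by simp
  qed
  then show "AE \<omega> in M. slice f \<omega> \<in> L2_halfplane" by eventually_elim simp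
  have "(\<integral>\<^sup>+\<omega>. ennreal (exp (J \<omega> - ip (slice f \<omega>) (slice f \<omega>) / 2)) \<partial>M)
     \<le> (\<integral>\<^sup>+\<omega>. liminf (\<lambda>n. ennreal (exp (simple_integral W (S (r n)) \<omega> - sq (S (r n)) \<omega> / 2))) \<partial>M)"
  proof (rule nn_integral_mono_AE, use lim in eventually_elim)
    case (elim \<omega>)
    then have "(\<lambda>n. ennreal (exp (simple_integral W (S (r n)) \<omega> - sq (S (r n)) \<omega> / 2))) \<longlonglongrightarrow> ennreal (exp (J \<omega> - ip (slice f \<omega>) (slice f \<omega>) / 2))"
      by (intro tendsto_ennrealI) auto
    then show ?case by (subst lim_imp_Liminf) auto
  qed
  also have "\<dots> \<le> liminf (\<lambda>n. \<integral>\<^sup>+\<omega>. ennreal (exp (simple_integral W (S (r n)) \<omega> - sq (S (r n)) \<omega> / 2)) \<partial>M)"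
  proof (rule nn_integral_liminf)
    fix n
    have [measurable]: "sq (S (r n)) \<in> borel_measurable M"
      using el[of "r n"] by (intro sq_measurable) (auto intro: elementary_measurable)
    show "(\<lambda>\<omega>. ennreal (exp (simple_integral W (S (r n)) \<omega> - sq (S (r n)) \<omega> / 2))) \<in> borel_measurable M"
      by measurable
  qed
  also have "\<dots> \<le> liminf (\<lambda>n. 1)"
    by (intro Liminf_mono always_eventually allI simple_exp el)
  also have "\<dots> = 1" by (simp add: Liminf_const)
  finally show "(\<integral>\<^sup>+\<omega>. ennreal (exp (J \<omega> - ip (slice f \<omega>) (slice f \<omega>) / 2)) \<partial>M) \<le> 1" .
qed

end

section \<open>Linear combinations of Walsh integrals and tilted bounds\<close>

definition scale_simple :: "real \<Rightarrow> 'a elementary list \<Rightarrow> 'a elementary list" where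
  "scale_simple a S = map (\<lambda>(X, r, t, A). (\<lambda>\<omega>. a * X \<omega>, r, t, A)) S"

lemma simple_value_scale: "simple_value (scale_simple a S) s y \<omega> = a * simple_value S s y \<omega>"
  by (induction S) (auto simp: scale_simple_def simple_value_Cons ephi_def algebra_simps)

lemma simple_integral_scale: "simple_integral W (scale_simple a S) \<omega> = a * simple_integral W S \<omega>"
  by (induction S) (auto simp: scale_simple_def simple_integral_Cons ephi_def algebra_simps)

lemma lincomb_square_le:
  fixes x y :: real
  shows "(a * x + b * y)\<^sup>2 \<le> 2 * a\<^sup>2 * x\<^sup>2 + 2 * b\<^sup>2 * y\<^sup>2"
proof -
  have "0 \<le> (a * x - b * y)\<^sup>2" by simp
  then show ?thesis by (simp add: power2_eq_square algebra_simps)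
qed

lemma slice_lincomb: "slice (\<lambda>s y \<omega>. a * f s y \<omega> + b * g s y \<omega>) \<omega> z = a * slice f \<omega> z + b * slice g \<omega> z"
  by (simp add: slice_def algebra_simps)

context noise_space
begin

lemma elementary_scale:
  "\<forall>e\<in>set S. elementary_integrand M W e \<Longrightarrow> \<forall>e\<in>set (scale_simple a S). elementary_integrand M W e"
proof
  fix e assume S: "\<forall>e\<in>set S. elementary_integrand M W e" and "e \<in> set (scale_simple a S)"
  then obtain X r t A where e: "(X, r, t, A) \<in> set S" "e = (\<lambda>\<omega>. a * X \<omega>, r, t, A)"
    by (auto simp: scale_simple_def)
  have el: "elementary_integrand M W (X, r, t, A)" using S e(1) by blast
  then obtain B where "\<And>\<omega>. \<omega> \<in> space M \<Longrightarrow> \<bar>X \<omega>\<bar> \<le> B" by (auto simp: elementary_integrand_def bounded_iff)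
  then have "\<And>\<omega>. \<omega> \<in> space M \<Longrightarrow> \<bar>a * X \<omega>\<bar> \<le> \<bar>a\<bar> * B" by (simp add: abs_mult mult_left_mono)
  then have "bounded ((\<lambda>\<omega>. a * X \<omega>) ` space M)" by (auto simp: bounded_iff)
  then show "elementary_integrand M W e" using el by (auto simp: elementary_integrand_def e(2))
qed

lemma slice_mult_joint:
  assumes f: "predictable M W f" and g: "predictable M W g"
  shows "(\<lambda>\<omega>. ip (slice f \<omega>) (slice g \<omega>)) \<in> borel_measurable M"
proof (rule lborel.borel_measurable_lebesgue_integral)
  have "(\<lambda>x. (case x of (\<omega>, z) \<Rightarrow> slice f \<omega> z) * (case x of (\<omega>, z) \<Rightarrow> slice g \<omega> z)) \<in> borel_measurable (M \<Otimes>\<^sub>M lborel)"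
    by (intro borel_measurable_times predictable_joint f g)
  then show "(\<lambda>(\<omega>, z). slice f \<omega> z * slice g \<omega> z) \<in> borel_measurable (M \<Otimes>\<^sub>M lborel)"
    by (simp add: case_prod_beta')
qed

text \<open>The scaled approximating lists are concatenated; both errors are controlled by
  \<open>lincomb_square_le\<close>.\<close>

lemma has_walsh_integral_lincomb:
  assumes f: "has_walsh_integral M W f I" and g: "has_walsh_integral M W g J"
  shows "has_walsh_integral M W (\<lambda>s y \<omega>. a * f s y \<omega> + b * g s y \<omega>) (\<lambda>\<omega>. a * I \<omega> + b * J \<omega>)"
proof -
  from f obtain S where S: "predictable M W f" and I[measurable]: "I \<in> borel_measurable M"
    and Se: "\<And>n. \<forall>e\<in>set (S n). elementary_integrand M W e"
    and S1: "(\<lambda>n. \<integral>\<^sup>+\<omega>. (\<integral>\<^sup>+z. ennreal ((simple_value (S n) (fst z) (snd z) \<omega> - slice f \<omega> z)\<^sup>2) \<partial>lborel) \<partial>M) \<longlonglongrightarrow> 0"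
    and S2: "(\<lambda>n. \<integral>\<^sup>+\<omega>. ennreal ((simple_integral W (S n) \<omega> - I \<omega>)\<^sup>2) \<partial>M) \<longlonglongrightarrow> 0"
    by (rule has_walsh_integralE) blast
  from g obtain T where T: "predictable M W g" and J[measurable]: "J \<in> borel_measurable M"
    and Te: "\<And>n. \<forall>e\<in>set (T n). elementary_integrand M W e"
    and T1: "(\<lambda>n. \<integral>\<^sup>+\<omega>. (\<integral>\<^sup>+z. ennreal ((simple_value (T n) (fst z) (snd z) \<omega> - slice g \<omega> z)\<^sup>2) \<partial>lborel) \<partial>M) \<longlonglongrightarrow> 0"
    and T2: "(\<lambda>n. \<integral>\<^sup>+\<omega>. ennreal ((simple_integral W (T n) \<omega> - J \<omega>)\<^sup>2) \<partial>M) \<longlonglongrightarrow> 0"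
    by (rule has_walsh_integralE) blast
  let ?h = "\<lambda>s y \<omega>. a * f s y \<omega> + b * g s y \<omega>"
  let ?U = "\<lambda>n. scale_simple a (S n) @ scale_simple b (T n)"
  let ?eS = "\<lambda>n \<omega> z. ennreal ((simple_value (S n) (fst z) (snd z) \<omega> - slice f \<omega> z)\<^sup>2)"
  let ?eT = "\<lambda>n \<omega> z. ennreal ((simple_value (T n) (fst z) (snd z) \<omega> - slice g \<omega> z)\<^sup>2)"
  have Sm[measurable]: "simple_integral W (S n) \<in> borel_measurable M" for n by (rule simple_integral_M[OF Se])
  have Tm[measurable]: "simple_integral W (T n) \<in> borel_measurable M" for n by (rule simple_integral_M[OF Te])
  note [measurable] = error_measurable[OF Se S] error_measurable[OF Te T]
  have lim0: "(\<lambda>n. ennreal (2 * a\<^sup>2) * x n + ennreal (2 * b\<^sup>2) * y n) \<longlonglongrightarrow> 0"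
    if "x \<longlonglongrightarrow> 0" "y \<longlonglongrightarrow> 0" for x y :: "nat \<Rightarrow> ennreal"
  proof -
    have "(\<lambda>n. ennreal (2 * a\<^sup>2) * x n + ennreal (2 * b\<^sup>2) * y n) \<longlonglongrightarrow> ennreal (2 * a\<^sup>2) * 0 + ennreal (2 * b\<^sup>2) * 0"
      using that by (intro tendsto_add tendsto_mult_ennreal tendsto_const) auto
    then show ?thesis by simp
  qed
  have pt: "ennreal ((a * x + b * y)\<^sup>2) \<le> ennreal (2 * a\<^sup>2) * ennreal (x\<^sup>2) + ennreal (2 * b\<^sup>2) * ennreal (y\<^sup>2)" for x y
  proof -
    have "ennreal ((a * x + b * y)\<^sup>2) \<le> ennreal (2 * a\<^sup>2 * x\<^sup>2 + 2 * b\<^sup>2 * y\<^sup>2)"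
      by (intro ennreal_leI lincomb_square_le)
    also have "\<dots> = ennreal (2 * a\<^sup>2) * ennreal (x\<^sup>2) + ennreal (2 * b\<^sup>2) * ennreal (y\<^sup>2)"
      by (subst ennreal_plus) (auto simp: ennreal_mult)
    finally show ?thesis .
  qed
  show ?thesis
  proof (rule has_walsh_integralI)
    show "predictable M W ?h"
    proof -
      have "(\<lambda>x. a * (case x of (s, y, \<omega>) \<Rightarrow> f s y \<omega>) + b * (case x of (s, y, \<omega>) \<Rightarrow> g s y \<omega>)) \<in> borel_measurable (predictable_sigma M W)"
        using S T unfolding predictable_def by measurable
      then show ?thesis unfolding predictable_def by (simp add: case_prod_beta')
    qed
    show "\<forall>e\<in>set (?U n). elementary_integrand M W e" for n
      using elementary_scale[OF Se[of n], of a] elementary_scale[OF Te[of n], of b] by auto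
    show "(\<lambda>n. \<integral>\<^sup>+\<omega>. (\<integral>\<^sup>+z. ennreal ((simple_value (?U n) (fst z) (snd z) \<omega> - slice ?h \<omega> z)\<^sup>2) \<partial>lborel) \<partial>M) \<longlonglongrightarrow> 0"
    proof (rule tendsto_sandwich[OF always_eventually always_eventually tendsto_const lim0[OF S1 T1]]; intro allI)
      fix n
      have "(\<integral>\<^sup>+\<omega>. (\<integral>\<^sup>+z. ennreal ((simple_value (?U n) (fst z) (snd z) \<omega> - slice ?h \<omega> z)\<^sup>2) \<partial>lborel) \<partial>M)
        \<le> (\<integral>\<^sup>+\<omega>. ennreal (2 * a\<^sup>2) * (\<integral>\<^sup>+z. ?eS n \<omega> z \<partial>lborel) + ennreal (2 * b\<^sup>2) * (\<integral>\<^sup>+z. ?eT n \<omega> z \<partial>lborel) \<partial>M)"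
      proof (rule nn_integral_mono)
        fix \<omega> assume \<omega>: "\<omega> \<in> space M"
        have m: "?eS n \<omega> \<in> borel_measurable lborel" "?eT n \<omega> \<in> borel_measurable lborel"
          using measurable_Pair2[OF error_joint[OF Se[of n] S] \<omega>] measurable_Pair2[OF error_joint[OF Te[of n] T] \<omega>] by simp_all
        have "(\<integral>\<^sup>+z. ennreal ((simple_value (?U n) (fst z) (snd z) \<omega> - slice ?h \<omega> z)\<^sup>2) \<partial>lborel)
          \<le> (\<integral>\<^sup>+z. ennreal (2 * a\<^sup>2) * ?eS n \<omega> z + ennreal (2 * b\<^sup>2) * ?eT n \<omega> z \<partial>lborel)"
        proof (rule nn_integral_mono)
          fix z
          have "simple_value (?U n) (fst z) (snd z) \<omega> - slice ?h \<omega> z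
            = a * (simple_value (S n) (fst z) (snd z) \<omega> - slice f \<omega> z) + b * (simple_value (T n) (fst z) (snd z) \<omega> - slice g \<omega> z)"
            by (simp add: simple_value_append simple_value_scale slice_lincomb algebra_simps)
          then show "ennreal ((simple_value (?U n) (fst z) (snd z) \<omega> - slice ?h \<omega> z)\<^sup>2) \<le> ennreal (2 * a\<^sup>2) * ?eS n \<omega> z + ennreal (2 * b\<^sup>2) * ?eT n \<omega> z"
            using pt by simp
        qed
        also have "\<dots> = ennreal (2 * a\<^sup>2) * (\<integral>\<^sup>+z. ?eS n \<omega> z \<partial>lborel) + ennreal (2 * b\<^sup>2) * (\<integral>\<^sup>+z. ?eT n \<omega> z \<partial>lborel)"
          using m by (simp add: nn_integral_add nn_integral_cmult)
        finally show "(\<integral>\<^sup>+z. ennreal ((simple_value (?U n) (fst z) (snd z) \<omega> - slice ?h \<omega> z)\<^sup>2) \<partial>lborel) \<le> \<dots>" .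
      qed
      also have "\<dots> = ennreal (2 * a\<^sup>2) * (\<integral>\<^sup>+\<omega>. (\<integral>\<^sup>+z. ?eS n \<omega> z \<partial>lborel) \<partial>M) + ennreal (2 * b\<^sup>2) * (\<integral>\<^sup>+\<omega>. (\<integral>\<^sup>+z. ?eT n \<omega> z \<partial>lborel) \<partial>M)"
        by (subst nn_integral_add; simp add: nn_integral_cmult)
      finally show "(\<integral>\<^sup>+\<omega>. (\<integral>\<^sup>+z. ennreal ((simple_value (?U n) (fst z) (snd z) \<omega> - slice ?h \<omega> z)\<^sup>2) \<partial>lborel) \<partial>M) \<le> \<dots>" .
    qed simp
    show "(\<lambda>n. \<integral>\<^sup>+\<omega>. ennreal ((simple_integral W (?U n) \<omega> - (a * I \<omega> + b * J \<omega>))\<^sup>2) \<partial>M) \<longlonglongrightarrow> 0"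
    proof (rule tendsto_sandwich[OF always_eventually always_eventually tendsto_const lim0[OF S2 T2]]; intro allI)
      fix n
      have "(\<integral>\<^sup>+\<omega>. ennreal ((simple_integral W (?U n) \<omega> - (a * I \<omega> + b * J \<omega>))\<^sup>2) \<partial>M)
        \<le> (\<integral>\<^sup>+\<omega>. ennreal (2 * a\<^sup>2) * ennreal ((simple_integral W (S n) \<omega> - I \<omega>)\<^sup>2) + ennreal (2 * b\<^sup>2) * ennreal ((simple_integral W (T n) \<omega> - J \<omega>)\<^sup>2) \<partial>M)"
      proof (rule nn_integral_mono)
        fix \<omega>
        have "simple_integral W (?U n) \<omega> - (a * I \<omega> + b * J \<omega>) = a * (simple_integral W (S n) \<omega> - I \<omega>) + b * (simple_integral W (T n) \<omega> - J \<omega>)"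
          by (simp add: simple_integral_append simple_integral_scale algebra_simps)
        then show "ennreal ((simple_integral W (?U n) \<omega> - (a * I \<omega> + b * J \<omega>))\<^sup>2)
          \<le> ennreal (2 * a\<^sup>2) * ennreal ((simple_integral W (S n) \<omega> - I \<omega>)\<^sup>2) + ennreal (2 * b\<^sup>2) * ennreal ((simple_integral W (T n) \<omega> - J \<omega>)\<^sup>2)"
          using pt by simp
      qed
      also have "\<dots> = ennreal (2 * a\<^sup>2) * (\<integral>\<^sup>+\<omega>. ennreal ((simple_integral W (S n) \<omega> - I \<omega>)\<^sup>2) \<partial>M)
          + ennreal (2 * b\<^sup>2) * (\<integral>\<^sup>+\<omega>. ennreal ((simple_integral W (T n) \<omega> - J \<omega>)\<^sup>2) \<partial>M)"
        by (subst nn_integral_add; simp add: nn_integral_cmult)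
      finally show "(\<integral>\<^sup>+\<omega>. ennreal ((simple_integral W (?U n) \<omega> - (a * I \<omega> + b * J \<omega>))\<^sup>2) \<partial>M) \<le> \<dots>" .
    qed simp
  qed measurable
qed

text \<open>A deterministic indicator is itself a simple integrand, so a constant approximating
  sequence works.\<close>

lemma has_walsh_integral_indicator:
  assumes "0 \<le> t" "A \<in> sets borel" "emeasure lborel A < \<infinity>"
  shows "has_walsh_integral M W (\<lambda>s y \<omega>. indicat_real ({0<..t} \<times> A) (s, y)) (W (indicat_real ({0<..t} \<times> A)))"
proof (rule has_walsh_integralI[where S="\<lambda>n. [(\<lambda>_. 1, 0, t, A)]"])
  have L: "indicat_real ({0<..t} \<times> A) \<in> L2_halfplane" using assms by (intro L2_halfplane_indicator) auto
  then show "W (indicat_real ({0<..t} \<times> A)) \<in> borel_measurable M" by (rule W_measurable)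
  let ?A = "{{r<..t} \<times> (A :: real set) \<times> G | r t A G. 0 \<le> r \<and> r \<le> t \<and> A \<in> sets borel \<and> G \<in> sets (noise_filtration M W r)}"
  have sub: "?A \<subseteq> Pow ({0<..} \<times> UNIV \<times> space M)"
    using sets.sets_into_space[of _ "noise_filtration M W r" for r] by fastforce
  have sets: "{0<..t} \<times> A \<times> space M \<in> sets (predictable_sigma M W)"
    unfolding predictable_sigma_def sets_measure_of[OF sub]
    by (rule sigma_sets.Basic) (use assms sets.top[of "noise_filtration M W 0"] in auto)
  have sp: "space (predictable_sigma M W) = {0<..} \<times> UNIV \<times> space M"
    unfolding predictable_sigma_def by (rule space_measure_of[OF sub])
  have "indicat_real ({0<..t} \<times> A \<times> space M) \<in> borel_measurable (predictable_sigma M W)"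
    using sets by simp
  then show "predictable M W (\<lambda>s y \<omega>. indicat_real ({0<..t} \<times> A) (s, y))"
    unfolding predictable_def by (rule measurable_cong[THEN iffD1, rotated]) (auto simp: sp indicator_def)
  show "\<forall>e\<in>set [(\<lambda>_. 1, 0, t, A)]. elementary_integrand M W e"
    using assms by (auto simp: elementary_integrand_def image_constant_conv)
  have "simple_value [(\<lambda>_. 1, 0, t, A)] (fst z) (snd z) \<omega> - slice (\<lambda>s y \<omega>. indicat_real ({0<..t} \<times> A) (s, y)) \<omega> z = 0" for z and \<omega> :: 'a
    by (cases z) (auto simp: simple_value_Cons slice_def ephi_def indicator_def)
  then show "(\<lambda>n. \<integral>\<^sup>+\<omega>. (\<integral>\<^sup>+z. ennreal ((simple_value [(\<lambda>_. 1, 0, t, A)] (fst z) (snd z) \<omega>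
      - slice (\<lambda>s y \<omega>. indicat_real ({0<..t} \<times> A) (s, y)) \<omega> z)\<^sup>2) \<partial>lborel) \<partial>M) \<longlonglongrightarrow> 0"
    by simp
  show "(\<lambda>n. \<integral>\<^sup>+\<omega>. ennreal ((simple_integral W [(\<lambda>_. 1, 0, t, A)] \<omega> - W (indicat_real ({0<..t} \<times> A)) \<omega>)\<^sup>2) \<partial>M) \<longlonglongrightarrow> 0"
    by (simp add: simple_integral_Cons ephi_def)
qed

lemma has_walsh_integral_zero: "has_walsh_integral M W (\<lambda>s y \<omega>. 0) (\<lambda>\<omega>. 0)"
  using has_walsh_integral_lincomb[OF has_walsh_integral_indicator[of 0 "{}"] has_walsh_integral_indicator[of 0 "{}"], of 0 0]
  by simp

text \<open>The noise shifted by the deterministic drift \<open>h\<close> on a rectangle: no Girsanov theorem is needed,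
  because the exponential bound applies to the integrand \<open>f + h 1\<^bsub>R\<^esub>\<close>.\<close>

lemma walsh_exp_tilted:
  assumes f: "has_walsh_integral M W f I"
    and R: "R = {0<..t} \<times> A" "0 \<le> t" "A \<in> sets borel" "emeasure lborel A < \<infinity>"
    and v: "AE \<omega> in M. ip (slice f \<omega>) (slice f \<omega>) \<le> v"
  shows "(\<integral>\<^sup>+\<omega>. ennreal (dens (\<lambda>z. h * indicat_real R z) \<omega> * exp (I \<omega> - h * ip (slice f \<omega>) (indicat_real R))) \<partial>M) \<le> ennreal (exp (v / 2))"
proof -
  let ?\<eta> = "\<lambda>z. h * indicat_real R z"
  have L: "indicat_real R \<in> L2_halfplane" unfolding R(1) using R by (intro L2_halfplane_indicator) auto
  have L\<eta>: "?\<eta> \<in> L2_halfplane" by (rule L2_halfplane_scale[OF L])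
  have w: "has_walsh_integral M W (\<lambda>s y \<omega>. 1 * f s y \<omega> + h * indicat_real R (s, y)) (\<lambda>\<omega>. 1 * I \<omega> + h * W (indicat_real R) \<omega>)"
    unfolding R(1) by (intro has_walsh_integral_lincomb f has_walsh_integral_indicator R)
  let ?f = "\<lambda>s y \<omega>. 1 * f s y \<omega> + h * indicat_real R (s, y)"
  have sl: "slice ?f \<omega> = (\<lambda>z. slice f \<omega> z + ?\<eta> z)" for \<omega>
    by (auto simp: fun_eq_iff slice_def R(1) indicator_def)
  have "(\<integral>\<^sup>+\<omega>. ennreal (dens ?\<eta> \<omega> * exp (I \<omega> - h * ip (slice f \<omega>) (indicat_real R))) \<partial>M)
    \<le> (\<integral>\<^sup>+\<omega>. ennreal (exp (v / 2)) * ennreal (exp (1 * I \<omega> + h * W (indicat_real R) \<omega> - ip (slice ?f \<omega>) (slice ?f \<omega>) / 2)) \<partial>M)"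
  proof (rule nn_integral_mono_AE, use walsh_exp(1)[OF f] W_scale[OF L, of h] v in eventually_elim)
    case (elim \<omega>)
    have e: "ip (slice f \<omega>) ?\<eta> = h * ip (slice f \<omega>) (indicat_real R)"
    proof -
      have "ip (slice f \<omega>) ?\<eta> = (\<integral>z. h * (slice f \<omega> z * indicat_real R z) \<partial>lborel)"
        by (intro Bochner_Integration.integral_cong) auto
      then show ?thesis by simp
    qed
    have "ip (slice ?f \<omega>) (slice ?f \<omega>) = ip (slice f \<omega>) (slice f \<omega>) + 2 * (h * ip (slice f \<omega>) (indicat_real R)) + ip ?\<eta> ?\<eta>"
      unfolding sl ip_add_self[OF elim(1) L\<eta>] e ..
    \<comment> \<open>Completing the square: the norm of the drift hidden in the density and the
      subtracted cross term are what the exponential for the shifted integrand requires. Only the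
      quadratic variation of \<open>f\<close> is left over, and it is at most
      \<open>v\<close>.\<close>
    then have "dens ?\<eta> \<omega> * exp (I \<omega> - h * ip (slice f \<omega>) (indicat_real R))
      = exp (ip (slice f \<omega>) (slice f \<omega>) / 2 + (1 * I \<omega> + h * W (indicat_real R) \<omega> - ip (slice ?f \<omega>) (slice ?f \<omega>) / 2))"
      unfolding dens_def exp_add[symmetric] using elim(2) by (simp add: add_divide_distrib)
    also have "\<dots> \<le> exp (v / 2) * exp (1 * I \<omega> + h * W (indicat_real R) \<omega> - ip (slice ?f \<omega>) (slice ?f \<omega>) / 2)"
      unfolding exp_add using elim(3) by (intro mult_right_mono) auto
    finally show ?case by (simp add: ennreal_mult'[symmetric] ennreal_leI)
  qed
  also have "\<dots> \<le> ennreal (exp (v / 2)) * (\<integral>\<^sup>+\<omega>. ennreal (exp (1 * I \<omega> + h * W (indicat_real R) \<omega> - ip (slice ?f \<omega>) (slice ?f \<omega>) / 2)) \<partial>M)"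
  proof (rule eq_refl, rule nn_integral_cmult)
    have p: "predictable M W ?f" and [measurable]: "(\<lambda>\<omega>. 1 * I \<omega> + h * W (indicat_real R) \<omega>) \<in> borel_measurable M"
      using w by (auto simp: has_walsh_integral_def)
    note [measurable] = slice_mult_joint[OF p p]
    show "(\<lambda>\<omega>. ennreal (exp (1 * I \<omega> + h * W (indicat_real R) \<omega> - ip (slice ?f \<omega>) (slice ?f \<omega>) / 2))) \<in> borel_measurable M"
      by measurable
  qed
  also have "\<dots> \<le> ennreal (exp (v / 2)) * 1"
    by (intro mult_left_mono walsh_exp(2)[OF w]) auto
  finally show ?thesis by simp
qed

end

section \<open>The heat kernel\<close>

lemma heat_kernel_normal: "0 < r \<Longrightarrow> heat_kernel r z = normal_density 0 (sqrt r) z"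
  by (simp add: heat_kernel_def normal_density_def)

lemma heat_kernel_nonneg: "0 \<le> r \<Longrightarrow> 0 \<le> heat_kernel r z"
  by (simp add: heat_kernel_def)

lemma heat_kernel_minus: "heat_kernel r (- z) = heat_kernel r z"
  by (simp add: heat_kernel_def)

lemma heat_kernel_compose_measurable [measurable (raw)]:
  assumes [measurable]: "f \<in> borel_measurable M" "g \<in> borel_measurable M"
  shows "(\<lambda>x. heat_kernel (f x) (g x)) \<in> borel_measurable M"
  unfolding heat_kernel_def by measurable

lemma heat_kernel_nn_integral: "0 < r \<Longrightarrow> (\<integral>\<^sup>+y. ennreal (heat_kernel r (y - x)) \<partial>lborel) = 1"
proof -
  assume r: "0 < r"
  have "(\<integral>\<^sup>+y. ennreal (heat_kernel r (y - x)) \<partial>lborel) = (\<integral>\<^sup>+y. ennreal (normal_density x (sqrt r) y) \<partial>lborel)"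
    using r by (intro nn_integral_cong) (simp add: heat_kernel_normal normal_density_def)
  also have "\<dots> = 1"
    using r by (subst nn_integral_eq_integral) auto
  finally show ?thesis .
qed

lemma heat_kernel_conv:
  assumes "0 < r" "0 < r'"
  shows "(\<integral>\<^sup>+y. ennreal (heat_kernel r (y - x) * heat_kernel r' (y - x')) \<partial>lborel) = ennreal (heat_kernel (r + r') (x - x'))"
proof -
  have "(\<integral>\<^sup>+y. ennreal (heat_kernel r (y - x) * heat_kernel r' (y - x')) \<partial>lborel)
    = (\<integral>\<^sup>+y. ennreal (heat_kernel r (x' + 1 * y - x) * heat_kernel r' (x' + 1 * y - x')) \<partial>lborel)"
    by (subst nn_integral_real_affine[where c=1 and t=x']) auto
  also have "\<dots> = (\<integral>\<^sup>+y. ennreal (normal_density 0 (sqrt r) ((x - x') - y) * normal_density 0 (sqrt r') y) \<partial>lborel)"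
  proof (intro nn_integral_cong)
    fix y
    have "heat_kernel r (x' + 1 * y - x) = heat_kernel r ((x - x') - y)"
      using heat_kernel_minus[of r "(x - x') - y"] by (simp add: algebra_simps)
    then show "ennreal (heat_kernel r (x' + 1 * y - x) * heat_kernel r' (x' + 1 * y - x'))
      = ennreal (normal_density 0 (sqrt r) ((x - x') - y) * normal_density 0 (sqrt r') y)"
      using assms by (simp add: heat_kernel_normal)
  qed
  also have "\<dots> = ennreal (normal_density 0 (sqrt ((sqrt r)\<^sup>2 + (sqrt r')\<^sup>2)) (x - x'))"
    using fun_cong[OF conv_normal_density_zero_mean[of "sqrt r" "sqrt r'"], of "x - x'"] assms by simp
  also have "\<dots> = ennreal (heat_kernel (r + r') (x - x'))"
    using assms by (simp add: heat_kernel_normal)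
  finally show ?thesis .
qed

text \<open>After expanding the square, each of the three products integrates by the semigroup
  property.\<close>

lemma heat_kernel_diff_sq:
  assumes "0 < r" "0 < r'"
  shows "(\<integral>\<^sup>+y. ennreal ((heat_kernel r (y - x) - heat_kernel r' (y - x'))\<^sup>2) \<partial>lborel)
    = ennreal (heat_kernel (2 * r) 0 + heat_kernel (2 * r') 0 - 2 * heat_kernel (r + r') (x - x'))"
proof -
  have i: "integrable lborel (\<lambda>y. heat_kernel a (y - u) * heat_kernel b (y - w))"
    and e: "(\<integral>y. heat_kernel a (y - u) * heat_kernel b (y - w) \<partial>lborel) = heat_kernel (a + b) (u - w)"
    if "0 < a" "0 < b" for a b u w
  proof -
    show "integrable lborel (\<lambda>y. heat_kernel a (y - u) * heat_kernel b (y - w))"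
      using heat_kernel_conv[OF that, of u w] that by (intro integrableI_nonneg) (auto simp: heat_kernel_nonneg)
    show "(\<integral>y. heat_kernel a (y - u) * heat_kernel b (y - w) \<partial>lborel) = heat_kernel (a + b) (u - w)"
      using heat_kernel_conv[OF that, of u w] that by (subst integral_eq_nn_integral) (auto simp: heat_kernel_nonneg)
  qed
  let ?a = "\<lambda>y. heat_kernel r (y - x)" and ?b = "\<lambda>y. heat_kernel r' (y - x')"
  have eq: "(\<lambda>y. (?a y - ?b y)\<^sup>2) = (\<lambda>y. ?a y * ?a y - 2 * (?a y * ?b y) + ?b y * ?b y)"
    by (auto simp: power2_eq_square algebra_simps)
  have I: "integrable lborel (\<lambda>y. (?a y - ?b y)\<^sup>2)"
    unfolding eq using i[of r r x x] i[of r r' x x'] i[of r' r' x' x'] assms by auto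
  have "(\<integral>\<^sup>+y. ennreal ((?a y - ?b y)\<^sup>2) \<partial>lborel) = ennreal (\<integral>y. (?a y - ?b y)\<^sup>2 \<partial>lborel)"
    by (rule nn_integral_eq_integral[OF I]) auto
  also have "(\<integral>y. (?a y - ?b y)\<^sup>2 \<partial>lborel) = heat_kernel (2 * r) 0 + heat_kernel (2 * r') 0 - 2 * heat_kernel (r + r') (x - x')"
    unfolding eq using i[of r r x x] i[of r r' x x'] i[of r' r' x' x'] e[of r r x x] e[of r r' x x'] e[of r' r' x' x'] assms
    by simp
  finally show ?thesis .
qed

lemma heat_kernel_sq:
  assumes "0 < r"
  shows "(\<integral>\<^sup>+y. ennreal ((heat_kernel r (y - x))\<^sup>2) \<partial>lborel) = ennreal (heat_kernel (2 * r) 0)"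
  using heat_kernel_conv[OF assms assms, of x x] by (simp add: power2_eq_square)

section \<open>Bounds for increments of the heat kernel at a fixed elapsed time\<close>

lemma heat_kernel_0_le:
  assumes "0 < r" shows "heat_kernel (2 * r) 0 \<le> r powr (- 1 / 2) / 2"
proof -
  have "heat_kernel (2 * r) 0 = 1 / (2 * sqrt pi * sqrt r)"
    using assms by (simp add: heat_kernel_def real_sqrt_mult)
  also have "\<dots> \<le> 1 / (2 * 1 * sqrt r)"
    using pi_gt3 assms by (intro divide_left_mono mult_right_mono mult_left_mono) (auto simp: mult_pos_pos)
  also have "\<dots> = r powr (- 1 / 2) / 2"
    using assms by (simp add: powr_minus_divide powr_half_sqrt)
  finally show ?thesis .
qed

text \<open>The exponent 1/4 is a deliberate loss. Multiplied by the r^(-1/2) of the squared kernel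
  it produces the singularity r^(-3/4), which is still integrable in time, together with a positive
  power of the increment.\<close>

lemma one_minus_exp_le:
  assumes "0 \<le> (w :: real)" shows "1 - exp (- w) \<le> w powr (1/4)"
proof (cases "1 \<le> w")
  case True
  then have "1 \<le> w powr (1/4)" by (simp add: ge_one_powr_ge_zero)
  then show ?thesis by (smt (verit) exp_gt_zero)
next
  case False
  have "1 - exp (- w) \<le> w" using exp_ge_add_one_self[of "- w"] by linarith
  also have "w \<le> w powr (1/4)"
    using False assms powr_mono'[of "1/4" 1 w] by (cases "w = 0") auto
  finally show ?thesis .
qed

lemma space_increment_le:
  assumes "0 < r"
  shows "heat_kernel (2 * r) 0 + heat_kernel (2 * r) 0 - 2 * heat_kernel (r + r) z \<le> \<bar>z\<bar> powr (1/2) * r powr (- 3 / 4)"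
proof -
  have a: "heat_kernel (r + r) z = heat_kernel (2 * r) 0 * exp (- (z\<^sup>2 / (4 * r)))"
    by (simp add: heat_kernel_def)
  have "heat_kernel (2 * r) 0 + heat_kernel (2 * r) 0 - 2 * heat_kernel (r + r) z
      = 2 * heat_kernel (2 * r) 0 * (1 - exp (- (z\<^sup>2 / (4 * r))))"
    unfolding a by (simp add: algebra_simps)
  also have "\<dots> \<le> 2 * (r powr (- 1 / 2) / 2) * (z\<^sup>2 / (4 * r)) powr (1/4)"
    using assms by (intro mult_mono one_minus_exp_le heat_kernel_0_le) (auto simp: heat_kernel_nonneg)
  also have "(z\<^sup>2 / (4 * r)) powr (1/4) \<le> (z\<^sup>2 / r) powr (1/4)"
    using assms by (intro powr_mono2) (auto simp: field_simps)
  also have "(z\<^sup>2 / r) powr (1/4) = \<bar>z\<bar> powr (1/2) * r powr (- 1 / 4)"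
  proof -
    have "z\<^sup>2 = \<bar>z\<bar> powr 2" by (cases "z = 0") (auto simp: powr_numeral)
    then have "z\<^sup>2 powr (1/4) = \<bar>z\<bar> powr (1/2)" by (simp only: powr_powr) simp
    then show ?thesis using assms by (simp add: powr_divide powr_minus_divide)
  qed
  finally have "heat_kernel (2 * r) 0 + heat_kernel (2 * r) 0 - 2 * heat_kernel (r + r) z
      \<le> 2 * (r powr (- 1 / 2) / 2) * (\<bar>z\<bar> powr (1/2) * r powr (- 1 / 4))"
    by (simp add: mult_left_mono)
  also have "\<dots> = \<bar>z\<bar> powr (1/2) * (r powr (- 1 / 2) * r powr (- 1 / 4))" by simp
  also have "r powr (- 1 / 2) * r powr (- 1 / 4) = r powr (- 3 / 4)" by (simp add: powr_add[symmetric])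
  finally show ?thesis .
qed

text \<open>By monotonicity of the kernel at 0 the left side is at most its drop between the times 2
  r and 2 (r + \<delta>). The relative drop is 1 - sqrt q with q = r / (r + \<delta>), which is at
  most 1 - q, and the same interpolation with exponent 1/4 applies.\<close>

lemma time_increment_le:
  assumes "0 < r" "0 \<le> \<delta>"
  shows "heat_kernel (2 * r) 0 + heat_kernel (2 * (r + \<delta>)) 0 - 2 * heat_kernel (r + (r + \<delta>)) 0 \<le> \<delta> powr (1/4) * r powr (- 3 / 4)"
proof -
  have h: "heat_kernel a 0 = 1 / sqrt (2 * pi * a)" for a by (simp add: heat_kernel_def)
  have m: "heat_kernel (2 * (r + \<delta>)) 0 \<le> heat_kernel (r + (r + \<delta>)) 0"
    unfolding h using assms by (intro divide_left_mono real_sqrt_le_mono mult_left_mono) (auto intro!: mult_pos_pos)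
  let ?q = "r / (r + \<delta>)"
  have q: "0 < ?q" "?q \<le> 1" using assms by (auto simp: field_simps)
  have "heat_kernel (2 * u) 0 = heat_kernel (2 * r) 0 * sqrt (r / u)" for u
    unfolding h using assms by (simp add: real_sqrt_mult real_sqrt_divide)
  then have e: "heat_kernel (2 * (r + \<delta>)) 0 = heat_kernel (2 * r) 0 * sqrt ?q" .
  have "w \<le> sqrt w" if "0 < w" "w \<le> 1" for w :: real
    using that by (intro real_le_rsqrt) (simp add: power2_eq_square mult_left_le)
  then have sq: "?q \<le> sqrt ?q" using q by blast
  have w: "1 - ?q \<le> (\<delta> / r) powr (1/4)"
  proof -
    have "1 - ?q = \<delta> / (r + \<delta>)" using assms by (simp add: field_simps)
    also have "\<dots> \<le> (\<delta> / r) powr (1/4)"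
    proof (cases "\<delta> \<ge> r")
      case True
      then have "1 \<le> (\<delta> / r) powr (1/4)" using assms by (intro ge_one_powr_ge_zero) auto
      moreover have "\<delta> / (r + \<delta>) \<le> 1" using assms by simp
      ultimately show ?thesis by linarith
    next
      case False
      have "\<delta> / (r + \<delta>) \<le> \<delta> / r" using assms by (intro divide_left_mono) auto
      also have "\<dots> \<le> (\<delta> / r) powr (1/4)"
        using False assms powr_mono'[of "1/4" 1 "\<delta> / r"] by (cases "\<delta> = 0") auto
      finally show ?thesis .
    qed
    finally show ?thesis .
  qed
  have "heat_kernel (2 * r) 0 + heat_kernel (2 * (r + \<delta>)) 0 - 2 * heat_kernel (r + (r + \<delta>)) 0
     \<le> heat_kernel (2 * r) 0 * (1 - sqrt ?q)"
    using m unfolding e by (simp add: algebra_simps)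
  also have "\<dots> \<le> (r powr (- 1 / 2) / 2) * (\<delta> / r) powr (1/4)"
    using sq w q assms by (intro mult_mono heat_kernel_0_le) auto
  also have "\<dots> \<le> r powr (- 1 / 2) * (\<delta> / r) powr (1/4)" by (intro mult_right_mono) auto
  also have "\<dots> = \<delta> powr (1/4) * (r powr (- 1 / 2) * r powr (- 1 / 4))"
    using assms by (simp add: powr_divide powr_minus_divide)
  also have "r powr (- 1 / 2) * r powr (- 1 / 4) = r powr (- 3 / 4)" by (simp add: powr_add[symmetric])
  finally show ?thesis .
qed

text \<open>For the last stretch of time, on which only the kernel with the later end point is
  present.\<close>

lemma short_time_le:
  assumes "0 < r" "r \<le> \<delta>" shows "heat_kernel (2 * r) 0 \<le> \<delta> powr (1/4) * r powr (- 3 / 4)"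
proof -
  have "heat_kernel (2 * r) 0 \<le> r powr (- 1 / 2)" using heat_kernel_0_le[OF assms(1)] powr_ge_zero[of r "-1/2"] by linarith
  also have "\<dots> = r powr (1/4) * r powr (- 3 / 4)" by (simp add: powr_add[symmetric])
  also have "\<dots> \<le> \<delta> powr (1/4) * r powr (- 3 / 4)" using assms by (intro mult_right_mono powr_mono2) auto
  finally show ?thesis .
qed

lemma nn_integral_powr_time:
  assumes "0 \<le> t"
  shows "(\<integral>\<^sup>+s. ennreal ((t - s) powr (- 3 / 4)) * indicator {0<..<t} s \<partial>lborel) = ennreal (4 * t powr (1/4))"
proof -
  have "(\<integral>\<^sup>+s. ennreal ((t - s) powr (- 3 / 4)) * indicator {0<..<t} s \<partial>lborel)
    = (\<integral>\<^sup>+r. ennreal ((t - (t + (-1) * r)) powr (- 3 / 4)) * indicator {0<..<t} (t + (-1) * r) \<partial>lborel)"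
    by (subst nn_integral_real_affine[where c="-1" and t=t]) auto
  also have "\<dots> = (\<integral>\<^sup>+r. ennreal (r powr (- 3 / 4)) * indicator {0..t} r \<partial>lborel)"
  proof (rule nn_integral_cong_AE)
    have "AE r in lborel. r \<noteq> 0 \<and> r \<noteq> t" by (auto intro!: AE_conjI AE_lborel_singleton)
    then show "AE r in lborel. ennreal ((t - (t + (-1) * r)) powr (- 3 / 4)) * indicator {0<..<t} (t + (-1) * r)
      = ennreal (r powr (- 3 / 4)) * indicator {0..t} r"
      by eventually_elim (auto simp: indicator_def)
  qed
  also have "\<dots> = ennreal (t powr (- 3 / 4 + 1) / (- 3 / 4 + 1))"
    by (rule nn_integral_has_integral_lebesgue'[OF _ has_integral_powr_from_0]) (use assms in auto)
  finally show ?thesis by simp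
qed

text \<open>The time window is built in, so that stochastic and drift integrals can be written over
  the whole plane. For \<open>t \<le> 0\<close> the window is empty and the kernel vanishes.\<close>

definition kern :: "real \<Rightarrow> real \<Rightarrow> real \<times> real \<Rightarrow> real" where
  "kern t x z = indicat_real {0<..<t} (fst z) * heat_kernel (t - fst z) (snd z - x)"

lemma kern_nonneg: "0 \<le> kern t x z"
  by (simp add: kern_def heat_kernel_nonneg indicator_def)

lemma kern_measurable [measurable]: "kern t x \<in> borel_measurable borel"
  unfolding kern_def[abs_def] borel_prod[symmetric] by measurable

lemma kern_space_increment:
  assumes "0 \<le> t"
  shows "(\<integral>\<^sup>+z. ennreal ((kern t x z - kern t x' z)\<^sup>2) \<partial>lborel) \<le> ennreal (\<bar>x - x'\<bar> powr (1/2) * (4 * t powr (1/4)))"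
proof -
  have [measurable]: "(\<lambda>z. (kern t x z - kern t x' z)\<^sup>2) \<in> borel_measurable (lborel \<Otimes>\<^sub>M lborel)"
    unfolding lborel_prod by measurable
  have "(\<integral>\<^sup>+z. ennreal ((kern t x z - kern t x' z)\<^sup>2) \<partial>lborel)
     = (\<integral>\<^sup>+s. \<integral>\<^sup>+y. ennreal ((kern t x (s, y) - kern t x' (s, y))\<^sup>2) \<partial>lborel \<partial>lborel)"
    unfolding lborel_prod[symmetric] by (subst lborel.nn_integral_fst[symmetric]) auto
  also have "\<dots> \<le> (\<integral>\<^sup>+s. ennreal (\<bar>x - x'\<bar> powr (1/2)) * (ennreal ((t - s) powr (- 3 / 4)) * indicator {0<..<t} s) \<partial>lborel)"
  proof (rule nn_integral_mono)
    fix s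
    show "(\<integral>\<^sup>+y. ennreal ((kern t x (s, y) - kern t x' (s, y))\<^sup>2) \<partial>lborel)
      \<le> ennreal (\<bar>x - x'\<bar> powr (1/2)) * (ennreal ((t - s) powr (- 3 / 4)) * indicator {0<..<t} s)"
    proof (cases "0 < s \<and> s < t")
      case True
      then have "(\<integral>\<^sup>+y. ennreal ((kern t x (s, y) - kern t x' (s, y))\<^sup>2) \<partial>lborel)
        = ennreal (heat_kernel (2 * (t - s)) 0 + heat_kernel (2 * (t - s)) 0 - 2 * heat_kernel ((t - s) + (t - s)) (x - x'))"
        by (simp add: kern_def heat_kernel_diff_sq)
      also have "\<dots> \<le> ennreal (\<bar>x - x'\<bar> powr (1/2) * (t - s) powr (- 3 / 4))"
        using True by (intro ennreal_leI space_increment_le) auto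
      finally show ?thesis using True by (simp add: ennreal_mult)
    qed (simp add: kern_def)
  qed
  also have "\<dots> = ennreal (\<bar>x - x'\<bar> powr (1/2)) * ennreal (4 * t powr (1/4))"
    using assms by (subst nn_integral_cmult) (auto simp: nn_integral_powr_time[simplified])
  finally show ?thesis by (simp add: ennreal_mult)
qed

lemma kern_time_increment:
  assumes "0 \<le> t" "t \<le> t'"
  shows "(\<integral>\<^sup>+z. ennreal ((kern t x z - kern t' x z)\<^sup>2) \<partial>lborel) \<le> ennreal ((t' - t) powr (1/4) * (8 * t' powr (1/4)))"
proof -
  let ?\<delta> = "t' - t"
  let ?J = "\<lambda>t s. ennreal ((t - s) powr (- 3 / 4)) * indicator {0<..<t} s"
  have [measurable]: "(\<lambda>z. (kern t x z - kern t' x z)\<^sup>2) \<in> borel_measurable (lborel \<Otimes>\<^sub>M lborel)"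
    unfolding lborel_prod by measurable
  have "(\<integral>\<^sup>+z. ennreal ((kern t x z - kern t' x z)\<^sup>2) \<partial>lborel)
     = (\<integral>\<^sup>+s. \<integral>\<^sup>+y. ennreal ((kern t x (s, y) - kern t' x (s, y))\<^sup>2) \<partial>lborel \<partial>lborel)"
    unfolding lborel_prod[symmetric] by (subst lborel.nn_integral_fst[symmetric]) auto
  also have "\<dots> \<le> (\<integral>\<^sup>+s. ennreal (?\<delta> powr (1/4)) * (?J t s + ?J t' s) \<partial>lborel)"
  proof (rule nn_integral_mono)
    fix s
    show "(\<integral>\<^sup>+y. ennreal ((kern t x (s, y) - kern t' x (s, y))\<^sup>2) \<partial>lborel) \<le> ennreal (?\<delta> powr (1/4)) * (?J t s + ?J t' s)"
    proof -
      \<comment> \<open>Both kernels are present, or only the later one, or neither.\<close>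
      consider "0 < s" "s < t" | "0 < s" "t \<le> s" "s < t'" | "s \<le> 0 \<or> t' \<le> s" by linarith
      then show ?thesis
      proof cases
        case 1
        then have "(\<integral>\<^sup>+y. ennreal ((kern t x (s, y) - kern t' x (s, y))\<^sup>2) \<partial>lborel)
          = ennreal (heat_kernel (2 * (t - s)) 0 + heat_kernel (2 * (t' - s)) 0 - 2 * heat_kernel ((t - s) + (t' - s)) (x - x))"
          using assms by (simp add: kern_def heat_kernel_diff_sq)
        also have "\<dots> \<le> ennreal (?\<delta> powr (1/4) * (t - s) powr (- 3 / 4))"
          using time_increment_le[of "t - s" ?\<delta>] 1 assms by (intro ennreal_leI) (simp add: algebra_simps)
        also have "\<dots> \<le> ennreal (?\<delta> powr (1/4)) * (?J t s + ?J t' s)"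
          using 1 by (simp add: ennreal_mult) (intro mult_left_mono, auto)
        finally show ?thesis .
      next
        case 2
        then have "(\<integral>\<^sup>+y. ennreal ((kern t x (s, y) - kern t' x (s, y))\<^sup>2) \<partial>lborel) = ennreal (heat_kernel (2 * (t' - s)) 0)"
          by (simp add: kern_def heat_kernel_sq)
        also have "\<dots> \<le> ennreal (?\<delta> powr (1/4) * (t' - s) powr (- 3 / 4))"
          using 2 by (intro ennreal_leI short_time_le) auto
        also have "\<dots> \<le> ennreal (?\<delta> powr (1/4)) * (?J t s + ?J t' s)"
          using 2 by (simp add: ennreal_mult)
        finally show ?thesis .
      next
        case 3
        then show ?thesis using assms by (auto simp: kern_def indicator_def)
      qed
    qed
  qed
  also have "\<dots> = ennreal (?\<delta> powr (1/4)) * (ennreal (4 * t powr (1/4)) + ennreal (4 * t' powr (1/4)))"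
    using assms by (subst nn_integral_cmult; simp?) (subst nn_integral_add; simp add: nn_integral_powr_time[simplified])
  also have "\<dots> = ennreal (?\<delta> powr (1/4)) * ennreal (4 * t powr (1/4) + 4 * t' powr (1/4))"
    by (subst ennreal_plus) auto
  also have "\<dots> \<le> ennreal (?\<delta> powr (1/4)) * ennreal (8 * t' powr (1/4))"
    using powr_mono2[of "1/4" t t'] assms by (intro mult_left_mono ennreal_leI) auto
  finally show ?thesis by (simp add: ennreal_mult)
qed

text \<open>Within distance sqrt r of \<open>x\<close> the kernel is at least exp (-1/2) / sqrt (2
  pi r). Of the two intervals of length sqrt r next to \<open>x\<close>, the one on the side of
  \<open>c\<close> stays in the window because \<open>r \<le> 1\<close>. Its mass is at least 1/6,
  by exp (-1/2) \<ge> 1/2 and sqrt (2 pi) \<le> 3.\<close>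

lemma heat_kernel_mass_lower:
  assumes "0 < r" "r \<le> 1" "\<bar>x - c\<bar> \<le> 1"
  shows "ennreal (1 / 6) \<le> (\<integral>\<^sup>+y. ennreal (heat_kernel r (y - x)) * indicator {c - 1<..c + 1} y \<partial>lborel)"
proof -
  define q where "q = sqrt r"
  define I where "I = (if x \<le> c then {x<..<x + q} else {x - q<..<x})"
  have sr: "0 < q" "q \<le> 1" using assms by (auto simp: q_def)
  have sub: "I \<subseteq> {c - 1<..c + 1}" using assms(3) sr by (auto simp: I_def abs_le_iff)
  have "ennreal (1 / 6) \<le> ennreal (exp (- 1 / 2) / sqrt (2 * pi * r)) * ennreal (sqrt r)"
  proof -
    have "exp (- 1 / 2 :: real) \<ge> 1 - 1 / 2" using exp_ge_add_one_self[of "-1/2 :: real"] by simp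
    moreover have "sqrt (2 * pi) \<le> 3"
    proof (rule real_le_lsqrt)
      show "2 * pi \<le> 3\<^sup>2" using pi_less_4 by simp
    qed auto
    ultimately have "(1 / 6) \<le> exp (- 1 / 2) / sqrt (2 * pi)"
      by (simp add: le_divide_eq)
    also have "\<dots> = exp (- 1 / 2) / sqrt (2 * pi * r) * sqrt r"
      using assms(1) by (simp add: real_sqrt_mult)
    finally show ?thesis using assms(1) by (simp add: ennreal_mult[symmetric] ennreal_leI)
  qed
  also have "ennreal (sqrt r) = emeasure lborel I" using sr by (auto simp: I_def q_def)
  also have "ennreal (exp (- 1 / 2) / sqrt (2 * pi * r)) * emeasure lborel I
      = (\<integral>\<^sup>+y. ennreal (exp (- 1 / 2) / sqrt (2 * pi * r)) * indicator I y \<partial>lborel)"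
    by (subst nn_integral_cmult_indicator) (auto simp: I_def)
  also have "\<dots> \<le> (\<integral>\<^sup>+y. ennreal (heat_kernel r (y - x)) * indicator {c - 1<..c + 1} y \<partial>lborel)"
  proof (rule nn_integral_mono)
    fix y
    show "ennreal (exp (- 1 / 2) / sqrt (2 * pi * r)) * indicator I y \<le> ennreal (heat_kernel r (y - x)) * indicator {c - 1<..c + 1} y"
    proof (cases "y \<in> I")
      case True
      then have "\<bar>y - x\<bar> \<le> sqrt r" by (auto simp: I_def q_def[symmetric] split: if_splits)
      then have "(y - x)\<^sup>2 \<le> r" using assms(1) by (metis abs_ge_zero less_imp_le power2_abs power_mono real_sqrt_pow2)
      then have "exp (- 1 / 2) / sqrt (2 * pi * r) \<le> heat_kernel r (y - x)"
        unfolding heat_kernel_def using assms(1) by (intro divide_right_mono) (auto simp: field_simps)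
      then show ?thesis using True sub by (auto intro!: ennreal_leI)
    qed simp
  qed
  finally show ?thesis .
qed

section \<open>Chaining\<close>

text \<open>Chernoff's bound with the fixed parameter 1 / sqrt v for either sign. The exponential
  tail that results suffices for chaining; the constant 4 is twice the bound 2 for exp
  (1/2).\<close>

lemma subgaussian_tail:
  fixes X :: "'a \<Rightarrow> real"
  assumes [measurable]: "X \<in> borel_measurable N" and "0 < v"
    and mgf: "\<And>\<mu>. (\<integral>\<^sup>+\<omega>. ennreal (exp (\<mu> * X \<omega>)) \<partial>N) \<le> ennreal (exp (\<mu>\<^sup>2 * v / 2))"
  shows "emeasure N {\<omega> \<in> space N. r < \<bar>X \<omega>\<bar>} \<le> ennreal (4 * exp (- r / sqrt v))"
proof -
  let ?l = "1 / sqrt v"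
  have one: "emeasure N {\<omega> \<in> space N. r < s * X \<omega>} \<le> ennreal (2 * exp (- r / sqrt v))" if s: "s\<^sup>2 = 1" for s
  proof -
    have "{\<omega> \<in> space N. r < s * X \<omega>} \<subseteq> {\<omega> \<in> space N. 1 \<le> ennreal (exp (- r / sqrt v)) * ennreal (exp ((s * ?l) * X \<omega>))}"
    proof safe
      fix \<omega> assume "r < s * X \<omega>"
      then have "r / sqrt v \<le> s * X \<omega> / sqrt v" using assms(2) by (intro divide_right_mono) auto
      then have "1 \<le> exp (- r / sqrt v) * exp ((s * ?l) * X \<omega>)"
        by (simp add: exp_add[symmetric])
      then show "1 \<le> ennreal (exp (- r / sqrt v)) * ennreal (exp ((s * ?l) * X \<omega>))"
        by (simp add: ennreal_mult'[symmetric] ennreal_ge_1)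
    qed
    then have "emeasure N {\<omega> \<in> space N. r < s * X \<omega>} \<le> emeasure N {\<omega> \<in> space N. 1 \<le> ennreal (exp (- r / sqrt v)) * ennreal (exp ((s * ?l) * X \<omega>))}"
      by (intro emeasure_mono) auto
    also have "\<dots> \<le> ennreal (exp (- r / sqrt v)) * (\<integral>\<^sup>+\<omega>. ennreal (exp ((s * ?l) * X \<omega>)) * indicator (space N) \<omega> \<partial>N)"
      by (rule nn_integral_Markov_inequality) auto
    also have "(\<integral>\<^sup>+\<omega>. ennreal (exp ((s * ?l) * X \<omega>)) * indicator (space N) \<omega> \<partial>N) = (\<integral>\<^sup>+\<omega>. ennreal (exp ((s * ?l) * X \<omega>)) \<partial>N)"
      by (intro nn_integral_cong) auto
    also have "\<dots> \<le> ennreal (exp ((s * ?l)\<^sup>2 * v / 2))" by (rule mgf)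
    also have "(s * ?l)\<^sup>2 * v / 2 = 1 / 2" using assms(2) s by (simp add: power_mult_distrib power_divide)
    also have "ennreal (exp (- r / sqrt v)) * ennreal (exp (1 / 2)) \<le> ennreal (exp (- r / sqrt v)) * ennreal 2"
    proof -
      have "exp (1 / 2 :: real) \<le> 2" using exp_bound_half[of "1/2 :: real"] by simp
      then show ?thesis by (intro mult_left_mono ennreal_leI) auto
    qed
    also have "\<dots> = ennreal (2 * exp (- r / sqrt v))" by (subst ennreal_mult'[symmetric]) (auto simp: mult.commute)
    finally show ?thesis by (simp add: mult_left_mono)
  qed
  have "{\<omega> \<in> space N. r < \<bar>X \<omega>\<bar>} = {\<omega> \<in> space N. r < 1 * X \<omega>} \<union> {\<omega> \<in> space N. r < (- 1) * X \<omega>}" by auto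
  then have "emeasure N {\<omega> \<in> space N. r < \<bar>X \<omega>\<bar>} \<le> emeasure N {\<omega> \<in> space N. r < 1 * X \<omega>} + emeasure N {\<omega> \<in> space N. r < (- 1) * X \<omega>}"
    by (simp only:) (rule emeasure_subadditive; measurable)
  also have "\<dots> \<le> ennreal (2 * exp (- r / sqrt v)) + ennreal (2 * exp (- r / sqrt v))"
    by (intro add_mono one) auto
  also have "\<dots> = ennreal (4 * exp (- r / sqrt v))" by (subst ennreal_plus[symmetric]) auto
  finally show ?thesis .
qed

text \<open>A single term of the exponential series bounds \<open>exp w\<close> from below.\<close>

lemma exp_minus_le_power:
  fixes w :: real assumes "0 < w" shows "exp (- w) \<le> fact n / w ^ n"
proof -
  have "(\<Sum>i\<in>{n}. w ^ i /\<^sub>R fact i) \<le> (\<Sum>i. w ^ i /\<^sub>R fact i)"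
    using assms by (intro sum_le_suminf summable_exp_generic) auto
  then have "w ^ n / fact n \<le> exp w" by (simp add: exp_def divide_inverse mult.commute)
  then show ?thesis using assms by (simp add: exp_minus field_simps)
qed

text \<open>
  Increments over a step \<open>2\<^sup>-\<^sup>k\<close> have standard deviation of order \<open>\<rho>\<^sup>2\<^sup>k\<close> and are compared with \<open>\<rho>\<^sup>k\<close>.  Since
  \<open>\<rho>\<^sup>4\<^sup>8 = 1/8\<close>, the 48th power of the ratio outweighs the \<open>4\<^sup>k\<close> pairs of neighbours.
\<close>

definition chain_ratio :: real where "chain_ratio = (1 / 2) powr (1 / 16)"

lemma chain_ratio: "0 < chain_ratio" "chain_ratio < 1" "chain_ratio ^ 48 = 1 / 8"
proof -
  show "0 < chain_ratio" by (simp add: chain_ratio_def)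
  show "chain_ratio < 1" unfolding chain_ratio_def using powr_less_mono2[of "1/16" "1/2" 1] by simp
  have "chain_ratio ^ 48 = (1 / 2) powr 3"
    unfolding chain_ratio_def by (simp add: powr_power)
  also have "\<dots> = 1 / 8" by (simp add: powr_numeral power3_eq_cube)
  finally show "chain_ratio ^ 48 = 1 / 8" .
qed

lemma chain_ratio_power2: "sqrt (C * (1 / 2 ^ k) powr (1 / 4)) = sqrt C * (chain_ratio ^ k)\<^sup>2"
proof -
  have "(1 / 2 ^ k :: real) = (1 / 2) powr real k" by (simp add: powr_realpow power_one_over)
  then have "((1 / 2 ^ k) powr (1 / 4)) powr (1 / 2) = (1 / 2 :: real) powr (real k / 8)"
    by (simp only: powr_powr) simp
  also have "\<dots> = (chain_ratio ^ k)\<^sup>2"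
    unfolding chain_ratio_def by (simp add: powr_power power_mult[symmetric])
  finally have "(chain_ratio ^ k)\<^sup>2 = ((1 / 2 ^ k) powr (1 / 4)) powr (1 / 2)" ..
  then show ?thesis by (simp add: real_sqrt_mult powr_half_sqrt)
qed

lemma of_int_le_grid: "a \<le> int m * 2 ^ k \<Longrightarrow> real_of_int a \<le> real m * 2 ^ k"
  using of_int_le_iff[of a "int m * 2 ^ k", where 'a=real] by simp

text \<open>The points are the dyadic points of the box [0, m] x [c - m, c + m]. The field comes as
  one random variable per point, without any regularity in the point, so a bound on a countable set
  is what defines a measurable event and what chaining can deliver.\<close>

definition grid_bound :: "(real \<Rightarrow> real \<Rightarrow> 'a \<Rightarrow> real) \<Rightarrow> nat \<Rightarrow> real \<Rightarrow> real \<Rightarrow> 'a \<Rightarrow> bool" where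
  "grid_bound Y m c K \<omega> \<longleftrightarrow> (\<forall>k :: nat. \<forall>j\<in>{0..int m * 2 ^ k}. \<forall>l\<in>{- (int m * 2 ^ k)..int m * 2 ^ k}.
     \<bar>Y (real_of_int j / 2 ^ k) (c + real_of_int l / 2 ^ k) \<omega>\<bar> \<le> K)"

text \<open>At most \<open>m\<close> unit steps in time lead away from the zero initial value; then
  every level of refinement costs one step in time and one in space, and the step sizes form a
  geometric series.\<close>

definition chain_const :: "nat \<Rightarrow> real" where "chain_const m = real m + 2 / (1 - chain_ratio)"

lemma grid_boundI:
  assumes zero: "\<And>x. Y 0 x \<omega> = 0" and a: "0 \<le> a"
    and t: "\<And>k j l. j \<in> {0..<int m * 2 ^ k} \<Longrightarrow> l \<in> {- (int m * 2 ^ k)..int m * 2 ^ k} \<Longrightarrow>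
      \<bar>Y (real_of_int (j + 1) / 2 ^ k) (c + real_of_int l / 2 ^ k) \<omega> - Y (real_of_int j / 2 ^ k) (c + real_of_int l / 2 ^ k) \<omega>\<bar> \<le> a * chain_ratio ^ k"
    and x: "\<And>k j l. j \<in> {0..int m * 2 ^ k} \<Longrightarrow> l \<in> {- (int m * 2 ^ k)..<int m * 2 ^ k} \<Longrightarrow>
      \<bar>Y (real_of_int j / 2 ^ k) (c + real_of_int (l + 1) / 2 ^ k) \<omega> - Y (real_of_int j / 2 ^ k) (c + real_of_int l / 2 ^ k) \<omega>\<bar> \<le> a * chain_ratio ^ k"
  shows "grid_bound Y m c (a * chain_const m) \<omega>"
proof -
  let ?Y = "\<lambda>k j l. Y (real_of_int j / 2 ^ k) (c + real_of_int l / 2 ^ k) \<omega>"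
  let ?S = "\<lambda>k. \<Sum>i\<le>k. chain_ratio ^ i"
  have main: "\<bar>?Y k j l\<bar> \<le> a * real m + 2 * a * ?S k"
    if "j \<in> {0..int m * 2 ^ k}" "l \<in> {- (int m * 2 ^ k)..int m * 2 ^ k}" for k :: nat and j l
    using that
  proof (induction k arbitrary: j l)
    case 0
    \<comment> \<open>On the coarsest grid the point is joined by unit time steps to time 0, where
      the field vanishes.\<close>
    have "n \<le> m \<Longrightarrow> \<bar>?Y 0 (int n) l\<bar> \<le> a * real n" for n
    proof (induction n)
      case 0 then show ?case using zero by simp
    next
      case (Suc n)
      have "\<bar>?Y 0 (int n + 1) l - ?Y 0 (int n) l\<bar> \<le> a * chain_ratio ^ 0"
        by (rule t) (use Suc.prems 0 in auto)
      moreover have "\<bar>?Y 0 (int n) l\<bar> \<le> a * real n" using Suc by simp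
      ultimately show ?case by (simp add: algebra_simps)
    qed
    from this[of "nat j"] have "\<bar>?Y 0 j l\<bar> \<le> a * real (nat j)" using 0 by (simp add: nat_le_iff)
    also have "\<dots> \<le> a * real m" using 0 a by (intro mult_left_mono) auto
    finally show ?case using a by simp
  next
    case (Suc k)
    \<comment> \<open>The parent on the coarser grid, at most one step in time and one step in space
      away.\<close>
    define j' l' where "j' = j div 2" and "l' = l div 2"
    have jl: "j = 2 * j' \<or> j = 2 * j' + 1" "l = 2 * l' \<or> l = 2 * l' + 1" by (auto simp: j'_def l'_def)
    define P where "P = int m * 2 ^ k"
    have P2: "int m * 2 ^ Suc k = 2 * P" by (simp add: P_def)
    have pr: "0 \<le> j" "j \<le> 2 * P" "- (2 * P) \<le> l" "l \<le> 2 * P" using Suc.prems unfolding P2 by auto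
    have r': "0 \<le> j'" "j' \<le> P" "- P \<le> l'" "l' \<le> P" using pr by (auto simp: j'_def l'_def)
    then have r: "j' \<in> {0..int m * 2 ^ k}" "l' \<in> {- (int m * 2 ^ k)..int m * 2 ^ k}"
      by (auto simp: P_def)
    have IH: "\<bar>?Y k j' l'\<bar> \<le> a * real m + 2 * a * ?S k" by (rule Suc.IH[OF r])
    have e: "?Y k j' l' = ?Y (Suc k) (2 * j') (2 * l')" by simp
    have \<rho>: "0 \<le> a * chain_ratio ^ Suc k" using a chain_ratio(1) by simp
    have 1: "\<bar>?Y (Suc k) j l - ?Y (Suc k) (2 * j') l\<bar> \<le> a * chain_ratio ^ Suc k"
      using jl(1)
    proof
      assume j: "j = 2 * j' + 1"
      show ?thesis unfolding j
      proof (rule t)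
        show "2 * j' \<in> {0..<int m * 2 ^ Suc k}" unfolding P2 using r' pr j by simp
      qed (use Suc.prems in simp)
    qed (use \<rho> in simp)
    have 2: "\<bar>?Y (Suc k) (2 * j') l - ?Y (Suc k) (2 * j') (2 * l')\<bar> \<le> a * chain_ratio ^ Suc k"
      using jl(2)
    proof
      assume l: "l = 2 * l' + 1"
      show ?thesis unfolding l
      proof (rule x)
        show "2 * j' \<in> {0..int m * 2 ^ Suc k}" unfolding P2 using r' by simp
        show "2 * l' \<in> {- (int m * 2 ^ Suc k)..<int m * 2 ^ Suc k}" unfolding P2 using r' pr l by simp
      qed
    qed (use \<rho> in simp)
    have "\<bar>?Y (Suc k) j l\<bar> \<le> a * real m + 2 * a * ?S k + 2 * (a * chain_ratio ^ Suc k)"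
      using IH 1 2 unfolding e by linarith
    then show ?case by (simp add: algebra_simps)
  qed
  have "?S k \<le> 1 / (1 - chain_ratio)" for k
    using sum_le_suminf[of "\<lambda>i. chain_ratio ^ i" "{..k}"] suminf_geometric[of chain_ratio] chain_ratio
    by (simp add: summable_geometric)
  then have "a * real m + 2 * a * ?S k \<le> a * real m + 2 * a * (1 / (1 - chain_ratio))" for k
    using a by (intro add_left_mono mult_left_mono) auto
  also have "a * real m + 2 * a * (1 / (1 - chain_ratio)) = a * chain_const m"
    by (simp add: chain_const_def algebra_simps)
  finally show ?thesis unfolding grid_bound_def using main by (meson order_trans)
qed

text \<open>The union bound summed over all levels. It does not involve the centre \<open>c\<close>
  and decays like the 48th power of 1/\<open>a\<close>.\<close>

definition chain_err :: "real \<Rightarrow> nat \<Rightarrow> real \<Rightarrow> real" where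
  "chain_err C m a = 96 * (real m)\<^sup>2 * fact 48 * (sqrt C / a) ^ 48"

lemma chain_err_small:
  assumes "0 < \<epsilon>" shows "\<exists>a>0. chain_err C m a \<le> \<epsilon>"
proof -
  have "((\<lambda>a. chain_err C m a) \<longlongrightarrow> 96 * (real m)\<^sup>2 * fact 48 * 0 ^ 48) at_top"
    unfolding chain_err_def by (intro tendsto_intros tendsto_divide_0[OF tendsto_const] filterlim_at_top_imp_at_infinity filterlim_ident)
  then have "((\<lambda>a. chain_err C m a) \<longlongrightarrow> 0) at_top" by simp
  then have "\<forall>\<^sub>F a in at_top. chain_err C m a < \<epsilon>" using assms by (rule order_tendstoD(2))
  then have "\<forall>\<^sub>F a in at_top. chain_err C m a < \<epsilon> \<and> 0 < a" using eventually_gt_at_top by (rule eventually_conj)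
  then obtain a where "chain_err C m a < \<epsilon> \<and> 0 < a" using eventually_happens by force
  then show ?thesis by (intro exI[of _ a]) auto
qed

lemma grid_bound_measurable:
  assumes Y: "\<And>t x. Y t x \<in> borel_measurable N"
  shows "{\<omega> \<in> space N. grid_bound Y m c K \<omega>} \<in> sets N"
  unfolding grid_bound_def
proof (intro sets.sets_Collect_countable_All sets.sets_Collect_finite_All)
  fix k j l
  have [measurable]: "Y (real_of_int j / 2 ^ k) (c + real_of_int l / 2 ^ k) \<in> borel_measurable N" by (rule Y)
  show "{\<omega> \<in> space N. \<bar>Y (real_of_int j / 2 ^ k) (c + real_of_int l / 2 ^ k) \<omega>\<bar> \<le> K} \<in> sets N" by measurable
qed auto

text \<open>By the tail bound and the 48th power estimate, each neighbouring pair at level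
  \<open>k\<close> violates its bound on a set of measure of order 8^(-k). There are of order 4^k
  such pairs, so the measures of the exceptional sets are summable over the levels.\<close>

theorem chaining:
  assumes Y: "\<And>t x. Y t x \<in> borel_measurable N"
    and zero: "\<And>x \<omega>. Y 0 x \<omega> = 0" and C: "0 < C" and m: "1 \<le> m" and a: "0 < a"
    and time: "\<And>t t' x \<mu>. 0 \<le> t \<Longrightarrow> t < t' \<Longrightarrow> t' \<le> real m \<Longrightarrow>
      (\<integral>\<^sup>+\<omega>. ennreal (exp (\<mu> * (Y t' x \<omega> - Y t x \<omega>))) \<partial>N) \<le> ennreal (exp (\<mu>\<^sup>2 * (C * (t' - t) powr (1 / 4)) / 2))"
    and space: "\<And>t x x' \<mu>. 0 \<le> t \<Longrightarrow> t \<le> real m \<Longrightarrow> x < x' \<Longrightarrow> x' \<le> x + 1 \<Longrightarrow>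
      (\<integral>\<^sup>+\<omega>. ennreal (exp (\<mu> * (Y t x' \<omega> - Y t x \<omega>))) \<partial>N) \<le> ennreal (exp (\<mu>\<^sup>2 * (C * (x' - x) powr (1 / 4)) / 2))"
  shows "emeasure N {\<omega> \<in> space N. \<not> grid_bound Y m c (a * chain_const m) \<omega>} \<le> ennreal (chain_err C m a)"
proof -
  define T where "T k p = {\<omega> \<in> space N. a * chain_ratio ^ k < \<bar>Y (real_of_int (fst p + 1) / 2 ^ k) (c + real_of_int (snd p) / 2 ^ k) \<omega> - Y (real_of_int (fst p) / 2 ^ k) (c + real_of_int (snd p) / 2 ^ k) \<omega>\<bar>}" for k :: nat and p :: "int \<times> int"
  define X where "X k p = {\<omega> \<in> space N. a * chain_ratio ^ k < \<bar>Y (real_of_int (fst p) / 2 ^ k) (c + real_of_int (snd p + 1) / 2 ^ k) \<omega> - Y (real_of_int (fst p) / 2 ^ k) (c + real_of_int (snd p) / 2 ^ k) \<omega>\<bar>}" for k :: nat and p :: "int \<times> int"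
  define I where "I k = {0..<int m * 2 ^ k} \<times> {- (int m * 2 ^ k)..int m * 2 ^ k}" for k :: nat
  define J where "J k = {0..int m * 2 ^ k} \<times> {- (int m * 2 ^ k)..<int m * 2 ^ k}" for k :: nat
  define e where "e k = fact 48 * (sqrt C / a) ^ 48 * (1 / 8) ^ k" for k :: nat
  note [measurable] = Y
  have sets[measurable]: "T k p \<in> sets N" "X k p \<in> sets N" for k p
    unfolding T_def X_def by measurable
  have tail: "ennreal (4 * exp (- (a * chain_ratio ^ k) / sqrt (C * (1 / 2 ^ k) powr (1 / 4)))) \<le> ennreal (4 * e k)" for k
  proof (rule ennreal_leI, rule mult_left_mono)
    let ?w = "a / (sqrt C * chain_ratio ^ k)"
    have "(a * chain_ratio ^ k) / sqrt (C * (1 / 2 ^ k) powr (1 / 4)) = ?w"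
      unfolding chain_ratio_power2 using chain_ratio(1) by (simp add: power2_eq_square)
    then have "exp (- (a * chain_ratio ^ k) / sqrt (C * (1 / 2 ^ k) powr (1 / 4))) = exp (- ?w)" by simp
    also have "\<dots> \<le> fact 48 / ?w ^ 48"
      using a C chain_ratio by (intro exp_minus_le_power) auto
    also have "\<dots> = fact 48 * (sqrt C / a) ^ 48 * (chain_ratio ^ 48) ^ k"
      by (simp add: power_divide power_mult_distrib power_mult[symmetric] mult.commute)
    finally show "exp (- (a * chain_ratio ^ k) / sqrt (C * (1 / 2 ^ k) powr (1 / 4))) \<le> e k"
      by (simp add: e_def chain_ratio)
  qed simp
  have Tle: "emeasure N (T k p) \<le> ennreal (4 * e k)" if p: "p \<in> I k" for k p
  proof -
    have "emeasure N (T k p) \<le> ennreal (4 * exp (- (a * chain_ratio ^ k) / sqrt (C * (1 / 2 ^ k) powr (1 / 4))))"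
      unfolding T_def
    proof (rule subgaussian_tail)
      fix \<mu>
      let ?t = "real_of_int (fst p) / 2 ^ k" and ?t' = "real_of_int (fst p + 1) / 2 ^ k"
      have d: "?t' - ?t = 1 / 2 ^ k" by (simp add: diff_divide_distrib[symmetric])
      have "fst p + 1 \<le> int m * 2 ^ k" using p by (auto simp: I_def)
      then have "real_of_int (fst p + 1) \<le> real m * 2 ^ k" by (rule of_int_le_grid)
      then have "?t' \<le> real m" by (simp add: divide_le_eq)
      then show "(\<integral>\<^sup>+\<omega>. ennreal (exp (\<mu> * (Y ?t' (c + real_of_int (snd p) / 2 ^ k) \<omega> - Y ?t (c + real_of_int (snd p) / 2 ^ k) \<omega>))) \<partial>N)
         \<le> ennreal (exp (\<mu>\<^sup>2 * (C * (1 / 2 ^ k) powr (1 / 4)) / 2))"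
        unfolding d[symmetric] using p by (intro time) (auto simp: I_def divide_strict_right_mono)
    qed (use C in auto)
    also have "\<dots> \<le> ennreal (4 * e k)" by (rule tail)
    finally show ?thesis .
  qed
  have Xle: "emeasure N (X k p) \<le> ennreal (4 * e k)" if p: "p \<in> J k" for k p
  proof -
    have "emeasure N (X k p) \<le> ennreal (4 * exp (- (a * chain_ratio ^ k) / sqrt (C * (1 / 2 ^ k) powr (1 / 4))))"
      unfolding X_def
    proof (rule subgaussian_tail)
      fix \<mu>
      let ?x = "c + real_of_int (snd p) / 2 ^ k" and ?x' = "c + real_of_int (snd p + 1) / 2 ^ k"
      have d: "?x' - ?x = 1 / 2 ^ k" by (simp add: diff_divide_distrib[symmetric])
      have "fst p \<le> int m * 2 ^ k" using p by (auto simp: J_def)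
      then have "real_of_int (fst p) \<le> real m * 2 ^ k" by (rule of_int_le_grid)
      then have "real_of_int (fst p) / 2 ^ k \<le> real m" by (simp add: divide_le_eq)
      moreover have "?x' \<le> ?x + 1"
      proof -
        have "1 / 2 ^ k \<le> (1 :: real)" by simp
        then show ?thesis using d by linarith
      qed
      ultimately show "(\<integral>\<^sup>+\<omega>. ennreal (exp (\<mu> * (Y (real_of_int (fst p) / 2 ^ k) ?x' \<omega> - Y (real_of_int (fst p) / 2 ^ k) ?x \<omega>))) \<partial>N)
         \<le> ennreal (exp (\<mu>\<^sup>2 * (C * (1 / 2 ^ k) powr (1 / 4)) / 2))"
        unfolding d[symmetric] using p by (intro space) (auto simp: J_def divide_strict_right_mono)
    qed (use C in auto)
    also have "\<dots> \<le> ennreal (4 * e k)" by (rule tail)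
    finally show ?thesis .
  qed
  have e0: "0 \<le> e k" for k using C a by (simp add: e_def)
  have fin: "finite (I k)" "finite (J k)" for k by (auto simp: I_def J_def)
  have card: "real (card (I k)) \<le> 3 * (real m)\<^sup>2 * 4 ^ k" "real (card (J k)) \<le> 4 * (real m)\<^sup>2 * 4 ^ k" for k
  proof -
    define q where "q = real m * 2 ^ k"
    have q: "1 \<le> q" using m mult_mono[of 1 "real m" 1 "2 ^ k"] by (simp add: q_def)
    have qq: "q * q = (real m)\<^sup>2 * 4 ^ k" by (simp add: q_def power2_eq_square power_mult_distrib[symmetric])
    have n: "real (nat (int m * 2 ^ k)) = q" "real (nat (int m * 2 ^ k + 1)) = q + 1" "real (nat (int m * 2 ^ k + 1 + int m * 2 ^ k)) = 2 * q + 1" "real (nat (int m * 2 ^ k + int m * 2 ^ k)) = 2 * q"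
      by (simp_all add: q_def nat_add_distrib nat_mult_distrib nat_power_eq)
    have "real (card (I k)) = q * (2 * q + 1)"
      unfolding I_def card_cartesian_product by (simp add: n[unfolded q_def] q_def)
    also have "\<dots> \<le> 3 * (q * q)" using q by (simp add: algebra_simps)
    finally show "real (card (I k)) \<le> 3 * (real m)\<^sup>2 * 4 ^ k" by (simp add: qq)
    have "real (card (J k)) = (q + 1) * (2 * q)"
      unfolding J_def card_cartesian_product by (simp add: n[unfolded q_def] q_def)
    also have "\<dots> \<le> 4 * (q * q)" using q by (simp add: algebra_simps)
    finally show "real (card (J k)) \<le> 4 * (real m)\<^sup>2 * 4 ^ k" by (simp add: qq)
  qed
  define B where "B k = (\<Union>p\<in>I k. T k p) \<union> (\<Union>p\<in>J k. X k p)" for k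
  have Bs: "B k \<in> sets N" for k unfolding B_def using fin by auto
  have Ble: "emeasure N (B k) \<le> ennreal (48 * (real m)\<^sup>2 * fact 48 * (sqrt C / a) ^ 48 * (1 / 2) ^ k)" for k
  proof -
    have "emeasure N (B k) \<le> emeasure N (\<Union>p\<in>I k. T k p) + emeasure N (\<Union>p\<in>J k. X k p)"
      unfolding B_def by (rule emeasure_subadditive) (use fin in auto)
    also have "\<dots> \<le> (\<Sum>p\<in>I k. emeasure N (T k p)) + (\<Sum>p\<in>J k. emeasure N (X k p))"
      by (intro add_mono emeasure_subadditive_finite) (use fin in auto)
    also have "\<dots> \<le> (\<Sum>p\<in>I k. ennreal (4 * e k)) + (\<Sum>p\<in>J k. ennreal (4 * e k))"
      by (intro add_mono sum_mono Tle Xle)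
    also have "\<dots> = ennreal (real (card (I k)) * (4 * e k) + real (card (J k)) * (4 * e k))"
      using e0 by (simp add: ennreal_mult ennreal_plus ennreal_of_nat_eq_real_of_nat)
    \<comment> \<open>The factor 7 = 3 + 4 from the two counts is rounded up to 12. With the 4 of
      the tail bound this gives 48, which the geometric sum over the levels doubles to the 96 in
      \<open>chain_err\<close>.\<close>
    also have "\<dots> \<le> ennreal (12 * (real m)\<^sup>2 * 4 ^ k * (4 * e k))"
    proof (rule ennreal_leI)
      have "real (card (I k)) * (4 * e k) + real (card (J k)) * (4 * e k) \<le> (3 * (real m)\<^sup>2 * 4 ^ k) * (4 * e k) + (4 * (real m)\<^sup>2 * 4 ^ k) * (4 * e k)"
        using card e0 by (intro add_mono mult_right_mono) auto
      also have "\<dots> = 7 * ((real m)\<^sup>2 * 4 ^ k * (4 * e k))" by simp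
      also have "\<dots> \<le> 12 * ((real m)\<^sup>2 * 4 ^ k * (4 * e k))" using e0 by (intro mult_right_mono) auto
      finally show "real (card (I k)) * (4 * e k) + real (card (J k)) * (4 * e k) \<le> 12 * (real m)\<^sup>2 * 4 ^ k * (4 * e k)"
        by (simp add: mult.assoc)
    qed
    also have "12 * (real m)\<^sup>2 * 4 ^ k * (4 * e k) = 48 * (real m)\<^sup>2 * fact 48 * (sqrt C / a) ^ 48 * (4 ^ k * (1 / 8) ^ k)"
      by (simp add: e_def)
    also have "(4 :: real) ^ k * (1 / 8) ^ k = (1 / 2) ^ k" by (simp add: power_mult_distrib[symmetric])
    finally show ?thesis .
  qed
  have "{\<omega> \<in> space N. \<not> grid_bound Y m c (a * chain_const m) \<omega>} \<subseteq> (\<Union>k. B k)"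
  proof (rule subsetI, rule ccontr)
    fix \<omega> assume \<omega>: "\<omega> \<in> {\<omega> \<in> space N. \<not> grid_bound Y m c (a * chain_const m) \<omega>}" and n: "\<omega> \<notin> (\<Union>k. B k)"
    have "grid_bound Y m c (a * chain_const m) \<omega>"
    proof (rule grid_boundI)
      fix k j l assume "j \<in> {0..<int m * 2 ^ k}" "l \<in> {- (int m * 2 ^ k)..int m * 2 ^ k}"
      then have "(j, l) \<in> I k" by (simp add: I_def)
      then have "\<omega> \<notin> T k (j, l)" using n by (auto simp: B_def)
      then show "\<bar>Y (real_of_int (j + 1) / 2 ^ k) (c + real_of_int l / 2 ^ k) \<omega> - Y (real_of_int j / 2 ^ k) (c + real_of_int l / 2 ^ k) \<omega>\<bar> \<le> a * chain_ratio ^ k"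
        using \<omega> by (simp add: T_def)
    next
      fix k j l assume "j \<in> {0..int m * 2 ^ k}" "l \<in> {- (int m * 2 ^ k)..<int m * 2 ^ k}"
      then have "(j, l) \<in> J k" by (simp add: J_def)
      then have "\<omega> \<notin> X k (j, l)" using n by (auto simp: B_def)
      then show "\<bar>Y (real_of_int j / 2 ^ k) (c + real_of_int (l + 1) / 2 ^ k) \<omega> - Y (real_of_int j / 2 ^ k) (c + real_of_int l / 2 ^ k) \<omega>\<bar> \<le> a * chain_ratio ^ k"
        using \<omega> by (simp add: X_def)
    qed (use zero a in auto)
    then show False using \<omega> by simp
  qed
  then have "emeasure N {\<omega> \<in> space N. \<not> grid_bound Y m c (a * chain_const m) \<omega>} \<le> emeasure N (\<Union>k. B k)"
    using Bs by (intro emeasure_mono) auto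
  also have "\<dots> \<le> (\<Sum>k. emeasure N (B k))"
    using Bs by (intro emeasure_subadditive_countably) auto
  also have "\<dots> \<le> (\<Sum>k. ennreal (48 * (real m)\<^sup>2 * fact 48 * (sqrt C / a) ^ 48 * (1 / 2) ^ k))"
    by (intro suminf_le Ble) auto
  also have "\<dots> = ennreal (\<Sum>k. 48 * (real m)\<^sup>2 * fact 48 * (sqrt C / a) ^ 48 * (1 / 2) ^ k)"
    using C a by (intro suminf_ennreal2) (auto intro!: summable_mult summable_geometric)
  also have "(\<Sum>k. 48 * (real m)\<^sup>2 * fact 48 * (sqrt C / a) ^ 48 * (1 / 2) ^ k) = chain_err C m a"
    using suminf_geometric[of "1/2 :: real"] unfolding chain_err_def
    by (subst suminf_mult) (auto intro: summable_geometric)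
  finally show ?thesis .
qed

section \<open>The stochastic convolution under the tilted measures\<close>

definition conv_integrand :: "(real \<Rightarrow> real) \<Rightarrow> (real \<Rightarrow> real \<Rightarrow> 'a \<Rightarrow> real) \<Rightarrow> real \<Rightarrow> real \<Rightarrow> real \<Rightarrow> real \<Rightarrow> 'a \<Rightarrow> real" where
  "conv_integrand \<sigma> u t x s y \<omega> = indicat_real {0<..<t} s * (heat_kernel (t - s) (y - x) * \<sigma> (u s y \<omega>))"

lemma slice_conv_integrand:
  "slice (conv_integrand \<sigma> u t x) \<omega> z = kern t x z * \<sigma> (u (fst z) (snd z) \<omega>)"
  by (auto simp: slice_def conv_integrand_def kern_def indicator_def)

context noise_space
begin

lemma slice_indicator:
  "slice (\<lambda>s y \<omega>. indicat_real ({0<..t} \<times> A) (s, y)) \<omega> = indicat_real ({0<..t} \<times> A)"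
  by (auto simp: slice_def indicator_def fun_eq_iff)

text \<open>Under the density of the drift \<open>h\<close> on \<open>R\<close>, the stochastic
  convolution acquires the subtracted term as a drift. What remains obeys the exponential bounds
  that the convolution obeys under the original law.\<close>

definition shifted :: "(real \<Rightarrow> real) \<Rightarrow> (real \<Rightarrow> real \<Rightarrow> 'a \<Rightarrow> real) \<Rightarrow> (real \<Rightarrow> real \<Rightarrow> 'a \<Rightarrow> real) \<Rightarrow> real \<Rightarrow> (real \<times> real) set
    \<Rightarrow> real \<Rightarrow> real \<Rightarrow> 'a \<Rightarrow> real" where
  "shifted \<sigma> u I h R t x \<omega> = I t x \<omega> - h * ip (slice (conv_integrand \<sigma> u t x) \<omega>) (indicat_real R)"

context
  fixes \<sigma> :: "real \<Rightarrow> real" and u I :: "real \<Rightarrow> real \<Rightarrow> 'a \<Rightarrow> real" and \<sigma>\<^sub>2 :: real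
  assumes walsh: "\<And>t x. has_walsh_integral M W (conv_integrand \<sigma> u t x) (I t x)"
    and I0: "\<And>x \<omega>. I 0 x \<omega> = 0"
    and \<sigma>2: "\<And>y. \<bar>\<sigma> y\<bar> \<le> \<sigma>\<^sub>2" "0 < \<sigma>\<^sub>2"
begin

lemma shifted_measurable:
  assumes R: "R = {0<..t\<^sub>0} \<times> A" "0 \<le> t\<^sub>0" "A \<in> sets borel" "emeasure lborel A < \<infinity>"
  shows "shifted \<sigma> u I h R t x \<in> borel_measurable M"
proof -
  have p: "predictable M W (conv_integrand \<sigma> u t x)" and [measurable]: "I t x \<in> borel_measurable M"
    using walsh[of t x] by (auto simp: has_walsh_integral_def)
  have r: "predictable M W (\<lambda>s y \<omega>. indicat_real R (s, y))"
    using has_walsh_integral_indicator[OF R(2,3,4)] by (auto simp: has_walsh_integral_def R(1))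
  have "(\<lambda>\<omega>. ip (slice (conv_integrand \<sigma> u t x) \<omega>) (indicat_real R)) \<in> borel_measurable M"
    using slice_mult_joint[OF p r] unfolding R(1) slice_indicator .
  then show ?thesis unfolding shifted_def[abs_def] by measurable
qed

lemma shifted_zero: "shifted \<sigma> u I h R 0 x \<omega> = 0"
  by (simp add: shifted_def I0 slice_conv_integrand kern_def)

text \<open>By linearity the increment belongs to a single Walsh integral whose integrand is
  \<open>\<mu>\<close> times a difference of kernels times \<open>\<sigma>\<close> of the field.
  Since \<open>\<sigma>\<close> is bounded, its quadratic variation is bounded by a constant,
  whatever the field \<open>u\<close> is.\<close>

lemma shifted_increment:
  assumes R: "R = {0<..t\<^sub>0} \<times> A" "0 \<le> t\<^sub>0" "A \<in> sets borel" "emeasure lborel A < \<infinity>"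
    and v: "(\<integral>\<^sup>+z. ennreal ((kern t x z - kern t' x' z)\<^sup>2) \<partial>lborel) \<le> ennreal v" "0 \<le> v"
  shows "(\<integral>\<^sup>+\<omega>. ennreal (exp (\<mu> * (shifted \<sigma> u I h R t' x' \<omega> - shifted \<sigma> u I h R t x \<omega>))) \<partial>density M (\<lambda>\<omega>. ennreal (dens (\<lambda>z. h * indicat_real R z) \<omega>)))
    \<le> ennreal (exp (\<mu>\<^sup>2 * (\<sigma>\<^sub>2\<^sup>2 * v) / 2))"
proof -
  let ?\<eta> = "\<lambda>z. h * indicat_real R z"
  let ?g = "\<lambda>t x. slice (conv_integrand \<sigma> u t x)"
  let ?f = "\<lambda>s y \<omega>. \<mu> * conv_integrand \<sigma> u t' x' s y \<omega> + (- \<mu>) * conv_integrand \<sigma> u t x s y \<omega>"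
  let ?J = "\<lambda>\<omega>. \<mu> * I t' x' \<omega> + (- \<mu>) * I t x \<omega>"
  have L: "indicat_real R \<in> L2_halfplane" unfolding R(1) using R by (intro L2_halfplane_indicator) auto
  have L\<eta>: "?\<eta> \<in> L2_halfplane" by (rule L2_halfplane_scale[OF L])
  note [measurable] = dens_measurable[OF L\<eta>] shifted_measurable[OF R]
  have w: "has_walsh_integral M W ?f ?J" by (intro has_walsh_integral_lincomb walsh)
  have sl: "slice ?f \<omega> z = \<mu> * ?g t' x' \<omega> z + (- \<mu>) * ?g t x \<omega> z" for \<omega> z by (rule slice_lincomb)
  have bd: "AE \<omega> in M. ip (slice ?f \<omega>) (slice ?f \<omega>) \<le> \<mu>\<^sup>2 * (\<sigma>\<^sub>2\<^sup>2 * v)"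
  proof (rule AE_I2)
    fix \<omega>
    show "ip (slice ?f \<omega>) (slice ?f \<omega>) \<le> \<mu>\<^sup>2 * (\<sigma>\<^sub>2\<^sup>2 * v)"
    proof (rule integral_real_bounded)
      have "(\<integral>\<^sup>+z. ennreal (slice ?f \<omega> z * slice ?f \<omega> z) \<partial>lborel)
        \<le> (\<integral>\<^sup>+z. ennreal (\<mu>\<^sup>2 * \<sigma>\<^sub>2\<^sup>2) * ennreal ((kern t x z - kern t' x' z)\<^sup>2) \<partial>lborel)"
      proof (rule nn_integral_mono)
        fix z
        let ?s = "\<sigma> (u (fst z) (snd z) \<omega>)"
        have "?s\<^sup>2 \<le> \<sigma>\<^sub>2\<^sup>2" using \<sigma>2 by (metis abs_le_square_iff abs_of_pos)
        then have "\<mu>\<^sup>2 * (kern t x z - kern t' x' z)\<^sup>2 * ?s\<^sup>2 \<le> \<mu>\<^sup>2 * (kern t x z - kern t' x' z)\<^sup>2 * \<sigma>\<^sub>2\<^sup>2"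
          by (intro mult_left_mono) auto
        moreover have "slice ?f \<omega> z * slice ?f \<omega> z = \<mu>\<^sup>2 * (kern t x z - kern t' x' z)\<^sup>2 * ?s\<^sup>2"
          unfolding sl slice_conv_integrand by (simp add: power2_eq_square algebra_simps)
        ultimately show "ennreal (slice ?f \<omega> z * slice ?f \<omega> z) \<le> ennreal (\<mu>\<^sup>2 * \<sigma>\<^sub>2\<^sup>2) * ennreal ((kern t x z - kern t' x' z)\<^sup>2)"
          by (simp add: ennreal_mult'[symmetric] ennreal_leI algebra_simps)
      qed
      also have "\<dots> = ennreal (\<mu>\<^sup>2 * \<sigma>\<^sub>2\<^sup>2) * (\<integral>\<^sup>+z. ennreal ((kern t x z - kern t' x' z)\<^sup>2) \<partial>lborel)"
        by (rule nn_integral_cmult) measurable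
      also have "\<dots> \<le> ennreal (\<mu>\<^sup>2 * \<sigma>\<^sub>2\<^sup>2) * ennreal v" by (intro mult_left_mono v) auto
      finally show "(\<integral>\<^sup>+z. ennreal (slice ?f \<omega> z * slice ?f \<omega> z) \<partial>lborel) \<le> ennreal (\<mu>\<^sup>2 * (\<sigma>\<^sub>2\<^sup>2 * v))"
        by (simp add: ennreal_mult'[symmetric] mult.assoc)
    qed (use v in auto)
  qed
  have "(\<integral>\<^sup>+\<omega>. ennreal (exp (\<mu> * (shifted \<sigma> u I h R t' x' \<omega> - shifted \<sigma> u I h R t x \<omega>))) \<partial>density M (\<lambda>\<omega>. ennreal (dens ?\<eta> \<omega>)))
    = (\<integral>\<^sup>+\<omega>. ennreal (dens ?\<eta> \<omega>) * ennreal (exp (\<mu> * (shifted \<sigma> u I h R t' x' \<omega> - shifted \<sigma> u I h R t x \<omega>))) \<partial>M)"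
    by (rule nn_integral_density) auto
  also have "\<dots> = (\<integral>\<^sup>+\<omega>. ennreal (dens ?\<eta> \<omega> * exp (?J \<omega> - h * ip (slice ?f \<omega>) (indicat_real R))) \<partial>M)"
  proof (rule nn_integral_cong_AE, use walsh_exp(1)[OF walsh[of t x]] walsh_exp(1)[OF walsh[of t' x']] in eventually_elim)
    case (elim \<omega>)
    have "ip (slice ?f \<omega>) (indicat_real R) = (\<integral>z. \<mu> * (?g t' x' \<omega> z * indicat_real R z) - \<mu> * (?g t x \<omega> z * indicat_real R z) \<partial>lborel)"
      unfolding sl by (intro Bochner_Integration.integral_cong) (auto simp: algebra_simps)
    also have "\<dots> = \<mu> * ip (?g t' x' \<omega>) (indicat_real R) - \<mu> * ip (?g t x \<omega>) (indicat_real R)"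
      using integrable_ip[OF elim(1) L] integrable_ip[OF elim(2) L] by simp
    finally have e: "\<mu> * (shifted \<sigma> u I h R t' x' \<omega> - shifted \<sigma> u I h R t x \<omega>) = ?J \<omega> - h * ip (slice ?f \<omega>) (indicat_real R)"
      by (simp only: shifted_def) (simp add: algebra_simps)
    show ?case unfolding e by (simp add: ennreal_mult'' dens_pos)
  qed
  also have "\<dots> \<le> ennreal (exp (\<mu>\<^sup>2 * (\<sigma>\<^sub>2\<^sup>2 * v) / 2))"
    by (rule walsh_exp_tilted[OF w R bd])
  finally show ?thesis .
qed

text \<open>The right side contains neither \<open>h\<close> nor \<open>R\<close> nor the field
  \<open>u\<close>. One fluctuation level \<open>a\<close> thus serves all tilts, and
  \<open>h\<close> may be chosen depending on it.\<close>

lemma shifted_grid_bound: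
  assumes R: "R = {0<..t\<^sub>0} \<times> A" "0 \<le> t\<^sub>0" "A \<in> sets borel" "emeasure lborel A < \<infinity>"
    and m: "1 \<le> m" and a: "0 < a"
  shows "emeasure (density M (\<lambda>\<omega>. ennreal (dens (\<lambda>z. h * indicat_real R z) \<omega>)))
      {\<omega> \<in> space M. \<not> grid_bound (shifted \<sigma> u I h R) m c (a * chain_const m) \<omega>} \<le> ennreal (chain_err (8 * \<sigma>\<^sub>2\<^sup>2 * real m) m a)"
proof -
  let ?N = "density M (\<lambda>\<omega>. ennreal (dens (\<lambda>z. h * indicat_real R z) \<omega>))"
  have pm: "t powr (1/4) \<le> real m" if "0 \<le> t" "t \<le> real m" for t
  proof -
    have "t powr (1/4) \<le> real m powr (1/4)" using that by (intro powr_mono2) auto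
    also have "\<dots> \<le> real m powr 1" using m by (intro powr_mono) auto
    finally show ?thesis using m by simp
  qed
  have "emeasure ?N {\<omega> \<in> space ?N. \<not> grid_bound (shifted \<sigma> u I h R) m c (a * chain_const m) \<omega>} \<le> ennreal (chain_err (8 * \<sigma>\<^sub>2\<^sup>2 * real m) m a)"
  proof (rule chaining[where Y="shifted \<sigma> u I h R"])
    show "1 \<le> m" "0 < a" by fact+
    show "shifted \<sigma> u I h R 0 x \<omega> = 0" for x \<omega> by (rule shifted_zero)
    show "shifted \<sigma> u I h R t x \<in> borel_measurable ?N" for t x
      using shifted_measurable[OF R] by simp
    show "0 < 8 * \<sigma>\<^sub>2\<^sup>2 * real m" using \<sigma>2 m by simp
  next
    fix t t' x \<mu> :: real assume t: "0 \<le> t" "t < t'" "t' \<le> real m"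
    have "(\<integral>\<^sup>+\<omega>. ennreal (exp (\<mu> * (shifted \<sigma> u I h R t' x \<omega> - shifted \<sigma> u I h R t x \<omega>))) \<partial>?N)
      \<le> ennreal (exp (\<mu>\<^sup>2 * (\<sigma>\<^sub>2\<^sup>2 * ((t' - t) powr (1/4) * (8 * t' powr (1/4)))) / 2))"
      by (rule shifted_increment[OF R kern_time_increment]) (use t in auto)
    also have "\<dots> \<le> ennreal (exp (\<mu>\<^sup>2 * (8 * \<sigma>\<^sub>2\<^sup>2 * real m * (t' - t) powr (1/4)) / 2))"
    proof -
      have "\<mu>\<^sup>2 * \<sigma>\<^sub>2\<^sup>2 * (t' - t) powr (1/4) * 8 * t' powr (1/4) \<le> \<mu>\<^sup>2 * \<sigma>\<^sub>2\<^sup>2 * (t' - t) powr (1/4) * 8 * real m"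
        using pm[of t'] t by (intro mult_left_mono) auto
      then show ?thesis by (intro ennreal_leI) (simp add: algebra_simps)
    qed
    finally show "(\<integral>\<^sup>+\<omega>. ennreal (exp (\<mu> * (shifted \<sigma> u I h R t' x \<omega> - shifted \<sigma> u I h R t x \<omega>))) \<partial>?N)
      \<le> ennreal (exp (\<mu>\<^sup>2 * (8 * \<sigma>\<^sub>2\<^sup>2 * real m * (t' - t) powr (1/4)) / 2))" .
  next
    fix t x x' \<mu> :: real assume t: "0 \<le> t" "t \<le> real m" "x < x'" "x' \<le> x + 1"
    have "(\<integral>\<^sup>+\<omega>. ennreal (exp (\<mu> * (shifted \<sigma> u I h R t x' \<omega> - shifted \<sigma> u I h R t x \<omega>))) \<partial>?N)
      \<le> ennreal (exp (\<mu>\<^sup>2 * (\<sigma>\<^sub>2\<^sup>2 * (\<bar>x - x'\<bar> powr (1/2) * (4 * t powr (1/4)))) / 2))"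
      by (rule shifted_increment[OF R kern_space_increment]) (use t in auto)
    also have "\<dots> \<le> ennreal (exp (\<mu>\<^sup>2 * (8 * \<sigma>\<^sub>2\<^sup>2 * real m * (x' - x) powr (1/4)) / 2))"
    proof -
      \<comment> \<open>The spatial increment is at most 1, so its exponent 1/2 may be lowered to
        the 1/4 that the chaining uses in both directions.\<close>
      have "\<bar>x - x'\<bar> powr (1/2) \<le> (x' - x) powr (1/4)"
        using t powr_mono'[of "1/4" "1/2" "x' - x"] by simp
      then have "\<bar>x - x'\<bar> powr (1/2) * (4 * t powr (1/4)) \<le> (x' - x) powr (1/4) * (8 * real m)"
        using pm[of t] t by (intro mult_mono) auto
      then have "\<mu>\<^sup>2 * \<sigma>\<^sub>2\<^sup>2 * (\<bar>x - x'\<bar> powr (1/2) * (4 * t powr (1/4))) \<le> \<mu>\<^sup>2 * \<sigma>\<^sub>2\<^sup>2 * ((x' - x) powr (1/4) * (8 * real m))"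
        by (intro mult_left_mono) auto
      then show ?thesis by (intro ennreal_leI) (simp add: algebra_simps)
    qed
    finally show "(\<integral>\<^sup>+\<omega>. ennreal (exp (\<mu> * (shifted \<sigma> u I h R t x' \<omega> - shifted \<sigma> u I h R t x \<omega>))) \<partial>?N)
      \<le> ennreal (exp (\<mu>\<^sup>2 * (8 * \<sigma>\<^sub>2\<^sup>2 * real m * (x' - x) powr (1/4)) / 2))" .
  qed
  then show ?thesis by simp
qed

text \<open>The untilted case: with \<open>h = 0\<close> and an empty rectangle the density is
  almost surely 1.\<close>

lemma conv_grid_bound:
  assumes m: "1 \<le> m" and a: "0 < a"
  shows "{\<omega> \<in> space M. \<not> grid_bound I m c (a * chain_const m) \<omega>} \<in> sets M"
    and "emeasure M {\<omega> \<in> space M. \<not> grid_bound I m c (a * chain_const m) \<omega>} \<le> ennreal (chain_err (8 * \<sigma>\<^sub>2\<^sup>2 * real m) m a)"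
proof -
  have Im: "I t x \<in> borel_measurable M" for t x
    using walsh[of t x] by (auto simp: has_walsh_integral_def)
  show s: "{\<omega> \<in> space M. \<not> grid_bound I m c (a * chain_const m) \<omega>} \<in> sets M"
    by (intro sets.sets_Collect_neg grid_bound_measurable Im)
  have R: "{} = {0<..0::real} \<times> ({} :: real set)" "0 \<le> (0 :: real)" "{} \<in> sets (borel :: real measure)" "emeasure lborel ({} :: real set) < \<infinity>" by auto
  have e: "shifted \<sigma> u I 0 {} = I" by (simp add: shifted_def fun_eq_iff)
  have "AE \<omega> in M. dens (\<lambda>z. 0) \<omega> = 1" using W_zero by eventually_elim (simp add: dens_def)
  then have "(\<integral>\<^sup>+\<omega>. indicator {\<omega> \<in> space M. \<not> grid_bound I m c (a * chain_const m) \<omega>} \<omega> \<partial>M)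
    = (\<integral>\<^sup>+\<omega>. ennreal (dens (\<lambda>z. 0) \<omega>) * indicator {\<omega> \<in> space M. \<not> grid_bound I m c (a * chain_const m) \<omega>} \<omega> \<partial>M)"
    by (intro nn_integral_cong_AE) (auto elim!: eventually_mono)
  then have "emeasure M {\<omega> \<in> space M. \<not> grid_bound I m c (a * chain_const m) \<omega>}
    = emeasure (density M (\<lambda>\<omega>. ennreal (dens (\<lambda>z. 0 * indicat_real {} z) \<omega>))) {\<omega> \<in> space M. \<not> grid_bound I m c (a * chain_const m) \<omega>}"
    using s dens_measurable[OF L2_halfplane_zero]
    by (simp add: emeasure_density)
  also have "\<dots> \<le> ennreal (chain_err (8 * \<sigma>\<^sub>2\<^sup>2 * real m) m a)"
    using shifted_grid_bound[OF R m a, of 0 c] unfolding e .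
  finally show "emeasure M {\<omega> \<in> space M. \<not> grid_bound I m c (a * chain_const m) \<omega>} \<le> ennreal (chain_err (8 * \<sigma>\<^sub>2\<^sup>2 * real m) m a)" .
qed

end

text \<open>
  An event that is unlikely under each of many shifts of the noise by orthogonal deterministic drifts
  is unlikely under the original law, because the average of the densities is close to \<open>1\<close> in \<open>L\<^sup>2\<close>.
\<close>

lemma average_tilt:
  assumes \<eta>: "\<And>i. i < N \<Longrightarrow> \<eta> i \<in> L2_halfplane" and N: "0 < (N :: nat)" and \<nu>: "0 < \<nu>"
    and orth: "\<And>i j. i < N \<Longrightarrow> j < N \<Longrightarrow> i \<noteq> j \<Longrightarrow> ip (\<eta> i) (\<eta> j) = 0"
    and q: "\<And>i. i < N \<Longrightarrow> ip (\<eta> i) (\<eta> i) \<le> q"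
    and G[measurable]: "G \<in> sets M"
    and le: "\<And>i. i < N \<Longrightarrow> emeasure (density M (\<lambda>\<omega>. ennreal (dens (\<eta> i) \<omega>))) G \<le> ennreal \<epsilon>" and \<epsilon>: "0 \<le> \<epsilon>"
  shows "prob G \<le> \<epsilon> + (\<nu> + exp q / (real N * \<nu>)) / 2"
proof -
  have Dm[measurable]: "i < N \<Longrightarrow> dens (\<eta> i) \<in> borel_measurable M" for i using \<eta> by (intro dens_measurable)
  define D where "D \<omega> = (\<Sum>i<N. dens (\<eta> i) \<omega>) / real N" for \<omega>
  have ID: "integrable M D" unfolding D_def
    by (intro integrable_divide Bochner_Integration.integrable_sum dens_expectation(1) \<eta>) auto
  have ED: "expectation D = 1"
  proof -
    have "expectation (\<lambda>\<omega>. \<Sum>i<N. dens (\<eta> i) \<omega>) = (\<Sum>i<N. expectation (dens (\<eta> i)))"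
      by (intro Bochner_Integration.integral_sum dens_expectation(1) \<eta>) auto
    then show ?thesis unfolding D_def using \<eta> N by (simp add: dens_expectation)
  qed
  have eq2: "(\<lambda>\<omega>. (D \<omega>)\<^sup>2) = (\<lambda>\<omega>. (\<Sum>i<N. \<Sum>j<N. dens (\<eta> i) \<omega> * dens (\<eta> j) \<omega>) / (real N)\<^sup>2)"
    by (auto simp: D_def fun_eq_iff power_divide power2_eq_square sum_product)
  have ID2: "integrable M (\<lambda>\<omega>. (D \<omega>)\<^sup>2)"
    unfolding eq2
    by (intro integrable_divide Bochner_Integration.integrable_sum dens_prod_expectation(1) \<eta>) auto
  have ED2: "expectation (\<lambda>\<omega>. (D \<omega>)\<^sup>2) \<le> 1 + exp q / real N"
  proof -
    have "expectation (\<lambda>\<omega>. (D \<omega>)\<^sup>2) = (\<Sum>i<N. \<Sum>j<N. exp (ip (\<eta> i) (\<eta> j))) / (real N)\<^sup>2"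
    proof -
      have "expectation (\<lambda>\<omega>. \<Sum>i<N. \<Sum>j<N. dens (\<eta> i) \<omega> * dens (\<eta> j) \<omega>) = (\<Sum>i<N. expectation (\<lambda>\<omega>. \<Sum>j<N. dens (\<eta> i) \<omega> * dens (\<eta> j) \<omega>))"
        using \<eta> by (intro Bochner_Integration.integral_sum Bochner_Integration.integrable_sum dens_prod_expectation) auto
      also have "\<dots> = (\<Sum>i<N. \<Sum>j<N. expectation (\<lambda>\<omega>. dens (\<eta> i) \<omega> * dens (\<eta> j) \<omega>))"
        using \<eta> by (intro sum.cong refl Bochner_Integration.integral_sum dens_prod_expectation) auto
      also have "\<dots> = (\<Sum>i<N. \<Sum>j<N. exp (ip (\<eta> i) (\<eta> j)))"
        using \<eta> by (intro sum.cong refl dens_prod_expectation) auto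
      finally show ?thesis unfolding eq2 by simp
    qed
    \<comment> \<open>Off the diagonal orthogonality gives exp 0 = 1. Only the \<open>N\<close>
      diagonal terms cost up to \<open>exp q\<close>, and after division by N^2 they leave exp q /
      N.\<close>
    also have "\<dots> \<le> (\<Sum>i<N. \<Sum>j<N. 1 + (if i = j then exp q else 0)) / (real N)\<^sup>2"
    proof (intro divide_right_mono sum_mono)
      fix i j assume "i \<in> {..<N}" "j \<in> {..<N}"
      then show "exp (ip (\<eta> i) (\<eta> j)) \<le> 1 + (if i = j then exp q else 0)"
        using orth[of i j] q[of i] by (auto intro: order_trans[of _ "exp q"])
    qed auto
    also have "\<dots> = 1 + exp q / real N"
      using N by (simp add: sum.distrib add_divide_distrib power2_eq_square)
    finally show ?thesis .
  qed
  have sq: "expectation (\<lambda>\<omega>. (1 - D \<omega>)\<^sup>2) \<le> exp q / real N" and Isq: "integrable M (\<lambda>\<omega>. (1 - D \<omega>)\<^sup>2)"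
  proof -
    have e: "(\<lambda>\<omega>. (1 - D \<omega>)\<^sup>2) = (\<lambda>\<omega>. 1 - 2 * D \<omega> + (D \<omega>)\<^sup>2)" by (auto simp: fun_eq_iff power2_eq_square algebra_simps)
    show "integrable M (\<lambda>\<omega>. (1 - D \<omega>)\<^sup>2)" unfolding e using ID ID2 by auto
    show "expectation (\<lambda>\<omega>. (1 - D \<omega>)\<^sup>2) \<le> exp q / real N"
      unfolding e using ID ID2 ED ED2 by (simp add: prob_space)
  qed
  have iG: "integrable M (\<lambda>\<omega>. indicat_real G \<omega> * dens (\<eta> i) \<omega>)" if "i < N" for i
    by (rule Bochner_Integration.integrable_bound[OF dens_expectation(1)[OF \<eta>[OF that]]])
      (use that in \<open>auto simp: indicator_def\<close>)
  have leG: "expectation (\<lambda>\<omega>. indicat_real G \<omega> * dens (\<eta> i) \<omega>) \<le> \<epsilon>" if i: "i < N" for i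
  proof (rule integral_real_bounded[OF \<epsilon>])
    have "(\<integral>\<^sup>+\<omega>. ennreal (indicat_real G \<omega> * dens (\<eta> i) \<omega>) \<partial>M) = emeasure (density M (\<lambda>\<omega>. ennreal (dens (\<eta> i) \<omega>))) G"
      using i by (subst emeasure_density) (auto intro!: nn_integral_cong simp: indicator_def)
    then show "(\<integral>\<^sup>+\<omega>. ennreal (indicat_real G \<omega> * dens (\<eta> i) \<omega>) \<partial>M) \<le> ennreal \<epsilon>" using le[OF i] by simp
  qed
  have iGD: "integrable M (\<lambda>\<omega>. indicat_real G \<omega> * D \<omega>)"
    by (rule Bochner_Integration.integrable_bound[OF ID]) (use borel_measurable_integrable[OF ID] in \<open>auto simp: indicator_def\<close>)
  have GD: "expectation (\<lambda>\<omega>. indicat_real G \<omega> * D \<omega>) \<le> \<epsilon>"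
  proof -
    have "expectation (\<lambda>\<omega>. indicat_real G \<omega> * D \<omega>) = expectation (\<lambda>\<omega>. (\<Sum>i<N. indicat_real G \<omega> * dens (\<eta> i) \<omega>) / real N)"
      by (intro Bochner_Integration.integral_cong) (auto simp: D_def sum_distrib_left)
    also have "\<dots> = expectation (\<lambda>\<omega>. \<Sum>i<N. indicat_real G \<omega> * dens (\<eta> i) \<omega>) / real N"
      by (rule integral_divide_zero)
    also have "expectation (\<lambda>\<omega>. \<Sum>i<N. indicat_real G \<omega> * dens (\<eta> i) \<omega>) = (\<Sum>i<N. expectation (\<lambda>\<omega>. indicat_real G \<omega> * dens (\<eta> i) \<omega>))"
      by (intro Bochner_Integration.integral_sum iG) auto
    also have "(\<Sum>i<N. expectation (\<lambda>\<omega>. indicat_real G \<omega> * dens (\<eta> i) \<omega>)) / real N \<le> (\<Sum>i<N. \<epsilon>) / real N" by (intro divide_right_mono sum_mono leG) auto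
    finally show ?thesis using N by simp
  qed
  have iG1: "integrable M (indicat_real G)" by (intro integrable_real_indicator) (auto simp: less_top[symmetric])
  have "prob G = expectation (\<lambda>\<omega>. indicat_real G \<omega>)" by simp
  \<comment> \<open>The indicator is split along 1 = D + (1 - D): the first part is the average of
    the tilted probabilities of \<open>G\<close>, the second is small in
    \<open>L\<^sup>2\<close>.\<close>
  also have "expectation (\<lambda>\<omega>. indicat_real G \<omega>) \<le> expectation (\<lambda>\<omega>. indicat_real G \<omega> * D \<omega> + (\<nu> + (1 - D \<omega>)\<^sup>2 / \<nu>) / 2)"
  proof (rule integral_mono[OF iG1])
    show "integrable M (\<lambda>\<omega>. indicat_real G \<omega> * D \<omega> + (\<nu> + (1 - D \<omega>)\<^sup>2 / \<nu>) / 2)" using iGD Isq by auto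
    fix \<omega>
    have "1 - D \<omega> \<le> (\<nu> + (1 - D \<omega>)\<^sup>2 / \<nu>) / 2" using abs_le_square_bound[OF \<nu>, of "1 - D \<omega>"] by linarith
    moreover have "0 \<le> (\<nu> + (1 - D \<omega>)\<^sup>2 / \<nu>) / 2" using \<nu> by simp
    moreover have "i \<le> i * d + r" if "1 - d \<le> r" "0 \<le> r" "i = 0 \<or> i = 1" for i d r :: real
      using that by auto
    ultimately show "indicat_real G \<omega> \<le> indicat_real G \<omega> * D \<omega> + (\<nu> + (1 - D \<omega>)\<^sup>2 / \<nu>) / 2"
      by (metis indicator_simps)
  qed
  also have "\<dots> = expectation (\<lambda>\<omega>. indicat_real G \<omega> * D \<omega>) + (\<nu> + expectation (\<lambda>\<omega>. (1 - D \<omega>)\<^sup>2) / \<nu>) / 2"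
    using iGD Isq by (simp add: prob_space)
  also have "\<dots> \<le> \<epsilon> + (\<nu> + (exp q / real N) / \<nu>) / 2"
    using GD sq \<nu> by (intro add_mono divide_right_mono) auto
  finally show ?thesis by simp
qed

end

section \<open>Growth along a path\<close>

text \<open>A countable set of points: the mild equation, which holds almost surely at each point,
  holds at all of them off a single null set. The common denominator matches
  \<open>grid_bound\<close>.\<close>

definition gridpt :: "real \<Rightarrow> real \<Rightarrow> bool" where
  "gridpt t x \<longleftrightarrow> (\<exists>(k::nat) (j::int) (l::int). t = real_of_int j / 2 ^ k \<and> x = real_of_int l / 2 ^ k)"

lemma countable_gridpt: "countable {p. gridpt (fst p) (snd p)}"
proof -
  let ?f = "\<lambda>(k::nat, j::int, l::int). (real_of_int j / 2 ^ k, real_of_int l / 2 ^ k)"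
  have "{p. gridpt (fst p) (snd p)} \<subseteq> range ?f"
  proof
    fix p assume "p \<in> {p. gridpt (fst p) (snd p)}"
    then obtain k j l where "p = ?f (k, j, l)" by (auto simp: gridpt_def prod_eq_iff)
    then show "p \<in> range ?f" by blast
  qed
  then show ?thesis by (rule countable_subset) simp
qed

text \<open>The centre is an integer, so the dyadic points around it are the dyadic points around
  0.\<close>

lemma grid_boundD:
  assumes "grid_bound Y m (real_of_int c) K \<omega>" "gridpt t x" "0 \<le> t" "t \<le> real m" "\<bar>x - real_of_int c\<bar> \<le> real m"
  shows "\<bar>Y t x \<omega>\<bar> \<le> K"
proof -
  from assms(2) obtain k :: nat and j l :: int where t: "t = real_of_int j / 2 ^ k" and x: "x = real_of_int l / 2 ^ k"
    by (auto simp: gridpt_def)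
  let ?l = "l - c * 2 ^ k"
  have x': "x = real_of_int c + real_of_int ?l / 2 ^ k" by (simp add: x field_simps)
  have "0 \<le> real_of_int j" "real_of_int j \<le> real m * 2 ^ k" using assms(3,4) by (auto simp: t field_simps)
  then have "real_of_int 0 \<le> real_of_int j" "real_of_int j \<le> real_of_int (int m * 2 ^ k)" by auto
  then have j: "j \<in> {0..int m * 2 ^ k}" unfolding of_int_le_iff by simp
  have "\<bar>real_of_int ?l / 2 ^ k\<bar> \<le> real m" using assms(5) x' by simp
  then have "- (real m * 2 ^ k) \<le> real_of_int ?l" "real_of_int ?l \<le> real m * 2 ^ k"
    by (auto simp: abs_le_iff field_simps)
  then have "real_of_int (- (int m * 2 ^ k)) \<le> real_of_int ?l" "real_of_int ?l \<le> real_of_int (int m * 2 ^ k)" by auto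
  then have l: "?l \<in> {- (int m * 2 ^ k)..int m * 2 ^ k}" unfolding of_int_le_iff by simp
  show ?thesis using assms(1) j l unfolding grid_bound_def x' t by blast
qed

text \<open>Rounding up eventually stays in the interval unless \<open>t\<close> is its right end
  point; in that case rounding down does.\<close>

lemma dyadic_approx:
  fixes a b t :: real
  assumes "a < b" "a \<le> t" "t \<le> b"
  obtains j :: "nat \<Rightarrow> int" where "(\<lambda>k. real_of_int (j k) / 2 ^ k) \<longlonglongrightarrow> t"
    "\<forall>\<^sub>F k in sequentially. a \<le> real_of_int (j k) / 2 ^ k \<and> real_of_int (j k) / 2 ^ k \<le> b"
proof -
  have z: "(\<lambda>k. (1 / 2 :: real) ^ k) \<longlonglongrightarrow> 0" by (rule LIMSEQ_realpow_zero) auto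
  show thesis
  proof (cases "t < b")
    case True
    define j where "j k = \<lceil>t * 2 ^ k\<rceil>" for k :: nat
    have b1: "t \<le> real_of_int (j k) / 2 ^ k" for k
      by (simp add: j_def le_divide_eq)
    have b2: "real_of_int (j k) / 2 ^ k \<le> t + (1 / 2) ^ k" for k
    proof -
      have "real_of_int (j k) \<le> t * 2 ^ k + 1" unfolding j_def by linarith
      then have "real_of_int (j k) / 2 ^ k \<le> (t * 2 ^ k + 1) / 2 ^ k" by (intro divide_right_mono) auto
      then show ?thesis by (simp add: add_divide_distrib power_one_over)
    qed
    have "(\<lambda>k. t + (1 / 2) ^ k) \<longlonglongrightarrow> t + 0" by (intro tendsto_intros z)
    then have l: "(\<lambda>k. t + (1 / 2) ^ k) \<longlonglongrightarrow> t" by simp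
    have "(\<lambda>k. real_of_int (j k) / 2 ^ k) \<longlonglongrightarrow> t"
      by (rule tendsto_sandwich[OF _ _ tendsto_const l]) (use b1 b2 in auto)
    moreover have "\<forall>\<^sub>F k in sequentially. t + (1 / 2) ^ k < b" by (rule order_tendstoD(2)[OF l True])
    then have "\<forall>\<^sub>F k in sequentially. a \<le> real_of_int (j k) / 2 ^ k \<and> real_of_int (j k) / 2 ^ k \<le> b"
    proof eventually_elim
      case (elim k) then show ?case using b1[of k] b2[of k] assms by linarith
    qed
    ultimately show thesis by (rule that)
  next
    case False
    then have tb: "a < t" using assms by simp
    define j where "j k = \<lfloor>t * 2 ^ k\<rfloor>" for k :: nat
    have b1: "real_of_int (j k) / 2 ^ k \<le> t" for k
      by (simp add: j_def divide_le_eq)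
    have b2: "t - (1 / 2) ^ k \<le> real_of_int (j k) / 2 ^ k" for k
    proof -
      have "t * 2 ^ k - 1 \<le> real_of_int (j k)" unfolding j_def by linarith
      then have "(t * 2 ^ k - 1) / 2 ^ k \<le> real_of_int (j k) / 2 ^ k" by (intro divide_right_mono) auto
      then show ?thesis by (simp add: diff_divide_distrib power_one_over)
    qed
    have "(\<lambda>k. t - (1 / 2) ^ k) \<longlonglongrightarrow> t - 0" by (intro tendsto_intros z)
    then have l: "(\<lambda>k. t - (1 / 2) ^ k) \<longlonglongrightarrow> t" by simp
    have "(\<lambda>k. real_of_int (j k) / 2 ^ k) \<longlonglongrightarrow> t"
      by (rule tendsto_sandwich[OF _ _ l tendsto_const]) (use b1 b2 in auto)
    moreover have "\<forall>\<^sub>F k in sequentially. a < t - (1 / 2) ^ k" by (rule order_tendstoD(1)[OF l tb])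
    then have "\<forall>\<^sub>F k in sequentially. a \<le> real_of_int (j k) / 2 ^ k \<and> real_of_int (j k) / 2 ^ k \<le> b"
    proof eventually_elim
      case (elim k) then show ?case using b1[of k] b2[of k] assms by linarith
    qed
    ultimately show thesis by (rule that)
  qed
qed

lemma gridpt_dense_ge:
  fixes U :: "real \<Rightarrow> real \<Rightarrow> real"
  assumes cont: "continuous_on ({0<..} \<times> UNIV) (\<lambda>(t, x). U t x)"
    and ab: "0 < a" "a < b" "l < r"
    and ge: "\<And>t x. gridpt t x \<Longrightarrow> a \<le> t \<Longrightarrow> t \<le> b \<Longrightarrow> l \<le> x \<Longrightarrow> x \<le> r \<Longrightarrow> K \<le> U t x"
    and tx: "a \<le> t" "t \<le> b" "l \<le> x" "x \<le> r"
  shows "K \<le> U t x"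
proof -
  obtain j where j: "(\<lambda>k. real_of_int (j k) / 2 ^ k) \<longlonglongrightarrow> t"
    "\<forall>\<^sub>F k in sequentially. a \<le> real_of_int (j k) / 2 ^ k \<and> real_of_int (j k) / 2 ^ k \<le> b"
    using dyadic_approx[OF ab(2) tx(1,2)] by blast
  obtain i where i: "(\<lambda>k. real_of_int (i k) / 2 ^ k) \<longlonglongrightarrow> x"
    "\<forall>\<^sub>F k in sequentially. l \<le> real_of_int (i k) / 2 ^ k \<and> real_of_int (i k) / 2 ^ k \<le> r"
    using dyadic_approx[OF ab(3) tx(3,4)] by blast
  let ?p = "\<lambda>k. (real_of_int (j k) / 2 ^ k, real_of_int (i k) / 2 ^ k)"
  have "(\<lambda>k. (\<lambda>(t, x). U t x) (?p k)) \<longlonglongrightarrow> (\<lambda>(t, x). U t x) (t, x)"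
  proof (rule continuous_on_tendsto_compose[OF cont])
    show "?p \<longlonglongrightarrow> (t, x)" by (intro tendsto_Pair j i)
    show "\<forall>\<^sub>F k in sequentially. ?p k \<in> {0<..} \<times> UNIV"
      using j(2) by eventually_elim (use ab in auto)
  qed (use ab tx in auto)
  then have lim: "(\<lambda>k. U (real_of_int (j k) / 2 ^ k) (real_of_int (i k) / 2 ^ k)) \<longlonglongrightarrow> U t x" by simp
  have "\<forall>\<^sub>F k in sequentially. K \<le> U (real_of_int (j k) / 2 ^ k) (real_of_int (i k) / 2 ^ k)"
    using j(2) i(2)
  proof eventually_elim
    case (elim k)
    have "gridpt (real_of_int (j k) / 2 ^ k) (real_of_int (i k) / 2 ^ k)" unfolding gridpt_def by blast
    then show ?case using elim by (intro ge) auto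
  qed
  then show ?thesis by (intro tendsto_lowerbound[OF lim]) auto
qed

section \<open>Mass of the heat kernel on space-time strips\<close>

lemma kern_nn_integral_strip:
  "(\<integral>\<^sup>+z. ennreal (kern t x z) * indicator ({\<alpha><..<\<beta>} \<times> {c - 1<..c + 1}) z \<partial>lborel)
    = (\<integral>\<^sup>+s. indicator {\<alpha><..<\<beta>} s * indicator {0<..<t} s * (\<integral>\<^sup>+y. ennreal (heat_kernel (t - s) (y - x)) * indicator {c - 1<..c + 1} y \<partial>lborel) \<partial>lborel)"
proof -
  have [measurable]: "kern t x \<in> borel_measurable (lborel \<Otimes>\<^sub>M lborel)" unfolding lborel_prod by measurable
  have [measurable]: "{\<alpha><..<\<beta>} \<times> {c - 1<..c + 1} \<in> sets (lborel \<Otimes>\<^sub>M lborel)" by (intro pair_measureI) auto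
  have "(\<integral>\<^sup>+z. ennreal (kern t x z) * indicator ({\<alpha><..<\<beta>} \<times> {c - 1<..c + 1}) z \<partial>lborel)
    = (\<integral>\<^sup>+s. \<integral>\<^sup>+y. ennreal (kern t x (s, y)) * indicator ({\<alpha><..<\<beta>} \<times> {c - 1<..c + 1}) (s, y) \<partial>lborel \<partial>lborel)"
    unfolding lborel_prod[symmetric] by (subst lborel.nn_integral_fst[symmetric]) auto
  also have "\<dots> = (\<integral>\<^sup>+s. indicator {\<alpha><..<\<beta>} s * indicator {0<..<t} s * (\<integral>\<^sup>+y. ennreal (heat_kernel (t - s) (y - x)) * indicator {c - 1<..c + 1} y \<partial>lborel) \<partial>lborel)"
  proof (intro nn_integral_cong)
    fix s
    show "(\<integral>\<^sup>+y. ennreal (kern t x (s, y)) * indicator ({\<alpha><..<\<beta>} \<times> {c - 1<..c + 1}) (s, y) \<partial>lborel)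
      = indicator {\<alpha><..<\<beta>} s * indicator {0<..<t} s * (\<integral>\<^sup>+y. ennreal (heat_kernel (t - s) (y - x)) * indicator {c - 1<..c + 1} y \<partial>lborel)"
      by (cases "s \<in> {\<alpha><..<\<beta>}"; cases "s \<in> {0<..<t}")
        (auto simp: kern_def indicator_times intro!: nn_integral_cong)
  qed
  finally show ?thesis .
qed

lemma kern_strip_lower:
  assumes "0 \<le> \<alpha>" "\<alpha> \<le> \<beta>" "\<beta> \<le> t" "0 \<le> w"
    and lower: "\<And>s. \<alpha> < s \<Longrightarrow> s < \<beta> \<Longrightarrow> ennreal w \<le> (\<integral>\<^sup>+y. ennreal (heat_kernel (t - s) (y - x)) * indicator {c - 1<..c + 1} y \<partial>lborel)"
  shows "ennreal (w * (\<beta> - \<alpha>)) \<le> (\<integral>\<^sup>+z. ennreal (kern t x z) * indicator ({\<alpha><..<\<beta>} \<times> {c - 1<..c + 1}) z \<partial>lborel)"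
proof -
  have "ennreal (w * (\<beta> - \<alpha>)) = ennreal w * emeasure lborel {\<alpha><..<\<beta>}"
    using assms by (simp add: ennreal_mult)
  also have "\<dots> = (\<integral>\<^sup>+s. ennreal w * indicator {\<alpha><..<\<beta>} s \<partial>lborel)"
    by (subst nn_integral_cmult_indicator) auto
  also have "\<dots> \<le> (\<integral>\<^sup>+s. indicator {\<alpha><..<\<beta>} s * indicator {0<..<t} s * (\<integral>\<^sup>+y. ennreal (heat_kernel (t - s) (y - x)) * indicator {c - 1<..c + 1} y \<partial>lborel) \<partial>lborel)"
    using assms lower by (intro nn_integral_mono) (auto simp: indicator_def)
  also have "\<dots> = (\<integral>\<^sup>+z. ennreal (kern t x z) * indicator ({\<alpha><..<\<beta>} \<times> {c - 1<..c + 1}) z \<partial>lborel)"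
    by (rule kern_nn_integral_strip[symmetric])
  finally show ?thesis .
qed

lemma kern_strip_near:
  assumes "0 \<le> \<alpha>" "\<alpha> \<le> \<beta>" "\<beta> \<le> t" "t \<le> 1" "\<bar>x - c\<bar> \<le> 1"
  shows "ennreal (1 / 6 * (\<beta> - \<alpha>)) \<le> (\<integral>\<^sup>+z. ennreal (kern t x z) * indicator ({\<alpha><..<\<beta>} \<times> {c - 1<..c + 1}) z \<partial>lborel)"
  using assms by (intro kern_strip_lower heat_kernel_mass_lower) auto

text \<open>A crude Gaussian bound: the elapsed time lies between \<open>\<rho>\<close> and
  \<open>T\<close> and the distance is at most \<open>D\<close>, so the exponent is estimated at the
  shortest time and the prefactor at the longest. The factor 2 is the width of the strip.\<close>

lemma kern_strip_far:
  assumes "0 \<le> \<alpha>" "\<alpha> \<le> \<beta>" "0 < \<rho>" "\<beta> + \<rho> \<le> t" "t \<le> T" "\<bar>x - c\<bar> + 1 \<le> D"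
  shows "ennreal (2 * (exp (- D\<^sup>2 / (2 * \<rho>)) / sqrt (2 * pi * T)) * (\<beta> - \<alpha>))
    \<le> (\<integral>\<^sup>+z. ennreal (kern t x z) * indicator ({\<alpha><..<\<beta>} \<times> {c - 1<..c + 1}) z \<partial>lborel)"
proof (rule kern_strip_lower)
  have T: "0 < T" using assms by linarith
  let ?k = "exp (- D\<^sup>2 / (2 * \<rho>)) / sqrt (2 * pi * T)"
  show "0 \<le> 2 * ?k" using T by simp
  fix s assume s: "\<alpha> < s" "s < \<beta>"
  have "ennreal (2 * ?k) = (\<integral>\<^sup>+y. ennreal ?k * indicator {c - 1<..c + 1} y \<partial>lborel)"
    using T ennreal_mult[of ?k 2] by (subst nn_integral_cmult_indicator) (auto simp: mult.commute)
  also have "\<dots> \<le> (\<integral>\<^sup>+y. ennreal (heat_kernel (t - s) (y - x)) * indicator {c - 1<..c + 1} y \<partial>lborel)"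
  proof (rule nn_integral_mono)
    fix y
    show "ennreal ?k * indicator {c - 1<..c + 1} y \<le> ennreal (heat_kernel (t - s) (y - x)) * indicator {c - 1<..c + 1} y"
    proof (cases "y \<in> {c - 1<..c + 1}")
      case True
      have r: "\<rho> \<le> t - s" "t - s \<le> T" using s assms by auto
      have "\<bar>y - x\<bar> \<le> D" using True assms(6) by auto
      then have "(y - x)\<^sup>2 \<le> D\<^sup>2" by (metis abs_ge_zero power2_abs power_mono)
      then have "(y - x)\<^sup>2 / (2 * (t - s)) \<le> D\<^sup>2 / (2 * \<rho>)"
        using r assms(3) by (intro frac_le) auto
      then have "?k \<le> heat_kernel (t - s) (y - x)"
        unfolding heat_kernel_def using r assms(3) T
        by (intro frac_le real_sqrt_le_mono mult_left_mono) auto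
      then show ?thesis using True by (auto intro!: ennreal_leI)
    qed simp
  qed
  finally show "ennreal (2 * ?k) \<le> (\<integral>\<^sup>+y. ennreal (heat_kernel (t - s) (y - x)) * indicator {c - 1<..c + 1} y \<partial>lborel)" .
qed (use assms in auto)

text \<open>For a non-integrable integrand the value is 0 by convention; integrability is therefore
  carried along wherever the drift is bounded from below.\<close>

definition drift :: "(real \<Rightarrow> real) \<Rightarrow> (real \<Rightarrow> real \<Rightarrow> real) \<Rightarrow> real \<Rightarrow> real \<Rightarrow> real" where
  "drift b U t x = (\<integral>z. kern t x z * b (U (fst z) (snd z)) \<partial>lborel)"

text \<open>A step function on finitely many disjoint strips, multiplied by the kernel, lies below
  the nonnegative integrand of the drift.\<close>

lemma drift_strips:
  assumes int: "integrable lborel (\<lambda>z. kern t x z * b (U (fst z) (snd z)))"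
    and b: "\<And>y. 0 \<le> b y"
    and disj: "disjoint_family_on S I" and I: "finite I"
    and S[measurable]: "\<And>i. i \<in> I \<Longrightarrow> S i \<in> sets borel"
    and w: "\<And>i. i \<in> I \<Longrightarrow> 0 \<le> w i" "\<And>i s y. i \<in> I \<Longrightarrow> (s, y) \<in> S i \<Longrightarrow> w i \<le> b (U s y)"
    and v: "\<And>i. i \<in> I \<Longrightarrow> ennreal (v i) \<le> (\<integral>\<^sup>+z. ennreal (kern t x z) * indicator (S i) z \<partial>lborel)" "\<And>i. i \<in> I \<Longrightarrow> 0 \<le> v i"
  shows "(\<Sum>i\<in>I. w i * v i) \<le> drift b U t x"
proof -
  have nn: "0 \<le> kern t x z * b (U (fst z) (snd z))" for z using b kern_nonneg by simp
  have "ennreal (\<Sum>i\<in>I. w i * v i) = (\<Sum>i\<in>I. ennreal (w i) * ennreal (v i))"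
    using w v by (subst sum_ennreal[symmetric]) (auto simp: ennreal_mult)
  also have "\<dots> \<le> (\<Sum>i\<in>I. ennreal (w i) * (\<integral>\<^sup>+z. ennreal (kern t x z) * indicator (S i) z \<partial>lborel))"
    using v by (intro sum_mono mult_left_mono) auto
  also have "\<dots> = (\<Sum>i\<in>I. \<integral>\<^sup>+z. ennreal (w i) * (ennreal (kern t x z) * indicator (S i) z) \<partial>lborel)"
    by (intro sum.cong refl nn_integral_cmult[symmetric]) auto
  also have "\<dots> = (\<integral>\<^sup>+z. (\<Sum>i\<in>I. ennreal (w i) * (ennreal (kern t x z) * indicator (S i) z)) \<partial>lborel)"
    by (intro nn_integral_sum[symmetric]) auto
  also have "\<dots> \<le> (\<integral>\<^sup>+z. ennreal (kern t x z * b (U (fst z) (snd z))) \<partial>lborel)"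
  proof (rule nn_integral_mono)
    fix z
    show "(\<Sum>i\<in>I. ennreal (w i) * (ennreal (kern t x z) * indicator (S i) z)) \<le> ennreal (kern t x z * b (U (fst z) (snd z)))"
    proof (cases "\<exists>i\<in>I. z \<in> S i")
      case True
      then obtain i where i: "i \<in> I" "z \<in> S i" by auto
      have "z \<notin> S i'" if "i' \<in> I - {i}" for i' using disj i that by (auto simp: disjoint_family_on_def)
      then have "(\<Sum>i\<in>I. ennreal (w i) * (ennreal (kern t x z) * indicator (S i) z)) = ennreal (w i) * ennreal (kern t x z)"
        using i I by (subst sum.remove[of _ i]) (auto intro!: sum.neutral)
      also have "\<dots> = ennreal (kern t x z * w i)" using w(1)[OF i(1)] kern_nonneg by (simp add: ennreal_mult'' mult.commute)
      also have "\<dots> \<le> ennreal (kern t x z * b (U (fst z) (snd z)))"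
        using w(2)[OF i(1), of "fst z" "snd z"] i(2) kern_nonneg by (intro ennreal_leI mult_left_mono) auto
      finally show ?thesis .
    next
      case False
      then show ?thesis by (auto simp: sum.neutral)
    qed
  qed
  also have "\<dots> = ennreal (drift b U t x)"
    unfolding drift_def using nn by (intro nn_integral_eq_integral int) auto
  finally show ?thesis
    using nn by (subst (asm) ennreal_le_iff) (auto simp: drift_def)
qed

text \<open>
  The Osgood condition makes the times \<open>T\<^sub>j\<close> at which the level \<open>H + j\<close> is reached summable; the constant
  \<open>6\<close> is the reciprocal of the mass that the heat kernel keeps inside the island.
\<close>

lemma island_levels:
  fixes U :: "real \<Rightarrow> real \<Rightarrow> real" and T :: "nat \<Rightarrow> real"
  assumes cont: "continuous_on ({0<..} \<times> UNIV) (\<lambda>(t, x). U t x)"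
    and b: "mono b" "\<And>y. 0 < b y"
    and T: "0 < T 0" "\<And>i. T (Suc i) = T i + 6 / b (H + real i)" and t0: "t\<^sub>0 \<le> 1"
    and eq: "\<And>t x. gridpt t x \<Longrightarrow> T 0 \<le> t \<Longrightarrow> t \<le> t\<^sub>0 \<Longrightarrow> \<bar>x - c\<bar> \<le> 1 \<Longrightarrow>
      integrable lborel (\<lambda>z. kern t x z * b (U (fst z) (snd z))) \<and> H + drift b U t x \<le> U t x"
  shows "T J < t\<^sub>0 \<Longrightarrow> T J \<le> t \<Longrightarrow> t \<le> t\<^sub>0 \<Longrightarrow> \<bar>x - c\<bar> \<le> 1 \<Longrightarrow> H + real J \<le> U t x"
proof (induction J arbitrary: t x rule: less_induct)
  case (less J)
  have Tm: "mono T"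
    using b(2) by (intro incseq_SucI) (simp add: T less_imp_le)
  show ?case
  \<comment> \<open>The equation is available at dyadic points only; the level is established there
    and extended by continuity.\<close>
  proof (rule gridpt_dense_ge[OF cont, of "T J" t\<^sub>0 "c - 1" "c + 1"])
    show "0 < T J" using T(1) monoD[OF Tm, of 0 J] by simp
    fix t x assume g: "gridpt t x" "T J \<le> t" "t \<le> t\<^sub>0" "c - 1 \<le> x" "x \<le> c + 1"
    then have x: "\<bar>x - c\<bar> \<le> 1" by auto
    have e: "integrable lborel (\<lambda>z. kern t x z * b (U (fst z) (snd z)))" "H + drift b U t x \<le> U t x"
      using eq[OF g(1) _ g(3) x] monoD[OF Tm, of 0 J] g(2) by auto
    define S where "S i = {T i<..<T (Suc i)} \<times> {c - 1<..c + 1}" for i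
    \<comment> \<open>From time \<open>T J\<close> on, the strips of all lower levels lie in the
      past. By the induction hypothesis the drift on strip \<open>i\<close> is at least
      \<open>b (H + real i)\<close>, and the length \<open>6 / b (H + real i)\<close> of the strip
      is chosen so that this lower bound contributes exactly 1.\<close>
    have "(\<Sum>i<J. b (H + real i) * (1 / 6 * (T (Suc i) - T i))) \<le> drift b U t x"
    proof (rule drift_strips[where S=S and t=t and x=x and b=b and U=U])
      show "integrable lborel (\<lambda>z. kern t x z * b (U (fst z) (snd z)))" by (rule e(1))
      show "disjoint_family_on S {..<J}"
        unfolding disjoint_family_on_def
      proof (intro ballI impI)
        have "S i \<inter> S k = {}" if "i < k" for i k
          using monoD[OF Tm, of "Suc i" k] that by (auto simp: S_def)
        then show "S i \<inter> S k = {}" if "i \<noteq> k" for i k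
          using that by (metis Int_commute linorder_neqE_nat)
      qed
      show "S i \<in> sets borel" for i
        unfolding S_def borel_prod[symmetric] by (intro pair_measureI) auto
      fix i assume i: "i \<in> {..<J}"
      then have Ti: "T (Suc i) \<le> T J" "T i \<le> T (Suc i)" "0 \<le> T i"
        using monoD[OF Tm, of "Suc i" J] monoD[OF Tm, of i "Suc i"] monoD[OF Tm, of 0 i] T(1) by auto
      show "ennreal (1 / 6 * (T (Suc i) - T i)) \<le> (\<integral>\<^sup>+z. ennreal (kern t x z) * indicator (S i) z \<partial>lborel)"
        unfolding S_def by (rule kern_strip_near) (use Ti g x t0 in auto)
      show "0 \<le> 1 / 6 * (T (Suc i) - T i)" using Ti by simp
      fix s y assume sy: "(s, y) \<in> S i"
      have "H + real i \<le> U s y"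
        by (rule less.IH) (use i sy Ti less.prems in \<open>auto simp: S_def\<close>)
      then show "b (H + real i) \<le> b (U s y)" using b(1) by (rule monoD[rotated])
    qed (use b(2) in \<open>auto intro: less_imp_le\<close>)
    also have "(\<Sum>i<J. b (H + real i) * (1 / 6 * (T (Suc i) - T i))) = (\<Sum>i<J. 1)"
    proof (rule sum.cong[OF refl])
      fix i show "b (H + real i) * (1 / 6 * (T (Suc i) - T i)) = 1"
        using b(2)[of "H + real i"] by (simp add: T(2))
    qed
    finally show "H + real J \<le> U t x" using e(2) by simp
  qed (use less.prems in auto)
qed

section \<open>Blow-up\<close>

text \<open>The integral test on the intervals (i + 1, i + 2]: \<open>b\<close> is largest at the
  right end point. The shift by 2 comes from the lower limit 1 of the integral.\<close>

lemma osgood_summable: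
  fixes b :: "real \<Rightarrow> real"
  assumes b: "mono b" "\<And>x. 0 < b x"
    and osgood: "(\<integral>\<^sup>+y\<in>{1..}. ennreal (1 / b y) \<partial>lborel) < \<infinity>"
  shows "summable (\<lambda>i. 1 / b (real i + 2))"
proof (rule summable_suminf_not_top)
  define A where "A i = {real i + 1<..real i + 2}" for i :: nat
  have disj: "disjoint_family A"
    unfolding disjoint_family_on_def
  proof (intro ballI impI)
    have "A i \<inter> A j = {}" if "i < j" for i j
      using that by (auto simp: A_def)
    then show "A i \<inter> A j = {}" if "i \<noteq> j" for i j using that by (metis Int_commute linorder_neqE_nat)
  qed
  have "(\<Sum>i. ennreal (1 / b (real i + 2))) = (\<Sum>i. \<integral>\<^sup>+y. ennreal (1 / b (real i + 2)) * indicator (A i) y \<partial>lborel)"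
    by (intro suminf_cong) (simp add: nn_integral_cmult_indicator A_def)
  also have "\<dots> = (\<integral>\<^sup>+y. (\<Sum>i. ennreal (1 / b (real i + 2)) * indicator (A i) y) \<partial>lborel)"
    by (rule nn_integral_suminf[symmetric]) (simp add: A_def)
  also have "\<dots> \<le> (\<integral>\<^sup>+y\<in>{1..}. ennreal (1 / b y) \<partial>lborel)"
  proof (rule nn_integral_mono)
    fix y
    show "(\<Sum>i. ennreal (1 / b (real i + 2)) * indicator (A i) y) \<le> ennreal (1 / b y) * indicator {1..} y"
    proof (cases "\<exists>i. y \<in> A i")
      case True
      then obtain i where i: "y \<in> A i" by auto
      have "(\<Sum>i. ennreal (1 / b (real i + 2)) * indicator (A i) y) = ennreal (1 / b (real i + 2))"
        by (rule suminf_cmult_indicator[OF disj i])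
      also have "\<dots> \<le> ennreal (1 / b y)"
        using i b(2) by (intro ennreal_leI divide_left_mono monoD[OF b(1)]) (auto simp: A_def)
      finally show ?thesis using i by (simp add: A_def)
    next
      case False
      then show ?thesis by simp
    qed
  qed
  finally show "(\<Sum>i. ennreal (1 / b (real i + 2))) \<noteq> \<top>"
    using osgood by (simp add: top.not_eq_extremum order.strict_trans1)
qed (use b in \<open>simp add: less_imp_le\<close>)

lemma initial_lower:
  assumes "\<And>x. \<bar>u\<^sub>0 x\<bar> \<le> B" "0 < t"
  shows "- B \<le> (\<integral>y. heat_kernel t (x - y) * u\<^sub>0 y \<partial>lebesgue)"
proof -
  have B: "0 \<le> B" using assms(1)[of 0] by linarith
  have e: "heat_kernel t (x - y) = heat_kernel t (y - x)" for y using heat_kernel_minus[of t "y - x"] by simp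
  have hb: "has_bochner_integral lborel (\<lambda>y. heat_kernel t (x - y)) 1"
    unfolding e using heat_kernel_nn_integral[OF assms(2), of x] assms(2)
    by (intro has_bochner_integral_nn_integral) (auto simp: heat_kernel_nonneg)
  then have "integrable lborel (\<lambda>y. heat_kernel t (x - y))" "(\<integral>y. heat_kernel t (x - y) \<partial>lborel) = 1"
    by (auto simp: has_bochner_integral_iff)
  then have i: "integrable lebesgue (\<lambda>y. heat_kernel t (x - y))" "(\<integral>y. heat_kernel t (x - y) \<partial>lebesgue) = 1"
    by (auto simp: integrable_completion integral_completion)
  show ?thesis
  proof (cases "integrable lebesgue (\<lambda>y. heat_kernel t (x - y) * u\<^sub>0 y)")
    case True
    have "- B = (\<integral>y. heat_kernel t (x - y) * (- B) \<partial>lebesgue)" using i(2) by simp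
    also have "\<dots> \<le> (\<integral>y. heat_kernel t (x - y) * u\<^sub>0 y \<partial>lebesgue)"
    proof (rule integral_mono[OF _ True])
      show "integrable lebesgue (\<lambda>y. heat_kernel t (x - y) * (- B))" using i(1) by (rule integrable_mult_left)
      show "heat_kernel t (x - y) * (- B) \<le> heat_kernel t (x - y) * u\<^sub>0 y" for y
        using assms(1)[of y] assms(2) by (intro mult_left_mono) (auto simp: heat_kernel_nonneg abs_le_iff)
    qed
    finally show ?thesis .
  \<comment> \<open>In the remaining case the integral is 0 by convention, which is at least
    \<open>- B\<close>.\<close>
  qed (simp add: not_integrable_integral_eq B)
qed

text \<open>The equation supplies a version of the stochastic convolution for each point separately.
  Choice collects these into one field, set to 0 for \<open>t \<le> 0\<close>, where the integrand
  vanishes.\<close>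

lemma (in noise_space) mild_formE:
  assumes "random_field_solution M W \<sigma> c u\<^sub>0 u"
  obtains I where "\<And>t x. has_walsh_integral M W (conv_integrand \<sigma> u t x) (I t x)" "\<And>x \<omega>. I 0 x \<omega> = 0"
    "\<And>t x. 0 < t \<Longrightarrow> AE \<omega> in M. integrable lborel (\<lambda>z. kern t x z * c (u (fst z) (snd z) \<omega>)) \<and>
      u t x \<omega> = (\<integral>y. heat_kernel t (x - y) * u\<^sub>0 y \<partial>lebesgue) + drift c (\<lambda>s y. u s y \<omega>) t x + I t x \<omega>"
proof -
  define P where "P t x I \<longleftrightarrow> has_walsh_integral M W (conv_integrand \<sigma> u t x) I \<and>
    (AE \<omega> in M. integrable lborel (\<lambda>z. kern t x z * c (u (fst z) (snd z) \<omega>)) \<and>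
      u t x \<omega> = (\<integral>y. heat_kernel t (x - y) * u\<^sub>0 y \<partial>lebesgue) + drift c (\<lambda>s y. u s y \<omega>) t x + I \<omega>)" for t x I
  have eq: "(\<lambda>z. indicat_real ({0<..<t} \<times> UNIV) z *\<^sub>R (case z of (s, y) \<Rightarrow> heat_kernel (t - s) (y - x) * c (u s y \<omega>)))
      = (\<lambda>z. kern t x z * c (u (fst z) (snd z) \<omega>))" for t x \<omega>
    by (auto simp: fun_eq_iff kern_def indicator_def)
  have ex: "\<exists>I. P t x I" if "0 < t" for t x
  proof -
    note ex = conjunct2[OF assms[unfolded random_field_solution_def], rule_format, OF that, of x]
    obtain I where I: "has_walsh_integral M W (\<lambda>s y \<omega>. indicat_real {0<..<t} s * (heat_kernel (t - s) (y - x) * \<sigma> (u s y \<omega>))) I"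
      "AE \<omega> in M. set_integrable lborel ({0<..<t} \<times> UNIV) (\<lambda>(s, y). heat_kernel (t - s) (y - x) * c (u s y \<omega>)) \<and>
        u t x \<omega> = (\<integral>y. heat_kernel t (x - y) * u\<^sub>0 y \<partial>lebesgue)
            + (LINT z:{0<..<t} \<times> UNIV|lborel. (case z of (s, y) \<Rightarrow> heat_kernel (t - s) (y - x) * c (u s y \<omega>))) + I \<omega>"
      using ex by (elim exE conjE) (rule that)
    have "has_walsh_integral M W (conv_integrand \<sigma> u t x) I"
      using I(1) by (simp add: conv_integrand_def[abs_def])
    moreover have "AE \<omega> in M. integrable lborel (\<lambda>z. kern t x z * c (u (fst z) (snd z) \<omega>)) \<and>
      u t x \<omega> = (\<integral>y. heat_kernel t (x - y) * u\<^sub>0 y \<partial>lebesgue) + drift c (\<lambda>s y. u s y \<omega>) t x + I \<omega>"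
      using I(2) by (simp only: set_integrable_def set_lebesgue_integral_def eq drift_def)
    ultimately show ?thesis unfolding P_def by blast
  qed
  define J where "J t x = (SOME I. P t x I)" for t x
  have J: "P t x (J t x)" if "0 < t" for t x
    unfolding J_def by (rule someI_ex[OF ex[OF that]])
  define I where "I t x = (if 0 < t then J t x else (\<lambda>_. 0))" for t x
  show thesis
  proof (rule that[of I])
    fix t x
    show "has_walsh_integral M W (conv_integrand \<sigma> u t x) (I t x)"
    proof (cases "0 < t")
      case False
      then have "conv_integrand \<sigma> u t x = (\<lambda>s y \<omega>. 0)" by (auto simp: conv_integrand_def fun_eq_iff)
      then show ?thesis using False has_walsh_integral_zero by (simp add: I_def)
    qed (use J in \<open>simp add: I_def P_def\<close>)
  qed (use J in \<open>auto simp: I_def P_def\<close>)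
qed

text \<open>The deterministic part, for a single outcome. From \<open>\<tau> / 4\<close> to
  \<open>\<tau> / 2\<close> the convolution on the island is at least \<open>H + B\<close>, where
  \<open>B\<close> pays for the initial datum. The level \<open>H + J\<close> is reached there
  before time \<open>3 / 8 * \<tau>\<close> and held until \<open>\<tau> / 2\<close>. At least
  \<open>\<tau> / 2\<close> of time then remains for the heat kernel to carry
  \<open>b (H + J)\<close> over the distance \<open>D\<close> into the box.\<close>

lemma path_lower_bound:
  fixes U Z :: "real \<Rightarrow> real \<Rightarrow> real" and b :: "real \<Rightarrow> real"
  assumes b: "mono b" "\<And>y. 0 < b y"
    and \<tau>: "0 < \<tau>" "\<tau> < 1" and m: "1 \<le> m"
    and cont: "continuous_on ({0<..} \<times> UNIV) (\<lambda>(t, x). U t x)"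
    and eq: "\<And>t x. gridpt t x \<Longrightarrow> 0 < t \<Longrightarrow>
      integrable lborel (\<lambda>z. kern t x z * b (U (fst z) (snd z))) \<and> - B + drift b U t x + Z t x \<le> U t x"
    and island: "\<And>t x. gridpt t x \<Longrightarrow> \<tau> / 4 \<le> t \<Longrightarrow> t \<le> \<tau> / 2 \<Longrightarrow> \<bar>x - c\<bar> \<le> 1 \<Longrightarrow> H + B \<le> Z t x"
    and osg: "(\<Sum>i<J. 6 / b (H + real i)) < \<tau> / 8"
    and box: "\<And>t x. gridpt t x \<Longrightarrow> 0 < t \<Longrightarrow> t \<le> real m \<Longrightarrow> \<bar>x\<bar> \<le> real m \<Longrightarrow> - A \<le> Z t x"
    and c: "\<bar>c\<bar> + real m + 1 \<le> D"
    and K: "K \<le> - B - A + b (H + real J) * (2 * (exp (- D\<^sup>2 / (2 * (\<tau> / 2))) / sqrt (2 * pi * real m)) * (\<tau> / 2 - 3 / 8 * \<tau>))"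
    and tx: "\<tau> \<le> t" "t \<le> real m" "\<bar>x\<bar> \<le> real m"
  shows "K \<le> U t x"
proof -
  have "1 \<le> real m" using m by simp
  then have mr: "\<tau> < real m" "0 < real m" using \<tau> by linarith+
  define T where "T j = \<tau> / 4 + (\<Sum>i<j. 6 / b (H + real i))" for j
  have TJ: "T J < 3 / 8 * \<tau>" using osg by (simp add: T_def)
  have high: "H + real J \<le> U t x" if "3 / 8 * \<tau> \<le> t" "t \<le> \<tau> / 2" "\<bar>x - c\<bar> \<le> 1" for t x
  proof (rule island_levels[where T=T and b=b and U=U and t\<^sub>0="\<tau> / 2" and c=c])
    fix t x assume g: "gridpt t x" "T 0 \<le> t" "t \<le> \<tau> / 2" "\<bar>x - c\<bar> \<le> 1"
    have "H + B \<le> Z t x" by (rule island) (use g in \<open>auto simp: T_def\<close>)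
    then show "integrable lborel (\<lambda>z. kern t x z * b (U (fst z) (snd z))) \<and> H + drift b U t x \<le> U t x"
      using eq[OF g(1)] g \<tau> by (auto simp: T_def)
  qed (use b cont \<tau> TJ that in \<open>auto simp: T_def\<close>)
  show ?thesis
  proof (rule gridpt_dense_ge[OF cont, of \<tau> "real m" "- real m" "real m"])
    fix t x assume g: "gridpt t x" "\<tau> \<le> t" "t \<le> real m" "- real m \<le> x" "x \<le> real m"
    have e: "integrable lborel (\<lambda>z. kern t x z * b (U (fst z) (snd z)))" "- B + drift b U t x + Z t x \<le> U t x"
      using eq[OF g(1)] g \<tau> by auto
    have z: "- A \<le> Z t x" by (rule box) (use g \<tau> in auto)
    let ?\<kappa> = "exp (- D\<^sup>2 / (2 * (\<tau> / 2))) / sqrt (2 * pi * real m)"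
    \<comment> \<open>One strip suffices: the island from time \<open>3 / 8 * \<tau>\<close> to
      \<open>\<tau> / 2\<close>. The rest of the drift is nonnegative.\<close>
    have "(\<Sum>i\<in>{()}. b (H + real J) * (2 * ?\<kappa> * (\<tau> / 2 - 3 / 8 * \<tau>))) \<le> drift b U t x"
    proof (rule drift_strips[where S="\<lambda>_. {3 / 8 * \<tau><..<\<tau> / 2} \<times> {c - 1<..c + 1}" and t=t and x=x and b=b and U=U])
      show "integrable lborel (\<lambda>z. kern t x z * b (U (fst z) (snd z)))" by (rule e(1))
      show "{3 / 8 * \<tau><..<\<tau> / 2} \<times> {c - 1<..c + 1} \<in> sets borel"
        unfolding borel_prod[symmetric] by (intro pair_measureI) auto
      show "ennreal (2 * ?\<kappa> * (\<tau> / 2 - 3 / 8 * \<tau>)) \<le> (\<integral>\<^sup>+z. ennreal (kern t x z) * indicator ({3 / 8 * \<tau><..<\<tau> / 2} \<times> {c - 1<..c + 1}) z \<partial>lborel)"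
        by (rule kern_strip_far) (use \<tau> g c in auto)
      show "0 \<le> 2 * ?\<kappa> * (\<tau> / 2 - 3 / 8 * \<tau>)" using \<tau> by simp
      fix s y assume "(s, y) \<in> {3 / 8 * \<tau><..<\<tau> / 2} \<times> {c - 1<..c + 1}"
      then have "H + real J \<le> U s y" by (intro high) auto
      then show "b (H + real J) \<le> b (U s y)" by (rule monoD[OF b(1)])
    qed (use b(2) in \<open>auto intro: less_imp_le simp: disjoint_family_on_def\<close>)
    then show "K \<le> U t x" using K z e(2) by simp
  qed (use \<tau> mr tx in auto)
qed

text \<open>The upward push that the tilt exerts on the convolution, per unit of \<open>h\<close>:
  at each past time the heat kernel has at least one sixth of its mass on the island, and there
  \<open>\<sigma>\<close> is at least \<open>\<sigma>\<^sub>1\<close>.\<close>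

lemma ip_slice_lower:
  fixes u :: "real \<Rightarrow> real \<Rightarrow> 'a \<Rightarrow> real"
  assumes L: "slice (conv_integrand \<sigma> u t x) \<omega> \<in> L2_halfplane"
    and \<sigma>: "\<And>y. \<sigma>\<^sub>1 \<le> \<sigma> y" "0 < \<sigma>\<^sub>1"
    and t: "0 \<le> t" "t \<le> t\<^sub>0" "t\<^sub>0 \<le> 1" and x: "\<bar>x - c\<bar> \<le> 1"
  shows "\<sigma>\<^sub>1 * (t / 6) \<le> ip (slice (conv_integrand \<sigma> u t x) \<omega>) (indicat_real ({0<..t\<^sub>0} \<times> {c - 1<..c + 1}))"
proof -
  let ?R = "{0<..t\<^sub>0} \<times> {c - 1<..c + 1}" and ?S = "{0<..<t} \<times> {c - 1<..c + 1}"
  have R: "indicat_real ?R \<in> L2_halfplane" by (intro L2_halfplane_indicator) auto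
  have [measurable]: "?S \<in> sets borel" unfolding borel_prod[symmetric] by (intro pair_measureI) auto
  have nn: "0 \<le> kern t x z * \<sigma> w" for z w
    using kern_nonneg \<sigma>(1)[of w] \<sigma>(2) by (intro mult_nonneg_nonneg) auto
  have "ennreal (\<sigma>\<^sub>1 * (t / 6)) = ennreal \<sigma>\<^sub>1 * ennreal (1 / 6 * (t - 0))"
    using \<sigma> t by (subst ennreal_mult[symmetric]) auto
  also have "\<dots> \<le> ennreal \<sigma>\<^sub>1 * (\<integral>\<^sup>+z. ennreal (kern t x z) * indicator ?S z \<partial>lborel)"
    using t x by (intro mult_left_mono kern_strip_near) auto
  also have "\<dots> = (\<integral>\<^sup>+z. ennreal \<sigma>\<^sub>1 * (ennreal (kern t x z) * indicator ?S z) \<partial>lborel)"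
    by (rule nn_integral_cmult[symmetric]) auto
  also have "\<dots> \<le> (\<integral>\<^sup>+z. ennreal (slice (conv_integrand \<sigma> u t x) \<omega> z * indicat_real ?R z) \<partial>lborel)"
  proof (rule nn_integral_mono)
    fix z
    show "ennreal \<sigma>\<^sub>1 * (ennreal (kern t x z) * indicator ?S z) \<le> ennreal (slice (conv_integrand \<sigma> u t x) \<omega> z * indicat_real ?R z)"
    proof (cases "z \<in> ?S")
      case True
      then have "z \<in> ?R" using t by auto
      have "ennreal \<sigma>\<^sub>1 * ennreal (kern t x z) = ennreal (kern t x z * \<sigma>\<^sub>1)"
        using \<sigma>(2) kern_nonneg by (simp add: ennreal_mult mult.commute)
      also have "\<dots> \<le> ennreal (kern t x z * \<sigma> (u (fst z) (snd z) \<omega>))"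
        using \<sigma>(1) kern_nonneg by (intro ennreal_leI mult_left_mono) auto
      finally show ?thesis using True \<open>z \<in> ?R\<close> by (simp add: slice_conv_integrand)
    qed simp
  qed
  also have "\<dots> = ennreal (ip (slice (conv_integrand \<sigma> u t x) \<omega>) (indicat_real ?R))"
    by (rule nn_integral_eq_integral[OF integrable_ip[OF L R]])
      (use nn in \<open>auto simp: slice_conv_integrand indicator_def\<close>)
  finally show ?thesis
    using nn by (subst (asm) ennreal_le_iff) (auto simp: slice_conv_integrand intro!: Bochner_Integration.integral_nonneg)
qed

text \<open>The exponent in the second moment of one tilted density: \<open>h\<^sup>2\<close> times
  the area.\<close>

lemma ip_rectangle:
  assumes "0 \<le> t" "R = {0<..t} \<times> {c - 1<..c + 1 :: real}"
  shows "ip (\<lambda>z. h * indicat_real R z) (\<lambda>z. h * indicat_real R z) = h\<^sup>2 * (2 * t)"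
proof -
  have "emeasure lborel R = emeasure lborel {0<..t} * emeasure lborel {c - 1<..c + 1}"
    unfolding assms(2) lborel_prod[symmetric] by (intro lborel.emeasure_pair_measure_Times) auto
  also have "\<dots> = ennreal (t * 2)" using assms(1) by (simp add: ennreal_mult)
  finally have "measure lborel R = 2 * t" using assms(1) by (simp add: measure_def)
  moreover have "ip (\<lambda>z. h * indicat_real R z) (\<lambda>z. h * indicat_real R z) = (\<integral>z. h\<^sup>2 * indicat_real R z \<partial>lborel)"
    by (intro Bochner_Integration.integral_cong) (auto simp: indicator_def power2_eq_square)
  ultimately show ?thesis by simp
qed

text \<open>The exceptional event has two parts. On \<open>F\<^sub>2\<close> the convolution is
  large somewhere on the box; its probability is at most \<open>\<epsilon>\<close>. On
  \<open>F\<^sub>1\<close> none of the \<open>N\<close> islands behaves as it typically does under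
  its own tilt; averaging over the tilts bounds its probability by \<open>2 * \<epsilon>\<close>.
  Outside both, the deterministic path estimate applies.\<close>

lemma (in noise_space) high_probability:
  assumes b: "mono b" "\<And>y. 0 < b y" and summ: "summable (\<lambda>i. 1 / b (real i + 2))"
    and u0: "\<And>x. \<bar>u\<^sub>0 x\<bar> \<le> B"
    and \<sigma>: "\<And>y. \<sigma>\<^sub>1 \<le> \<sigma> y" "\<And>y. \<sigma> y \<le> \<sigma>\<^sub>2" "0 < \<sigma>\<^sub>1"
    and \<tau>: "0 < \<tau>" "\<tau> < 1" and m: "1 \<le> m" and \<epsilon>: "0 < \<epsilon>"
  shows "\<exists>n\<^sub>0. \<forall>n\<ge>n\<^sub>0. \<forall>v. random_field_solution M W \<sigma> (\<lambda>y. min (b y) (real n)) u\<^sub>0 v \<longrightarrow>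
      (AE \<omega> in M. continuous_on ({0<..} \<times> UNIV) (\<lambda>(t, x). v t x \<omega>)) \<longrightarrow>
      (\<exists>F\<in>sets M. prob F \<le> 3 * \<epsilon> \<and>
        (AE \<omega> in M. \<omega> \<notin> F \<longrightarrow> (\<forall>t x. \<tau> \<le> t \<longrightarrow> t \<le> real m \<longrightarrow> \<bar>x\<bar> \<le> real m \<longrightarrow> K \<le> v t x \<omega>)))"
proof -
  have \<sigma>2: "0 < \<sigma>\<^sub>2" using \<sigma>(1,2)[of 0] \<sigma>(3) by linarith
  have abs\<sigma>: "\<bar>\<sigma> y\<bar> \<le> \<sigma>\<^sub>2" for y using \<sigma>(1,2)[of y] \<sigma>(3) by linarith
  have B: "0 \<le> B" using u0[of 0] by linarith
  have mr: "0 < real m" using m by simp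
  have cc: "0 \<le> chain_const k" for k using chain_ratio by (simp add: chain_const_def)
  \<comment> \<open>The fluctuation level on an island, found before the tilt is fixed; a box of
    size 1 covers the island.\<close>
  obtain a\<^sub>1 where a1: "0 < a\<^sub>1" "chain_err (8 * \<sigma>\<^sub>2\<^sup>2 * real 1) 1 a\<^sub>1 \<le> \<epsilon>"
    using chain_err_small[OF \<epsilon>] by blast
  define A\<^sub>1 where "A\<^sub>1 = a\<^sub>1 * chain_const 1"
  have A1: "0 \<le> A\<^sub>1" unfolding A\<^sub>1_def using a1 cc by simp
  obtain a\<^sub>2 where a2: "0 < a\<^sub>2" "chain_err (8 * \<sigma>\<^sub>2\<^sup>2 * real m) m a\<^sub>2 \<le> \<epsilon>"
    using chain_err_small[OF \<epsilon>] by blast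
  define A\<^sub>2 where "A\<^sub>2 = a\<^sub>2 * chain_const m"
  \<comment> \<open>A tail of the Osgood series below \<open>\<tau> / 48\<close> makes the climbing
    times, which carry the factor 6, sum to less than \<open>\<tau> / 8\<close>.\<close>
  obtain p where p: "norm (\<Sum>i. 1 / b (real (i + p) + 2)) < \<tau> / 48"
    using suminf_exist_split[OF _ summ, of "\<tau> / 48"] \<tau> by auto
  define H where "H = real p + 2"
  have sumH: "(\<Sum>i<J. 6 / b (H + real i)) < \<tau> / 8" for J
  proof -
    have s: "summable (\<lambda>i. 1 / b (real (i + p) + 2))"
      using summ by (subst summable_iff_shift[of "\<lambda>i. 1 / b (real i + 2)" p])
    have "(\<Sum>i<J. 1 / b (real (i + p) + 2)) \<le> (\<Sum>i. 1 / b (real (i + p) + 2))"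
      using b(2) by (intro sum_le_suminf s) (auto intro: less_imp_le)
    then have "(\<Sum>i<J. 1 / b (real (i + p) + 2)) < \<tau> / 48" using p by simp
    moreover have "(\<Sum>i<J. 6 / b (H + real i)) = 6 * (\<Sum>i<J. 1 / b (real (i + p) + 2))"
      by (simp add: sum_distrib_left H_def add_ac)
    ultimately show ?thesis by simp
  qed
  \<comment> \<open>For \<open>t \<ge> \<tau> / 4\<close> the push is at least
    \<open>h * \<sigma>\<^sub>1 * \<tau> / 24\<close>. It has to pay for the starting level
    \<open>H\<close>, the initial datum and the fluctuations.\<close>
  define h where "h = 24 * (H + B + A\<^sub>1) / (\<sigma>\<^sub>1 * \<tau>)"
  have h0: "0 \<le> h" using \<sigma>(3) \<tau> B A1 by (simp add: h_def H_def)
  have h: "H + B \<le> - A\<^sub>1 + h * (\<sigma>\<^sub>1 * (t / 6))" if "\<tau> / 4 \<le> t" for t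
  proof -
    have "H + B + A\<^sub>1 = h * (\<sigma>\<^sub>1 * ((\<tau> / 4) / 6))" using \<sigma>(3) \<tau> by (simp add: h_def)
    also have "\<dots> \<le> h * (\<sigma>\<^sub>1 * (t / 6))" using that h0 \<sigma>(3) by (intro mult_left_mono) auto
    finally show ?thesis by linarith
  qed
  \<comment> \<open>\<open>h\<^sup>2\<close> times the area of an island, which has duration
    \<open>\<tau> / 2\<close> and width 2.\<close>
  define q where "q = h\<^sup>2 * \<tau>"
  obtain N :: nat where N: "exp q / \<epsilon>\<^sup>2 < real N" using reals_Archimedean2 by blast
  have N0: "0 < N" using N \<epsilon> by (metis divide_nonneg_nonneg exp_ge_zero gr0I not_less of_nat_0 zero_le_power2)
  have Nq: "exp q / (real N * \<epsilon>) \<le> \<epsilon>"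
  proof -
    have "exp q < real N * \<epsilon>\<^sup>2" using N \<epsilon> by (simp add: divide_less_eq)
    then show ?thesis using N0 \<epsilon> by (simp add: divide_le_eq power2_eq_square mult_ac)
  qed
  \<comment> \<open>The islands are centred at the even numbers below \<open>2 * N\<close>; the
    remaining terms are the half-widths of the box and of an island.\<close>
  define D where "D = 2 * real N + real m + 1"
  define \<kappa> where "\<kappa> = 2 * (exp (- D\<^sup>2 / (2 * (\<tau> / 2))) / sqrt (2 * pi * real m)) * (\<tau> / 2 - 3 / 8 * \<tau>)"
  have \<kappa>: "0 < \<kappa>" using \<tau> mr by (simp add: \<kappa>_def)
  obtain J :: nat where J: "K \<le> - B - A\<^sub>2 + b (H + real J) * \<kappa>"
  proof -
    define X where "X = max 1 ((K + B + A\<^sub>2) / \<kappa>)"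
    have X: "0 < X" by (simp add: X_def)
    \<comment> \<open>Summability makes \<open>b\<close> unbounded, so that any \<open>K\<close> is
      within reach despite the tiny factor \<open>\<kappa>\<close>.\<close>
    have "(\<lambda>i. 1 / b (real i + 2)) \<longlonglongrightarrow> 0" by (rule summable_LIMSEQ_zero[OF summ])
    then have "\<forall>\<^sub>F i in sequentially. 1 / b (real i + 2) < 1 / X"
      using X by (intro order_tendstoD(2)) auto
    then obtain i where "1 / b (real i + 2) < 1 / X" by (auto simp: eventually_sequentially)
    then have "X < b (real i + 2)" using X b(2)[of "real i + 2"] by (simp add: field_simps)
    also have "b (real i + 2) \<le> b (H + real i)" by (rule monoD[OF b(1)]) (simp add: H_def)
    finally have "(K + B + A\<^sub>2) / \<kappa> \<le> b (H + real i)" by (simp add: X_def)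
    then have "K + B + A\<^sub>2 \<le> b (H + real i) * \<kappa>" using \<kappa> by (simp add: divide_le_eq)
    then show thesis by (intro that[of i]) simp
  qed
  \<comment> \<open>From \<open>n\<^sub>0\<close> on the truncation leaves \<open>b\<close>
    unchanged at all levels up to \<open>H + J\<close>, and the truncated drift is positive.\<close>
  obtain n\<^sub>0 :: nat where n0: "max 1 (b (H + real J)) < real n\<^sub>0" using reals_Archimedean2 by blast
  define R where "R i = {0<..\<tau> / 2} \<times> {real_of_int (2 * int i) - 1<..real_of_int (2 * int i) + 1}" for i :: nat
  have RL: "indicat_real (R i) \<in> L2_halfplane" for i
    unfolding R_def by (intro L2_halfplane_indicator) auto
  show ?thesis
  proof (intro exI[of _ n\<^sub>0] allI impI)
    fix n v
    assume n: "n\<^sub>0 \<le> n" and sol: "random_field_solution M W \<sigma> (\<lambda>y. min (b y) (real n)) u\<^sub>0 v"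
      and cont: "AE \<omega> in M. continuous_on ({0<..} \<times> UNIV) (\<lambda>(t, x). v t x \<omega>)"
    let ?c = "\<lambda>y. min (b y) (real n)"
    have n1: "1 < real n" "b (H + real J) < real n" using n n0 by auto
    have c: "mono ?c" "\<And>y. 0 < ?c y"
      using b n1 by (auto simp: mono_def min_def intro: order_trans)
    have cb: "?c (H + real i) = b (H + real i)" if "i \<le> J" for i
      using monoD[OF b(1), of "H + real i" "H + real J"] that n1 by auto
    obtain I where I: "\<And>t x. has_walsh_integral M W (conv_integrand \<sigma> v t x) (I t x)" "\<And>x \<omega>. I 0 x \<omega> = 0"
      "\<And>t x. 0 < t \<Longrightarrow> AE \<omega> in M. integrable lborel (\<lambda>z. kern t x z * ?c (v (fst z) (snd z) \<omega>)) \<and>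
        v t x \<omega> = (\<integral>y. heat_kernel t (x - y) * u\<^sub>0 y \<partial>lebesgue) + drift ?c (\<lambda>s y. v s y \<omega>) t x + I t x \<omega>"
      by (rule mild_formE[OF sol]) blast
    define F\<^sub>2 where "F\<^sub>2 = {\<omega> \<in> space M. \<not> grid_bound I m (real_of_int 0) A\<^sub>2 \<omega>}"
    define E where "E i = {\<omega> \<in> space M. \<not> grid_bound (shifted \<sigma> v I h (R i)) 1 (real_of_int (2 * int i)) A\<^sub>1 \<omega>}" for i
    define F\<^sub>1 where "F\<^sub>1 = (\<Inter>i\<in>{..<N}. E i)"
    have F2: "F\<^sub>2 \<in> sets M" "prob F\<^sub>2 \<le> \<epsilon>"
    proof -
      show "F\<^sub>2 \<in> sets M" unfolding F\<^sub>2_def A\<^sub>2_def by (rule conv_grid_bound[OF I(1,2) abs\<sigma> \<sigma>2 m a2(1)])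
      have "emeasure M F\<^sub>2 \<le> ennreal (chain_err (8 * \<sigma>\<^sub>2\<^sup>2 * real m) m a\<^sub>2)"
        unfolding F\<^sub>2_def A\<^sub>2_def by (rule conv_grid_bound[OF I(1,2) abs\<sigma> \<sigma>2 m a2(1)])
      also have "\<dots> \<le> ennreal \<epsilon>" using a2(2) by (rule ennreal_leI)
      finally show "prob F\<^sub>2 \<le> \<epsilon>" using \<epsilon> by (simp add: emeasure_eq_measure)
    qed
    have E: "E i \<in> sets M" "emeasure (density M (\<lambda>\<omega>. ennreal (dens (\<lambda>z. h * indicat_real (R i) z) \<omega>))) (E i) \<le> ennreal \<epsilon>" for i
    proof -
      have t2: "0 \<le> \<tau> / 2" using \<tau> by simp
      have R': "{real_of_int (2 * int i) - 1<..real_of_int (2 * int i) + 1} \<in> sets borel"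
        "emeasure lborel {real_of_int (2 * int i) - 1<..real_of_int (2 * int i) + 1} < \<infinity>" by auto
      note Ri = R_def[of i] t2 R'
      show "E i \<in> sets M"
        unfolding E_def by (intro sets.sets_Collect_neg grid_bound_measurable shifted_measurable[OF I(1,2) abs\<sigma> \<sigma>2 Ri])
      have "emeasure (density M (\<lambda>\<omega>. ennreal (dens (\<lambda>z. h * indicat_real (R i) z) \<omega>))) (E i) \<le> ennreal (chain_err (8 * \<sigma>\<^sub>2\<^sup>2 * real 1) 1 a\<^sub>1)"
        unfolding E_def A\<^sub>1_def by (rule shifted_grid_bound[OF I(1,2) abs\<sigma> \<sigma>2 Ri _ a1(1)]) simp
      also have "\<dots> \<le> ennreal \<epsilon>" using a1(2) by (rule ennreal_leI)
      finally show "emeasure (density M (\<lambda>\<omega>. ennreal (dens (\<lambda>z. h * indicat_real (R i) z) \<omega>))) (E i) \<le> ennreal \<epsilon>" .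
    qed
    have F1: "F\<^sub>1 \<in> sets M" "prob F\<^sub>1 \<le> 2 * \<epsilon>"
    proof -
      show F1s: "F\<^sub>1 \<in> sets M" unfolding F\<^sub>1_def using E(1) N0 by (intro sets.finite_INT) auto
      \<comment> \<open>With the AM-GM weight \<open>\<epsilon>\<close> and the choice of
        \<open>N\<close>, the averaging error is at most \<open>\<epsilon>\<close>.\<close>
      have "prob F\<^sub>1 \<le> \<epsilon> + (\<epsilon> + exp q / (real N * \<epsilon>)) / 2"
      proof (rule average_tilt[where \<eta>="\<lambda>i z. h * indicat_real (R i) z", OF _ N0 \<epsilon> _ _ F1s])
        show "(\<lambda>z. h * indicat_real (R i) z) \<in> L2_halfplane" for i by (rule L2_halfplane_scale[OF RL])
        show "ip (\<lambda>z. h * indicat_real (R i) z) (\<lambda>z. h * indicat_real (R i) z) \<le> q" for i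
          using ip_rectangle[of "\<tau> / 2" "R i" "real_of_int (2 * int i)" h] \<tau> by (simp add: R_def q_def)
        fix i j :: nat assume ij: "i < N" "j < N" "i \<noteq> j"
        have disj: "R i \<inter> R j = {}"
        proof (rule ccontr)
          assume "R i \<inter> R j \<noteq> {}"
          then obtain y where "2 * real i - 1 < y" "y \<le> 2 * real i + 1" "2 * real j - 1 < y" "y \<le> 2 * real j + 1"
            by (auto simp: R_def)
          then have "real i < real j + 1" "real j < real i + 1" by linarith+
          then show False using ij(3) by linarith
        qed
        show "ip (\<lambda>z. h * indicat_real (R i) z) (\<lambda>z. h * indicat_real (R j) z) = 0"
          by (rule ip_disjoint) (use disj in \<open>auto simp: indicator_def\<close>)
      next
        fix i assume "i < N"
        then have "F\<^sub>1 \<subseteq> E i" by (auto simp: F\<^sub>1_def)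
        then have "emeasure (density M (\<lambda>\<omega>. ennreal (dens (\<lambda>z. h * indicat_real (R i) z) \<omega>))) F\<^sub>1
          \<le> emeasure (density M (\<lambda>\<omega>. ennreal (dens (\<lambda>z. h * indicat_real (R i) z) \<omega>))) (E i)"
          using E(1) by (intro emeasure_mono) auto
        also have "\<dots> \<le> ennreal \<epsilon>" by (rule E(2))
        finally show "emeasure (density M (\<lambda>\<omega>. ennreal (dens (\<lambda>z. h * indicat_real (R i) z) \<omega>))) F\<^sub>1 \<le> ennreal \<epsilon>" .
      qed (use \<epsilon> in simp)
      moreover have "y \<le> 2 * e" if "y \<le> e + (e + r) / 2" "r \<le> e" for y e r :: real
        using that by (simp add: field_simps)
      ultimately show "prob F\<^sub>1 \<le> 2 * \<epsilon>" using Nq by blast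
    qed
    show "\<exists>F\<in>sets M. prob F \<le> 3 * \<epsilon> \<and>
        (AE \<omega> in M. \<omega> \<notin> F \<longrightarrow> (\<forall>t x. \<tau> \<le> t \<longrightarrow> t \<le> real m \<longrightarrow> \<bar>x\<bar> \<le> real m \<longrightarrow> K \<le> v t x \<omega>))"
    proof (intro bexI[of _ "F\<^sub>1 \<union> F\<^sub>2"] conjI)
      show "F\<^sub>1 \<union> F\<^sub>2 \<in> sets M" using F1 F2 by simp
      show "prob (F\<^sub>1 \<union> F\<^sub>2) \<le> 3 * \<epsilon>"
        using measure_Un_le[OF F1(1) F2(1)] F1(2) F2(2) by linarith
      \<comment> \<open>Countability of the dyadic points yields one null set outside of which the
        equation and the square integrability of the integrand hold at all of them.\<close>
      have "AE \<omega> in M. \<forall>p\<in>{p. gridpt (fst p) (snd p)}. 0 < fst p \<longrightarrow>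
        (slice (conv_integrand \<sigma> v (fst p) (snd p)) \<omega> \<in> L2_halfplane \<and>
         integrable lborel (\<lambda>z. kern (fst p) (snd p) z * ?c (v (fst z) (snd z) \<omega>)) \<and>
         v (fst p) (snd p) \<omega> = (\<integral>y. heat_kernel (fst p) (snd p - y) * u\<^sub>0 y \<partial>lebesgue) + drift ?c (\<lambda>s y. v s y \<omega>) (fst p) (snd p) + I (fst p) (snd p) \<omega>)"
      proof (subst AE_ball_countable[OF countable_gridpt], intro ballI)
        fix p :: "real \<times> real"
        show "AE \<omega> in M. 0 < fst p \<longrightarrow>
          (slice (conv_integrand \<sigma> v (fst p) (snd p)) \<omega> \<in> L2_halfplane \<and>
           integrable lborel (\<lambda>z. kern (fst p) (snd p) z * ?c (v (fst z) (snd z) \<omega>)) \<and>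
           v (fst p) (snd p) \<omega> = (\<integral>y. heat_kernel (fst p) (snd p - y) * u\<^sub>0 y \<partial>lebesgue) + drift ?c (\<lambda>s y. v s y \<omega>) (fst p) (snd p) + I (fst p) (snd p) \<omega>)"
        proof (cases "0 < fst p")
          case True
          show ?thesis using walsh_exp(1)[OF I(1)[of "fst p" "snd p"]] I(3)[OF True, of "snd p"]
            by eventually_elim blast
        qed simp
      qed
      then show "AE \<omega> in M. \<omega> \<notin> F\<^sub>1 \<union> F\<^sub>2 \<longrightarrow> (\<forall>t x. \<tau> \<le> t \<longrightarrow> t \<le> real m \<longrightarrow> \<bar>x\<bar> \<le> real m \<longrightarrow> K \<le> v t x \<omega>)"
        using cont AE_space
      proof eventually_elim
        case (elim \<omega>)
        show ?case
        proof (intro impI allI)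
          fix t x assume \<omega>: "\<omega> \<notin> F\<^sub>1 \<union> F\<^sub>2" and tx: "\<tau> \<le> t" "t \<le> real m" "\<bar>x\<bar> \<le> real m"
          \<comment> \<open>Some island is good at this outcome. From here on only its pathwise
            bound is used, without any tilted measure.\<close>
          obtain i where i: "i < N" "\<omega> \<notin> E i" using \<omega> by (auto simp: F\<^sub>1_def)
          let ?i = "real_of_int (2 * int i)"
          have g1: "grid_bound (shifted \<sigma> v I h (R i)) 1 ?i A\<^sub>1 \<omega>" using i elim(3) by (simp add: E_def)
          have g2: "grid_bound I m (real_of_int 0) A\<^sub>2 \<omega>" using \<omega> elim(3) by (simp add: F\<^sub>2_def)
          have at: "slice (conv_integrand \<sigma> v t x) \<omega> \<in> L2_halfplane"
            "integrable lborel (\<lambda>z. kern t x z * ?c (v (fst z) (snd z) \<omega>))"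
            "v t x \<omega> = (\<integral>y. heat_kernel t (x - y) * u\<^sub>0 y \<partial>lebesgue) + drift ?c (\<lambda>s y. v s y \<omega>) t x + I t x \<omega>"
            if "gridpt t x" "0 < t" for t x
            using elim(1) that by (auto dest!: bspec[of _ _ "(t, x)"])
          show "K \<le> v t x \<omega>"
          proof (rule path_lower_bound[where U="\<lambda>t x. v t x \<omega>" and t=t and x=x and b="?c" and \<tau>=\<tau> and m=m and B=B and Z="\<lambda>t x. I t x \<omega>" and H=H and c="?i" and A=A\<^sub>2 and D=D and J=J])
            show "continuous_on ({0<..} \<times> UNIV) (\<lambda>(t, x). v t x \<omega>)" by (rule elim(2))
            show "integrable lborel (\<lambda>z. kern t x z * ?c (v (fst z) (snd z) \<omega>)) \<and> - B + drift ?c (\<lambda>s y. v s y \<omega>) t x + I t x \<omega> \<le> v t x \<omega>"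
              if "gridpt t x" "0 < t" for t x
              using at[OF that] initial_lower[of u\<^sub>0 B t x, OF u0 that(2)] by simp
            \<comment> \<open>The shifted field is at least \<open>- A\<^sub>1\<close> on the
              island, so the convolution is at least the push minus
              \<open>A\<^sub>1\<close>.\<close>
            show "H + B \<le> I t x \<omega>" if tx: "gridpt t x" "\<tau> / 4 \<le> t" "t \<le> \<tau> / 2" "\<bar>x - ?i\<bar> \<le> 1" for t x
            proof -
              have "\<bar>shifted \<sigma> v I h (R i) t x \<omega>\<bar> \<le> A\<^sub>1"
                by (rule grid_boundD[OF g1 tx(1)]) (use tx \<tau> in auto)
              moreover have "\<sigma>\<^sub>1 * (t / 6) \<le> ip (slice (conv_integrand \<sigma> v t x) \<omega>) (indicat_real (R i))"
                unfolding R_def by (rule ip_slice_lower[OF at(1)[OF tx(1)] \<sigma>(1,3)]) (use tx \<tau> in auto)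
              then have "h * (\<sigma>\<^sub>1 * (t / 6)) \<le> h * ip (slice (conv_integrand \<sigma> v t x) \<omega>) (indicat_real (R i))"
                using h0 by (rule mult_left_mono)
              ultimately show ?thesis using h[OF tx(2)] unfolding shifted_def by linarith
            qed
            show "(\<Sum>i<J. 6 / ?c (H + real i)) < \<tau> / 8"
            proof -
              have "(\<Sum>i<J. 6 / ?c (H + real i)) = (\<Sum>i<J. 6 / b (H + real i))"
                by (intro sum.cong refl) (simp only: cb lessThan_iff less_imp_le)
              then show ?thesis using sumH[of J] by simp
            qed
            show "- A\<^sub>2 \<le> I t x \<omega>" if "gridpt t x" "0 < t" "t \<le> real m" "\<bar>x\<bar> \<le> real m" for t x
              using grid_boundD[OF g2 that(1)] that by force
            show "\<bar>?i\<bar> + real m + 1 \<le> D" using i by (simp add: D_def)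
            show "K \<le> - B - A\<^sub>2 + ?c (H + real J) * (2 * (exp (- D\<^sup>2 / (2 * (\<tau> / 2))) / sqrt (2 * pi * real m)) * (\<tau> / 2 - 3 / 8 * \<tau>))"
              unfolding cb[OF order_refl] \<kappa>_def[symmetric] by (rule J)
          qed (use c \<tau> m tx in auto)
        qed
      qed
    qed
  qed
qed

theorem theorem1p5:
  fixes M :: "'a measure"
    and W :: "(real \<times> real \<Rightarrow> real) \<Rightarrow> 'a \<Rightarrow> real"
    and \<sigma> b u\<^sub>0 :: "real \<Rightarrow> real"
    and u :: "real \<Rightarrow> real \<Rightarrow> 'a \<Rightarrow> ereal"
  assumes "prob_space M" and "complete_measure M"
    and "white_noise M W"
    and "\<And>x. 0 < \<sigma> x" and "\<exists>L. L-lipschitz_on UNIV \<sigma>"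
    and "0 < (INF x. \<sigma> x)" and "bdd_above (range \<sigma>)"
    and "\<And>x. 0 < b x" and "locally_lipschitz b" and "mono b"
    and "u\<^sub>0 \<in> borel_measurable lebesgue" and "bounded (range u\<^sub>0)"
    and "(\<integral>\<^sup>+y\<in>{1..}. ennreal (1 / b y) \<partial>lborel) < \<infinity>"
    and "minimal_solution M W \<sigma> b u\<^sub>0 u"
  shows "measure M {\<omega> \<in> space M. \<forall>t>0. \<forall>x. u t x \<omega> = \<infinity>} = 1"
proof -
  interpret prob_space M by fact
  interpret noise_space M W by unfold_locales fact
  have summ: "summable (\<lambda>i. 1 / b (real i + 2))"
    by (rule osgood_summable) fact+
  obtain B where B: "\<And>x. \<bar>u\<^sub>0 x\<bar> \<le> B"
    using \<open>bounded (range u\<^sub>0)\<close> by (auto simp: bounded_iff)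
  have \<sigma>1: "(INF x. \<sigma> x) \<le> \<sigma> y" for y
    using \<open>\<And>x. 0 < \<sigma> x\<close> by (intro cINF_lower bdd_belowI[of _ 0]) (auto intro: less_imp_le)
  have \<sigma>2: "\<sigma> y \<le> (SUP x. \<sigma> x)" for y
    using \<open>bdd_above (range \<sigma>)\<close> by (intro cSUP_upper) auto
  obtain v where sol: "\<And>n. 1 \<le> n \<Longrightarrow> classical_solution M W \<sigma> (\<lambda>y. min (b y) (real n)) u\<^sub>0 (v n)"
    and lim: "AE \<omega> in M. \<forall>t>0. \<forall>x. (\<lambda>n. ereal (v n t x \<omega>)) \<longlonglongrightarrow> u t x \<omega>"
    using \<open>minimal_solution M W \<sigma> b u\<^sub>0 u\<close> unfolding minimal_solution_def by blast
  \<comment> \<open>Stage \<open>k\<close> demands level \<open>k\<close> on the box [1/(k+2), k+1]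
    x [-(k+1), k+1]; these boxes exhaust the half-plane, and \<open>k + 2\<close> keeps the starting
    time below 1. The condition \<open>k \<le> n\<close> makes the selected truncations tend to
    infinity, so that they still compute the limit \<open>u\<close>.\<close>
  define Q where "Q k n F \<longleftrightarrow> k \<le> n \<and> F \<in> sets M \<and> prob F \<le> (1 / 2) ^ k \<and>
      (AE \<omega> in M. \<omega> \<notin> F \<longrightarrow> (\<forall>t x. 1 / (real k + 2) \<le> t \<longrightarrow> t \<le> real (Suc k) \<longrightarrow> \<bar>x\<bar> \<le> real (Suc k) \<longrightarrow> real k \<le> v n t x \<omega>))" for k n F
  have "\<exists>n F. Q k n F" for k
  proof -
    \<comment> \<open>The tolerance is a third of 2^(-k), because the exceptional event may have
      three times the tolerance.\<close>
    have "\<exists>n\<^sub>0. \<forall>n\<ge>n\<^sub>0. \<forall>v. random_field_solution M W \<sigma> (\<lambda>y. min (b y) (real n)) u\<^sub>0 v \<longrightarrow>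
      (AE \<omega> in M. continuous_on ({0<..} \<times> UNIV) (\<lambda>(t, x). v t x \<omega>)) \<longrightarrow>
      (\<exists>F\<in>sets M. prob F \<le> 3 * ((1 / 2) ^ k / 3) \<and>
        (AE \<omega> in M. \<omega> \<notin> F \<longrightarrow> (\<forall>t x. 1 / (real k + 2) \<le> t \<longrightarrow> t \<le> real (Suc k) \<longrightarrow> \<bar>x\<bar> \<le> real (Suc k) \<longrightarrow> real k \<le> v t x \<omega>)))"
      by (rule high_probability[OF \<open>mono b\<close> \<open>\<And>x. 0 < b x\<close> summ B \<sigma>1 \<sigma>2 \<open>0 < (INF x. \<sigma> x)\<close>]) auto
    then obtain n\<^sub>0 where n0: "\<And>n v. n\<^sub>0 \<le> n \<Longrightarrow> random_field_solution M W \<sigma> (\<lambda>y. min (b y) (real n)) u\<^sub>0 v \<Longrightarrow>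
      AE \<omega> in M. continuous_on ({0<..} \<times> UNIV) (\<lambda>(t, x). v t x \<omega>) \<Longrightarrow>
      \<exists>F\<in>sets M. prob F \<le> 3 * ((1 / 2) ^ k / 3) \<and>
        (AE \<omega> in M. \<omega> \<notin> F \<longrightarrow> (\<forall>t x. 1 / (real k + 2) \<le> t \<longrightarrow> t \<le> real (Suc k) \<longrightarrow> \<bar>x\<bar> \<le> real (Suc k) \<longrightarrow> real k \<le> v t x \<omega>))"
      by blast
    \<comment> \<open>The successor keeps \<open>n\<close> at least 1, where a solution is
      available, and above \<open>k\<close>.\<close>
    define n where "n = max n\<^sub>0 (Suc k)"
    have "classical_solution M W \<sigma> (\<lambda>y. min (b y) (real n)) u\<^sub>0 (v n)" by (rule sol) (simp add: n_def)
    then obtain F where "F \<in> sets M" "prob F \<le> 3 * ((1 / 2) ^ k / 3)"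
      "AE \<omega> in M. \<omega> \<notin> F \<longrightarrow> (\<forall>t x. 1 / (real k + 2) \<le> t \<longrightarrow> t \<le> real (Suc k) \<longrightarrow> \<bar>x\<bar> \<le> real (Suc k) \<longrightarrow> real k \<le> v n t x \<omega>)"
      using n0[of n "v n"] unfolding classical_solution_def by (auto simp: n_def)
    then have "Q k n F" by (auto simp: Q_def n_def)
    then show ?thesis by blast
  qed
  then obtain n F where "\<And>k. Q k (n k) (F k)" by metis
  then have n: "\<And>k. k \<le> n k" and F: "\<And>k. F k \<in> sets M" "\<And>k. prob (F k) \<le> (1 / 2) ^ k"
    and good: "\<And>k. AE \<omega> in M. \<omega> \<notin> F k \<longrightarrow> (\<forall>t x. 1 / (real k + 2) \<le> t \<longrightarrow> t \<le> real (Suc k) \<longrightarrow> \<bar>x\<bar> \<le> real (Suc k) \<longrightarrow> real k \<le> v (n k) t x \<omega>)"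
    by (auto simp: Q_def)
  have "AE \<omega> in M. \<forall>\<^sub>F k in sequentially. \<omega> \<in> space M - F k"
  proof (rule borel_cantelli_AE1)
    show "summable (\<lambda>k. prob (F k))"
      by (rule summable_comparison_test[of _ "\<lambda>k. (1 / 2) ^ k"]) (use F in \<open>auto intro: summable_geometric\<close>)
  qed (use F in \<open>auto simp: less_top[symmetric]\<close>)
  moreover have "AE \<omega> in M. \<forall>k. \<omega> \<notin> F k \<longrightarrow> (\<forall>t x. 1 / (real k + 2) \<le> t \<longrightarrow> t \<le> real (Suc k) \<longrightarrow> \<bar>x\<bar> \<le> real (Suc k) \<longrightarrow> real k \<le> v (n k) t x \<omega>)"
    using good by (simp add: AE_all_countable)
  ultimately have "AE \<omega> in M. \<forall>t>0. \<forall>x. u t x \<omega> = \<infinity>"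
    using lim
  proof eventually_elim
    case (elim \<omega>)
    note g = elim(2)
    show ?case
    proof (intro allI impI)
      fix t x :: real assume t: "0 < t"
      have "filterlim n at_top sequentially"
        by (rule filterlim_at_top_mono[OF filterlim_ident]) (use n in auto)
      moreover have "(\<lambda>n. ereal (v n t x \<omega>)) \<longlonglongrightarrow> u t x \<omega>" using elim(3) t by blast
      ultimately have l: "(\<lambda>k. ereal (v (n k) t x \<omega>)) \<longlonglongrightarrow> u t x \<omega>"
        by (rule filterlim_compose[rotated])
      have "\<forall>\<^sub>F k in sequentially. max (1 / t) (max t \<bar>x\<bar>) \<le> real k"
        using filterlim_real_sequentially unfolding filterlim_at_top by blast
      then have "\<forall>\<^sub>F k in sequentially. ereal (real k) \<le> ereal (v (n k) t x \<omega>)"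
        using elim(1)
      proof eventually_elim
        case (elim k)
        have "1 \<le> real k * t" using elim(1) t by (simp add: divide_le_eq)
        then have "1 / (real k + 2) \<le> t" using t by (simp add: divide_le_eq algebra_simps)
        then show ?case using elim g by auto
      qed
      moreover have "(\<lambda>k. ereal (real k)) \<longlonglongrightarrow> \<infinity>" by (rule tendsto_PInfty_eq_at_top[THEN iffD2]) (rule filterlim_real_sequentially)
      ultimately have "\<infinity> \<le> u t x \<omega>"
        using l by (intro tendsto_le[OF trivial_limit_sequentially, of _ "u t x \<omega>"]) auto
      then show "u t x \<omega> = \<infinity>" by simp
    qed
  qed
  \<comment> \<open>The event ranges over uncountably many points of a field known only as an almost
    sure limit; its measurability comes from completeness of \<open>M\<close>.\<close>
  then obtain Z where Z: "{\<omega> \<in> space M. \<not> (\<forall>t>0. \<forall>x. u t x \<omega> = \<infinity>)} \<subseteq> Z" "Z \<in> null_sets M"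
    by (auto elim!: AE_E simp: null_sets_def)
  then have s: "{\<omega> \<in> space M. \<not> (\<forall>t>0. \<forall>x. u t x \<omega> = \<infinity>)} \<in> sets M"
    by (rule complete_measure.complete[OF \<open>complete_measure M\<close>])
  have "space M - {\<omega> \<in> space M. \<not> (\<forall>t>0. \<forall>x. u t x \<omega> = \<infinity>)} = {\<omega> \<in> space M. \<forall>t>0. \<forall>x. u t x \<omega> = \<infinity>}" by blast
  then have "{\<omega> \<in> space M. \<forall>t>0. \<forall>x. u t x \<omega> = \<infinity>} \<in> sets M" using sets.compl_sets[OF s] by simp
  then show ?thesis
    using \<open>AE \<omega> in M. \<forall>t>0. \<forall>x. u t x \<omega> = \<infinity>\<close> by (subst prob_eq_1) auto
qed

end
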